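(* Let $N\ge 1$, $R>0$, and let $F:S_N\times\mathbb{R}^N\times\mathbb{R}\times \overline{B_R}\to\mathbb{R}$ be continuous and satisfy (F1), (F2), (F3) and (F4) (as stated in the context). Then the eigenvalue problem $$F(D^2u,Du,u,x)=-\lambda u\ \text{ in } B_R,\qquad u=0\ \text{ on }\partial B_R,$$ possesses two sequences $\{(\lambda_n^+,u_n^+)\}_{n\ge 0}$ and $\{(\lambda_n^-,u_n^-)\}_{n\ge 0}$ of classical radially symmetric solutions such that, for each $n$, both $u_n^+$ and $u_n^-$ (as functions of $r=|x|$) have $n$ interior zeros $r_1<\dots<r_n$ in $(0,R)$ (the zeros depending on $n$ and on the sign $\pm$), and $u_n^+$ (resp. $u_n^-$) is positive (resp. negative) in the interval $(0,r_1)$, with the convention $r_1=R$ if $n=0$. Moreover, the sequences $\{\lambda_n^+\}$ and $\{\lambda_n^-\}$ are increasing, and the sequences $\{(\lambda^\pm_n,u^\pm_n)\}$ are complete in the sense that there are no radially symmetric eigenpairs of the problem outside of them (eigenfunctions being considered up to multiplication by positive constants).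
   Context: $S_N$ is the set of symmetric $N\times N$ real matrices, $B_R$ is the ball of radius $R$ centered at the origin of $\mathbb{R}^N$. For constants $\Lambda\ge\lambda>0$, the Pucci operators are $\mathcal{M}^+_{\lambda,\Lambda}(M)=\Lambda\sum_{e_i>0}e_i+\lambda\sum_{e_i<0}e_i$ and $\mathcal{M}^-_{\lambda,\Lambda}(M)=\lambda\sum_{e_i>0}e_i+\Lambda\sum_{e_i<0}e_i$, where $e_i$ are the eigenvalues of $M\in S_N$. An eigenpair is a pair $(\lambda,u)$ with $\lambda\in\mathbb{R}$ and $u\not\equiv 0$ a classical solution. (F1) $F(sM,sp,su,x)=sF(M,p,u,x)$ for all $s\ge 0$ and all $(M,p,u,x)$. (F2) There are numbers $\Lambda\ge\lambda>0$ and $\gamma,\delta>0$ such that for all $M,M'\in S_N$, $p,q\in\mathbb{R}^N$, $u,v\in\mathbb{R}$ and all $x$: $$\mathcal{M}^-_{\lambda,\Lambda}(M-M')-\gamma|p-q|-\delta|u-v|\le F(M,p,u,x)-F(M',q,v,x)\le \mathcal{M}^+_{\lambda,\Lambda}(M-M')+\gamma|p-q|+\delta|u-v|.$$ (F3) For all $M,M'\in S_N$, $p,q\in\mathbb{R}^N$, $u,v\in\mathbb{R}$ and all $x$: $-F(M'-M,q-p,v-u,x)\le F(M,p,u,x)-F(M',q,v,x)\le F(M-M',p-q,u-v,x)$. (F4) $F$ is radially invariant: for all $m,p,u\in\mathbb{R}$ and $x\neq 0$, $r=|x|$, the quantity $F\big(\tfrac{p}{r}I+(m-\tfrac{p}{r})\tfrac{x\otimes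 x}{r^2},\,\tfrac{p}{r}x,\,u,\,x\big)$ depends on $x$ only through $r$. *)

theory Defs
  imports "HOL-Analysis.Analysis"
begin

definition sym_mats :: "(real^'n^'n) set" where
  "sym_mats = {M. transpose M = M}"

definition eigenspace :: "real^'n^'n \<Rightarrow> real \<Rightarrow> (real^'n) set" where
  "eigenspace M e = {v. M *v v = e *\<^sub>R v}"

definition eigenvalues :: "real^'n^'n \<Rightarrow> real set" where
  "eigenvalues M = {e. \<exists>v. v \<noteq> 0 \<and> M *v v = e *\<^sub>R v}"

text \<open>The Pucci operators sum over the eigenvalues repeated according to multiplicity; the
  operators are only used for symmetric matrices, for which the multiplicity of an eigenvalue is
  the dimension of its eigenspace. The sums range over a finite set, see
  \<open>finite_eigenvalues\<close>.\<close>

definition pucci_plus :: "real \<Rightarrow> real \<Rightarrow> real^'n^'n \<Rightarrow> real" where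
  "pucci_plus l L M =
     L * (\<Sum>e | e \<in> eigenvalues M \<and> e > 0. real (dim (eigenspace M e)) * e) +
     l * (\<Sum>e | e \<in> eigenvalues M \<and> e < 0. real (dim (eigenspace M e)) * e)"

definition pucci_minus :: "real \<Rightarrow> real \<Rightarrow> real^'n^'n \<Rightarrow> real" where
  "pucci_minus l L M =
     l * (\<Sum>e | e \<in> eigenvalues M \<and> e > 0. real (dim (eigenspace M e)) * e) +
     L * (\<Sum>e | e \<in> eigenvalues M \<and> e < 0. real (dim (eigenspace M e)) * e)"

lemma finite_eigenvalues:
  fixes M :: "real^'n^'n"
  assumes "M \<in> sym_mats"
  shows "finite (eigenvalues M)"
proof -
  define v where "v e = (SOME v. v \<noteq> 0 \<and> M *v v = e *\<^sub>R v)" for e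
  have v: "v e \<noteq> 0" "M *v v e = e *\<^sub>R v e" if "e \<in> eigenvalues M" for e
    using that someI_ex[of "\<lambda>v. v \<noteq> 0 \<and> M *v v = e *\<^sub>R v"]
    unfolding eigenvalues_def v_def by auto
  have self_adjoint: "(M *v x) \<bullet> y = x \<bullet> (M *v y)" for x y
  proof -
    have "M *v x = x v* M"
      using assms transpose_matrix_vector[of M x] unfolding sym_mats_def by auto
    then show ?thesis using dot_lmul_matrix[of x M y] by (simp only:)
  qed
  have orth: "v a \<bullet> v b = 0" if "a \<in> eigenvalues M" "b \<in> eigenvalues M" "a \<noteq> b" for a b
  proof -
    have "a * (v a \<bullet> v b) = b * (v a \<bullet> v b)"
      using self_adjoint[of "v a" "v b"] unfolding v(2)[OF that(1)] v(2)[OF that(2)]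
      by (simp only: inner_scaleR_left inner_scaleR_right)
    then show ?thesis using that(3) unfolding mult_cancel_right by blast
  qed
  have inj: "inj_on v (eigenvalues M)"
  proof (rule inj_onI, rule ccontr)
    fix a b assume ab: "a \<in> eigenvalues M" "b \<in> eigenvalues M" "v a = v b" "a \<noteq> b"
    then have "v b \<bullet> v b = 0" using orth[OF ab(1,2,4)] unfolding ab(3) by blast
    then show False using v(1)[OF ab(2)] unfolding inner_eq_zero_iff by blast
  qed
  have "pairwise orthogonal (v ` eigenvalues M)"
    unfolding pairwise_def orthogonal_def using orth by blast
  moreover have "0 \<notin> v ` eigenvalues M"
    using v(1) by fastforce
  ultimately have "finite (v ` eigenvalues M)"
    by (intro independent_imp_finite pairwise_orthogonal_independent)
  then show ?thesis using finite_imageD[OF _ inj] by blast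
qed

text \<open>The arguments of the operator \<open>F M p u x\<close> are only meaningful for symmetric \<open>M\<close> and for
  \<open>x\<close> in the closed ball of radius \<open>R\<close>; all conditions are relativised accordingly.\<close>

type_synonym 'n nonlin = "real^'n^'n \<Rightarrow> real^'n \<Rightarrow> real \<Rightarrow> real^'n \<Rightarrow> real"

definition F_continuous :: "real \<Rightarrow> 'n::finite nonlin \<Rightarrow> bool" where
  "F_continuous R F \<longleftrightarrow>
     continuous_on (sym_mats \<times> UNIV \<times> UNIV \<times> cball 0 R) (\<lambda>(M, p, u, x). F M p u x)"

definition F1 :: "real \<Rightarrow> 'n::finite nonlin \<Rightarrow> bool" where
  "F1 R F \<longleftrightarrow>
     (\<forall>s\<ge>0. \<forall>M\<in>sym_mats. \<forall>p u. \<forall>x\<in>cball 0 R.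
        F (s *\<^sub>R M) (s *\<^sub>R p) (s * u) x = s * F M p u x)"

definition F2 :: "real \<Rightarrow> 'n::finite nonlin \<Rightarrow> bool" where
  "F2 R F \<longleftrightarrow>
     (\<exists>l L \<gamma> \<delta>. 0 < l \<and> l \<le> L \<and> 0 < \<gamma> \<and> 0 < \<delta> \<and>
        (\<forall>M\<in>sym_mats. \<forall>M'\<in>sym_mats. \<forall>p q u v. \<forall>x\<in>cball 0 R.
           pucci_minus l L (M - M') - \<gamma> * norm (p - q) - \<delta> * \<bar>u - v\<bar>
             \<le> F M p u x - F M' q v x \<and>
           F M p u x - F M' q v x
             \<le> pucci_plus l L (M - M') + \<gamma> * norm (p - q) + \<delta> * \<bar>u - v\<bar>))"

definition F3 :: "real \<Rightarrow> 'n::finite nonlin \<Rightarrow> bool" where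
  "F3 R F \<longleftrightarrow>
     (\<forall>M\<in>sym_mats. \<forall>M'\<in>sym_mats. \<forall>p q u v. \<forall>x\<in>cball 0 R.
        - F (M' - M) (q - p) (v - u) x \<le> F M p u x - F M' q v x \<and>
        F M p u x - F M' q v x \<le> F (M - M') (p - q) (u - v) x)"

definition tensor :: "real^'n \<Rightarrow> real^'n \<Rightarrow> real^'n^'n" where
  "tensor x y = (\<chi> i j. x $ i * y $ j)"

text \<open>The Hessian at \<open>x \<noteq> 0\<close> of a radial function with first and second radial derivatives
  \<open>p\<close> and \<open>m\<close> at \<open>r = |x|\<close>. The gradient argument in \<open>F4\<close> is \<open>(p / r) x\<close>.\<close>

definition radial_hessian :: "real \<Rightarrow> real \<Rightarrow> real^'n \<Rightarrow> real^'n^'n" where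
  "radial_hessian m p x =
     (p / norm x) *\<^sub>R mat 1 + ((m - p / norm x) / (norm x)\<^sup>2) *\<^sub>R tensor x x"

definition F4 :: "real \<Rightarrow> 'n::finite nonlin \<Rightarrow> bool" where
  "F4 R F \<longleftrightarrow>
     (\<forall>m p u. \<forall>x \<in> cball 0 R - {0}. \<forall>y \<in> cball 0 R - {0}. norm x = norm y \<longrightarrow>
        F (radial_hessian m p x) ((p / norm x) *\<^sub>R x) u x =
        F (radial_hessian m p y) ((p / norm y) *\<^sub>R y) u y)"

definition grad :: "(real^'n \<Rightarrow> real) \<Rightarrow> real^'n \<Rightarrow> real^'n" where
  "grad u x = (\<chi> i. frechet_derivative u (at x) (axis i 1))"

definition hessian :: "(real^'n \<Rightarrow> real) \<Rightarrow> real^'n \<Rightarrow> real^'n^'n" where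
  "hessian u x = jacobian (grad u) (at x)"

definition C2_on :: "(real^'n) set \<Rightarrow> (real^'n \<Rightarrow> real) \<Rightarrow> bool" where
  "C2_on S u \<longleftrightarrow>
     (\<forall>x\<in>S. u differentiable (at x)) \<and> (\<forall>x\<in>S. grad u differentiable (at x)) \<and>
     continuous_on S (hessian u)"

text \<open>Classical solutions are of class \<open>C\<^sup>2\<close> in the open ball and continuous up to the
  boundary. Functions on the closed ball are represented by total functions; their values
  outside are irrelevant.\<close>

definition eigenpair :: "real \<Rightarrow> 'n::finite nonlin \<Rightarrow> real \<Rightarrow> (real^'n \<Rightarrow> real) \<Rightarrow> bool" where
  "eigenpair R F \<mu> u \<longleftrightarrow>
     C2_on (ball 0 R) u \<and> continuous_on (cball 0 R) u \<and>
     (\<forall>x\<in>ball 0 R. F (hessian u x) (grad u x) (u x) x = - \<mu> * u x) \<and>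
     (\<forall>x\<in>sphere 0 R. u x = 0) \<and>
     (\<exists>x\<in>cball 0 R. u x \<noteq> 0)"

definition has_profile :: "real \<Rightarrow> (real^'n \<Rightarrow> real) \<Rightarrow> (real \<Rightarrow> real) \<Rightarrow> bool" where
  "has_profile R u \<phi> \<longleftrightarrow> (\<forall>x\<in>cball 0 R. u x = \<phi> (norm x))"

definition radially_symmetric :: "real \<Rightarrow> (real^'n \<Rightarrow> real) \<Rightarrow> bool" where
  "radially_symmetric R u \<longleftrightarrow> (\<exists>\<phi>. has_profile R u \<phi>)"

text \<open>The zeros of \<open>\<phi>\<close> in \<open>(0, R)\<close> are exactly \<open>r 1 < \<dots> < r n\<close>.\<close>

definition interior_zeros :: "real \<Rightarrow> nat \<Rightarrow> (real \<Rightarrow> real) \<Rightarrow> (nat \<Rightarrow> real) \<Rightarrow> bool" where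
  "interior_zeros R n \<phi> r \<longleftrightarrow>
     strict_mono_on {1..n} r \<and> {s \<in> {0<..<R}. \<phi> s = 0} = r ` {1..n}"

definition first_zero :: "real \<Rightarrow> nat \<Rightarrow> (nat \<Rightarrow> real) \<Rightarrow> real" where
  "first_zero R n r = (if n = 0 then R else r 1)"

definition same_eigenfunction :: "real \<Rightarrow> (real^'n \<Rightarrow> real) \<Rightarrow> (real^'n \<Rightarrow> real) \<Rightarrow> bool" where
  "same_eigenfunction R u v \<longleftrightarrow> (\<exists>c>0. \<forall>x\<in>cball 0 R. u x = c * v x)"

end

theory Submission
  imports Defs
begin

text \<open>Along a radial function the equation becomes \<open>H u'' (u' / r) u' u r = - \<mu> u\<close> with
  \<open>H\<close> strictly increasing in \<open>u''\<close>, so it can be solved for \<open>u''\<close>. For each \<open>\<mu>\<close> there is exactly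
  one solution with \<open>u 0 = 1\<close>, \<open>u' 0 = 0\<close>, and by positive homogeneity every radial solution is a
  nonnegative multiple of it or of the solution of the reflected problem \<open>- F (- M) (- p) (- u) x\<close>.
  Homogeneity also gives a closed first-order equation \<open>\<theta>' = \<Phi>(r, \<theta>, \<mu>)\<close> for the Pruefer
  angle, with \<open>\<Phi>\<close> nondecreasing in \<open>\<mu>\<close>. Hence \<open>\<theta>(R, \<mu>)\<close> is continuous and strictly increasing
  in \<open>\<mu>\<close>; it is negative for very negative \<open>\<mu>\<close> and unbounded above. The angle crosses the levels
  \<open>\<pi>/2 + k \<pi>\<close>, which are the zeros of \<open>u\<close>, only upwards, so the \<open>n\<close>-th eigenvalue is the unique
  solution of \<open>\<theta>(R, \<mu>) = \<pi>/2 + n \<pi>\<close>.\<close>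

text \<open>The obstacle is the singular variable \<open>u' / r\<close>. The solved equation has
  Lipschitz constant \<open>K / l\<close> in it, which is at least 1, so plain Picard iteration need
  not contract at the origin. The angle equation is singular there too, so angle comparison runs
  only on \<open>{e..R}\<close> with \<open>e > 0\<close>. Monotonicity in \<open>u' / r\<close>
  helps repeatedly: it yields the contraction, it gives uniqueness from the origin onwards, and it
  orders the values of \<open>u''\<close> at the origin for different \<open>\<mu>\<close>, which
  starts the comparison.

  Positive homogeneity suffices to cancel the radius in the angle equation, but it relates nothing
  to negative multiples. The angle equation is therefore in general not \<open>pi\<close>-periodic:
  positive and negative nodal intervals obey different equations. Hence there are two families, and
  the angle is followed on the real line and not modulo \<open>pi\<close>. One equation covers both
  signs of \<open>u\<close>, so no gluing of solutions at the zeros is required.\<close>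

section \<open>The implicit radial equation\<close>

text \<open>The arguments \<open>a\<close>, \<open>b\<close>, \<open>p\<close>, \<open>u\<close>,
  \<open>r\<close> stand for \<open>u''\<close>, \<open>u' / r\<close>, \<open>u'\<close>,
  \<open>u\<close> and the radius. Strict growth is required in \<open>a\<close> only: in dimension
  1 there are no tangential directions and \<open>H\<close> does not depend on \<open>b\<close>. One
  constant \<open>K\<close> serves for all upper bounds.\<close>

locale radial_problem =
  fixes H :: "real \<Rightarrow> real \<Rightarrow> real \<Rightarrow> real \<Rightarrow> real \<Rightarrow> real" and R l K :: real
  assumes R_pos: "R > 0" and l_pos: "l > 0"
    and H_cont: "continuous_on UNIV (\<lambda>(a, b, p, u, r). H a b p u r)"
    and H_hom: "s \<ge> 0 \<Longrightarrow> H (s * a) (s * b) (s * p) (s * u) r = s * H a b p u r"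
    and H_a_lower: "a' \<le> a \<Longrightarrow> l * (a - a') \<le> H a b p u r - H a' b p u r"
    and H_a_upper: "a' \<le> a \<Longrightarrow> H a b p u r - H a' b p u r \<le> K * (a - a')"
    and H_b_mono: "b' \<le> b \<Longrightarrow> H a b' p u r \<le> H a b p u r"
    and H_b_upper: "b' \<le> b \<Longrightarrow> H a b p u r - H a b' p u r \<le> K * (b - b')"
    and H_pu: "\<bar>H a b p u r - H a b p' u' r\<bar> \<le> K * (\<bar>p - p'\<bar> + \<bar>u - u'\<bar>)"
begin

lemma l_le_K: "l \<le> K"
  using H_a_lower[of 0 1 0 0 0 0] H_a_upper[of 0 1 0 0 0 0] by simp

lemma K_pos: "K > 0"
  using l_le_K l_pos by linarith

lemma H_zero: "H 0 0 0 0 r = 0"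
  using H_hom[of 0 0 0 0 0 r] by simp

lemma H_a_dist: "l * \<bar>a - a'\<bar> \<le> \<bar>H a b p u r - H a' b p u r\<bar>"
proof (cases "a' \<le> a")
  case True
  then show ?thesis using H_a_lower[OF True, of b p u r] by linarith
next
  case False
  then have "a \<le> a'" by simp
  from H_a_lower[OF this, of b p u r] show ?thesis
    using \<open>a \<le> a'\<close> by (simp add: abs_if)
qed

lemma H_b_dist: "\<bar>H a b p u r - H a b' p u r\<bar> \<le> K * \<bar>b - b'\<bar>"
  using H_b_mono[of b' b a p u r] H_b_upper[of b' b a p u r]
    H_b_mono[of b b' a p u r] H_b_upper[of b b' a p u r]
  by (cases "b' \<le> b") (auto simp: abs_if)

lemma H_less_iff: "H a b p u r < H a' b p u r \<longleftrightarrow> a < a'"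
proof
  assume "a < a'"
  then have "l * (a' - a) > 0" using l_pos by simp
  then show "H a b p u r < H a' b p u r" using H_a_lower[of a a' b p u r] \<open>a < a'\<close> by linarith
next
  assume *: "H a b p u r < H a' b p u r"
  show "a < a'"
  proof (rule ccontr)
    assume "\<not> a < a'"
    then have "a' \<le> a" by simp
    from H_a_lower[OF this, of b p u r] l_pos \<open>a' \<le> a\<close> have "H a' b p u r \<le> H a b p u r"
      by (smt (verit) mult_nonneg_nonneg)
    then show False using * by simp
  qed
qed

lemma H_le_iff: "H a b p u r \<le> H a' b p u r \<longleftrightarrow> a \<le> a'"
  using H_less_iff[of a' b p u r a] by linarith

lemma H_eq_iff: "H a b p u r = H a' b p u r \<longleftrightarrow> a = a'"
  by (metis H_less_iff less_irrefl linorder_less_linear)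

lemma continuous_H:
  assumes "continuous_on S f1" "continuous_on S f2" "continuous_on S f3" "continuous_on S f4"
    "continuous_on S f5"
  shows "continuous_on S (\<lambda>x. H (f1 x) (f2 x) (f3 x) (f4 x) (f5 x))"
proof -
  have "continuous_on S (\<lambda>x. (f1 x, f2 x, f3 x, f4 x, f5 x))"
    by (intro continuous_intros assms)
  from continuous_on_compose2[OF H_cont this] show ?thesis by simp
qed

lemma H_surj: "\<exists>a. H a b p u r = c"
proof -
  define h where "h = H 0 b p u r"
  define m where "m = \<bar>c - h\<bar> / l"
  have m: "m \<ge> 0" "l * m = \<bar>c - h\<bar>" using l_pos by (auto simp: m_def)
  have "c \<le> H m b p u r" using H_a_lower[OF m(1), of b p u r] m h_def by simp
  moreover have "H (- m) b p u r \<le> c"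
    using H_a_lower[of "- m" 0 b p u r] m h_def by simp
  moreover have "continuous_on {- m..m} (\<lambda>a. H a b p u r)"
    by (intro continuous_H continuous_intros)
  ultimately show ?thesis using IVT'[of "\<lambda>a. H a b p u r" "- m" c m] m(1) by auto
qed

text \<open>The equation \<open>H u'' (u' / r) u' u r = - \<mu> u\<close> is solved for \<open>u''\<close>.\<close>

definition acc :: "real \<Rightarrow> real \<Rightarrow> real \<Rightarrow> real \<Rightarrow> real \<Rightarrow> real" where
  "acc b p u r \<mu> = (THE a. H a b p u r = - \<mu> * u)"

lemma H_acc: "H (acc b p u r \<mu>) b p u r = - \<mu> * u"
proof -
  obtain a where a: "H a b p u r = - \<mu> * u" using H_surj by blast
  have "acc b p u r \<mu> = a"
    unfolding acc_def
  proof (rule the_equality)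
    show "H a b p u r = - \<mu> * u" by (rule a)
    show "a' = a" if "H a' b p u r = - \<mu> * u" for a'
      using that a H_eq_iff[of a' b p u r a] by simp
  qed
  with a show ?thesis by simp
qed

lemma acc_eq_iff: "acc b p u r \<mu> = a \<longleftrightarrow> H a b p u r = - \<mu> * u"
  using H_acc[of b p u r \<mu>] H_eq_iff[of "acc b p u r \<mu>" b p u r a] by auto

lemma less_acc_iff: "a < acc b p u r \<mu> \<longleftrightarrow> H a b p u r < - \<mu> * u"
  using H_acc[of b p u r \<mu>] H_less_iff[of a b p u r "acc b p u r \<mu>"] by simp

lemma acc_hom:
  assumes "s \<ge> 0"
  shows "acc (s * b) (s * p) (s * u) r \<mu> = s * acc b p u r \<mu>"
  by (simp add: acc_eq_iff H_hom[OF assms] H_acc)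

lemma acc_zero: "acc 0 0 0 r \<mu> = 0"
  by (simp add: acc_eq_iff H_zero)

text \<open>The residual of a trial value, divided by \<open>l\<close>, bounds its distance to the
  root. Continuity and Lipschitz dependence of \<open>acc\<close> both come from testing the root
  for one set of arguments in the equation for another.\<close>

lemma acc_dist: "l * \<bar>a - acc b p u r \<mu>\<bar> \<le> \<bar>H a b p u r + \<mu> * u\<bar>"
  using H_a_dist[of a "acc b p u r \<mu>" b p u r] by (simp add: H_acc)

lemma continuous_acc:
  assumes "continuous_on S f2" "continuous_on S f3" "continuous_on S f4"
    "continuous_on S f5" "continuous_on S f6"
  shows "continuous_on S (\<lambda>x. acc (f2 x) (f3 x) (f4 x) (f5 x) (f6 x))"
proof -
  let ?A = "\<lambda>x. acc (f2 x) (f3 x) (f4 x) (f5 x) (f6 x)"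
  have "(?A \<longlongrightarrow> ?A y) (at y within S)" if y: "y \<in> S" for y
  proof -
    \<comment> \<open>The root at \<open>y\<close> is frozen; \<open>h\<close> is its scaled
      residual at nearby arguments.\<close>
    define h where "h x = (H (?A y) (f2 x) (f3 x) (f4 x) (f5 x) + f6 x * f4 x) / l" for x
    have "continuous_on S h"
      unfolding h_def using l_pos assms by (intro continuous_intros continuous_H) auto
    then have "(h \<longlongrightarrow> h y) (at y within S)"
      using y by (simp add: continuous_on)
    moreover have "h y = 0" by (simp add: h_def H_acc)
    ultimately have "((\<lambda>x. \<bar>h x\<bar>) \<longlongrightarrow> 0) (at y within S)"
      by (simp add: tendsto_rabs_zero)
    moreover have "\<forall>\<^sub>F x in at y within S. norm (?A x - ?A y) \<le> \<bar>h x\<bar>"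
    proof (rule always_eventually, rule allI)
      fix x
      have "\<bar>?A y - ?A x\<bar> * l \<le> \<bar>h x\<bar> * l"
        using acc_dist[of "?A y" "f2 x" "f3 x" "f4 x" "f5 x" "f6 x"] l_pos
        by (simp add: h_def mult.commute)
      then show "norm (?A x - ?A y) \<le> \<bar>h x\<bar>"
        using l_pos by (simp add: abs_minus_commute)
    qed
    ultimately have "((\<lambda>x. ?A x - ?A y) \<longlongrightarrow> 0) (at y within S)"
      by (rule Lim_null_comparison[rotated])
    then show ?thesis by (simp add: LIM_zero_iff)
  qed
  then show ?thesis by (simp add: continuous_on)
qed

definition Q :: real where "Q = (K + 1) / l"

lemma Q_pos: "Q > 0"
  using K_pos l_pos by (simp add: Q_def)

text \<open>The coefficient of \<open>b\<close> is kept apart and free of \<open>\<mu>\<close>,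
  because it fixes the exponent \<open>kap\<close>, which has to be the same for all
  \<open>\<mu>\<close>. The 1 in \<open>Q\<close> absorbs the term \<open>\<mu> * u\<close>.\<close>

lemma acc_lipschitz:
  "\<bar>acc b p u r \<mu> - acc b' p' u' r \<mu>\<bar>
     \<le> Q * (1 + \<bar>\<mu>\<bar>) * (\<bar>p - p'\<bar> + \<bar>u - u'\<bar>) + K / l * \<bar>b - b'\<bar>"
proof -
  let ?a = "acc b p u r \<mu>"
  have "l * \<bar>?a - acc b' p' u' r \<mu>\<bar> \<le> \<bar>H ?a b' p' u' r + \<mu> * u'\<bar>"
    by (rule acc_dist)
  also have "H ?a b' p' u' r + \<mu> * u' =
      (H ?a b' p' u' r - H ?a b p' u' r) + (H ?a b p' u' r - H ?a b p u r) + \<mu> * (u' - u)"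
    by (simp add: H_acc algebra_simps)
  also have "\<bar>\<dots>\<bar> \<le> K * \<bar>b' - b\<bar> + K * (\<bar>p' - p\<bar> + \<bar>u' - u\<bar>) + \<bar>\<mu>\<bar> * \<bar>u' - u\<bar>"
    using H_b_dist[of ?a b' p' u' r b] H_pu[of ?a b p' u' r p u]
    by (simp add: abs_mult flip: abs_mult) (smt (verit) abs_mult)
  also have "\<dots> \<le> K * \<bar>b' - b\<bar> + (K + 1) * (1 + \<bar>\<mu>\<bar>) * (\<bar>p' - p\<bar> + \<bar>u' - u\<bar>)"
  proof -
    have "0 \<le> \<bar>\<mu>\<bar> * \<bar>p' - p\<bar>" "0 \<le> K * (\<bar>\<mu>\<bar> * (\<bar>p' - p\<bar> + \<bar>u' - u\<bar>))"
      using K_pos by simp_all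
    moreover have "0 \<le> \<bar>p' - p\<bar>" "0 \<le> \<bar>u' - u\<bar>" by simp_all
    moreover have "(K + 1) * (1 + \<bar>\<mu>\<bar>) * (\<bar>p' - p\<bar> + \<bar>u' - u\<bar>) =
        K * (\<bar>p' - p\<bar> + \<bar>u' - u\<bar>) + K * (\<bar>\<mu>\<bar> * (\<bar>p' - p\<bar> + \<bar>u' - u\<bar>)) + \<bar>p' - p\<bar> + \<bar>u' - u\<bar>
        + \<bar>\<mu>\<bar> * \<bar>p' - p\<bar> + \<bar>\<mu>\<bar> * \<bar>u' - u\<bar>"
      by (simp add: algebra_simps)
    ultimately show ?thesis by linarith
  qed
  finally have "\<bar>?a - acc b' p' u' r \<mu>\<bar>
      \<le> (K * \<bar>b' - b\<bar> + (K + 1) * (1 + \<bar>\<mu>\<bar>) * (\<bar>p' - p\<bar> + \<bar>u' - u\<bar>)) / l"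
    using l_pos by (simp add: pos_le_divide_eq mult.commute)
  then show ?thesis
    by (simp add: Q_def abs_minus_commute add_divide_distrib[of "K * _"] add.commute)
qed

lemma acc_antimono_b: "b' \<le> b \<Longrightarrow> acc b p u r \<mu> \<le> acc b' p u r \<mu>"
  using H_b_mono[of b' b "acc b p u r \<mu>" p u r]
  using less_acc_iff[of "acc b' p u r \<mu>" b p u r \<mu>] H_acc[of b p u r \<mu>]
    H_le_iff[of "acc b p u r \<mu>" b' p u r "acc b' p u r \<mu>"] H_acc[of b' p u r \<mu>] by simp

lemma acc_bound: "\<bar>acc b p u r \<mu>\<bar> \<le> Q * (1 + \<bar>\<mu>\<bar>) * (\<bar>b\<bar> + \<bar>p\<bar> + \<bar>u\<bar>)"
proof -
  have "K / l \<le> Q * (1 + \<bar>\<mu>\<bar>)"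
  proof -
    have "K / l \<le> Q" using l_pos by (simp add: Q_def divide_right_mono)
    also have "\<dots> \<le> Q * (1 + \<bar>\<mu>\<bar>)" using Q_pos by simp
    finally show ?thesis .
  qed
  then have "K / l * \<bar>b\<bar> \<le> Q * (1 + \<bar>\<mu>\<bar>) * \<bar>b\<bar>" by (intro mult_right_mono) auto
  then show ?thesis
    using acc_lipschitz[of b p u r \<mu> 0 0 0] by (simp add: acc_zero distrib_left)
qed

text \<open>Adding \<open>kap * b\<close> makes the right-hand side monotone in the singular variable
  \<open>b = u' / r\<close>, with Lipschitz constant \<open>kap\<close>; the averaging with weight \<open>t ^ kap\<close> in the
  integral equation below divides that constant by \<open>kap + 1\<close> and gives a contraction.\<close>

definition kap :: nat where "kap = nat \<lceil>K / l\<rceil>"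

lemma kap_ge: "K / l \<le> real kap"
  unfolding kap_def by linarith

definition G :: "real \<Rightarrow> real \<Rightarrow> real \<Rightarrow> real \<Rightarrow> real \<Rightarrow> real" where
  "G b p u r \<mu> = acc b p u r \<mu> + real kap * b"

lemma continuous_G:
  assumes "continuous_on S f2" "continuous_on S f3" "continuous_on S f4"
    "continuous_on S f5" "continuous_on S f6"
  shows "continuous_on S (\<lambda>x. G (f2 x) (f3 x) (f4 x) (f5 x) (f6 x))"
  unfolding G_def by (intro continuous_intros continuous_acc assms)

lemma G_lipschitz:
  "\<bar>G b p u r \<mu> - G b' p' u' r \<mu>\<bar> \<le> real kap * \<bar>b - b'\<bar> + Q * (1 + \<bar>\<mu>\<bar>) * (\<bar>p - p'\<bar> + \<bar>u - u'\<bar>)"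
proof -
  have *: "\<bar>G c p u r \<mu> - G c' p u r \<mu>\<bar> \<le> real kap * \<bar>c - c'\<bar>" if "c' \<le> c" for c c' :: real
  proof -
    have "acc c p u r \<mu> \<le> acc c' p u r \<mu>" using acc_antimono_b[OF that] .
    moreover have "acc c' p u r \<mu> - acc c p u r \<mu> \<le> real kap * (c - c')"
    proof -
      have "acc c' p u r \<mu> - acc c p u r \<mu> \<le> K / l * (c - c')"
        using acc_lipschitz[of c' p u r \<mu> c p u] that by simp
      also have "\<dots> \<le> real kap * (c - c')" using kap_ge that by (intro mult_right_mono) auto
      finally show ?thesis .
    qed
    ultimately show ?thesis using that by (auto simp: G_def abs_if algebra_simps)
  qed
  have "\<bar>G b p u r \<mu> - G b' p u r \<mu>\<bar> \<le> real kap * \<bar>b - b'\<bar>"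
    using *[of b b'] *[of b' b] by (cases "b' \<le> b") (auto simp: abs_minus_commute)
  moreover have "\<bar>G b' p u r \<mu> - G b' p' u' r \<mu>\<bar> \<le> Q * (1 + \<bar>\<mu>\<bar>) * (\<bar>p - p'\<bar> + \<bar>u - u'\<bar>)"
    using acc_lipschitz[of b' p u r \<mu> b' p' u'] by (simp add: G_def)
  ultimately show ?thesis by linarith
qed

end

section \<open>The singular initial value problem\<close>

definition jointly_continuous :: "(real \<Rightarrow> real \<Rightarrow> real) \<Rightarrow> bool" where
  "jointly_continuous b \<longleftrightarrow> continuous_on UNIV (\<lambda>x. b (fst x) (snd x))"

lemma jointly_continuous_compose:
  assumes "jointly_continuous b" "continuous_on S f" "continuous_on S g"
  shows "continuous_on S (\<lambda>x. b (f x) (g x))"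
  using continuous_on_compose2[OF assms(1)[unfolded jointly_continuous_def], of S "\<lambda>x. (f x, g x)"]
    assms(2,3) by (simp add: continuous_on_Pair)

lemma continuous_on_integral_unit_interval:
  fixes f :: "'a::topological_space \<Rightarrow> real \<Rightarrow> real"
  assumes "continuous_on UNIV (\<lambda>y. f (fst y) (snd y))"
  shows "continuous_on UNIV (\<lambda>x. integral {0..1} (f x))"
proof -
  have "continuous_on (UNIV \<times> cbox 0 1) (\<lambda>(x, t). f x t)"
    using continuous_on_subset[OF assms] by (simp add: case_prod_unfold)
  from integral_continuous_on_param[OF this] show ?thesis by simp
qed

lemma has_integral_exp_unit_interval:
  fixes c s :: real
  shows "((\<lambda>t. s * c * exp (c * (s * t))) has_integral exp (c * s) - 1) {0..1}"
proof -
  have "((\<lambda>t. s * c * exp (c * (s * t))) has_integral exp (c * (s * 1)) - exp (c * (s * 0))) {0..1}"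
    by (intro fundamental_theorem_of_calculus)
      (auto intro!: derivative_eq_intros simp flip: has_real_derivative_iff_has_vector_derivative)
  then show ?thesis by simp
qed

lemma has_integral_power_unit_interval:
  "((\<lambda>t::real. t ^ n) has_integral 1 / (real n + 1)) {0..1}"
proof -
  have "((\<lambda>t::real. t ^ n) has_integral 1 ^ Suc n / real (Suc n) - 0 ^ Suc n / real (Suc n)) {0..1}"
  proof (rule fundamental_theorem_of_calculus)
    fix t :: real
    have "((\<lambda>t. t ^ Suc n / real (Suc n)) has_real_derivative t ^ n) (at t within {0..1})"
      using DERIV_cdivide[OF DERIV_pow[of "Suc n" t "{0..1}"], of "real (Suc n)"] by simp
    then show "((\<lambda>t. t ^ Suc n / real (Suc n)) has_vector_derivative t ^ n) (at t within {0..1})"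
      by (simp only: has_real_derivative_iff_has_vector_derivative)
  qed simp
  then show ?thesis by (simp add: add.commute)
qed

text \<open>The substitution \<open>s = r * t\<close>, valid also for \<open>r = 0\<close>. It links
  the form on the unit interval, which is regular at the origin, with the form that can be
  differentiated in \<open>r\<close>.\<close>

lemma integral_power_rescale:
  fixes f :: "real \<Rightarrow> real"
  assumes "continuous_on UNIV f" "r \<ge> 0"
  shows "r ^ Suc j * integral {0..1} (\<lambda>t. t ^ j * f (r * t)) = integral {0..r} (\<lambda>s. s ^ j * f s)"
proof -
  define P where "P s = integral {0..s} (\<lambda>s. s ^ j * f s)" for s
  have P: "(P has_real_derivative s ^ j * f s) (at s within {0..r})" if "s \<in> {0..r}" for s
    unfolding P_def
    by (rule integral_has_real_derivative[OF _ that])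
      (intro continuous_intros continuous_on_subset[OF assms(1)] subset_UNIV)
  have "((\<lambda>t. P (r * t)) has_real_derivative ((r * t) ^ j * f (r * t)) * r) (at t within {0..1})"
    if "t \<in> {0..1}" for t
  proof -
    have sub: "(\<lambda>t. r * t) ` {0..1} \<subseteq> {0..r}"
      using assms(2) by (auto intro: mult_left_le)
    have "(P has_real_derivative (r * t) ^ j * f (r * t)) (at (r * t) within (\<lambda>t. r * t) ` {0..1})"
      using P[of "r * t"] sub that by (meson DERIV_subset image_subset_iff)
    moreover have "((\<lambda>t. r * t) has_real_derivative r) (at t within {0..1})"
      by (auto intro!: derivative_eq_intros)
    ultimately show "((\<lambda>t. P (r * t)) has_real_derivative ((r * t) ^ j * f (r * t)) * r) (at t within {0..1})"
      using DERIV_image_chain[of P _ "\<lambda>t. r * t" t "{0..1}" r] by (simp add: o_def)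
  qed
  then have "((\<lambda>t. (r * t) ^ j * f (r * t) * r) has_integral P (r * 1) - P (r * 0)) {0..1}"
    by (intro fundamental_theorem_of_calculus)
      (auto simp flip: has_real_derivative_iff_has_vector_derivative)
  then have "integral {0..1} (\<lambda>t. (r * t) ^ j * f (r * t) * r) = P r"
    by (simp only: integral_unique) (simp add: P_def)
  also have "(\<lambda>t. (r * t) ^ j * f (r * t) * r) = (\<lambda>t. r ^ Suc j * (t ^ j * f (r * t)))"
    by (auto simp: power_mult_distrib algebra_simps)
  finally show ?thesis by (simp add: P_def)
qed

context radial_problem
begin

text \<open>With \<open>b = u' / r\<close> the initial value problem reads \<open>u = Pu b\<close> and
  \<open>(r ^ kap * u')' = r ^ kap * G\<close>; integrated and rescaled to the unit interval the latter becomes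
  \<open>b = Pb b\<close>, which makes sense at \<open>r = 0\<close>.\<close>

definition Pu :: "(real \<Rightarrow> real \<Rightarrow> real) \<Rightarrow> real \<Rightarrow> real \<Rightarrow> real" where
  "Pu b r \<mu> = 1 + r\<^sup>2 * integral {0..1} (\<lambda>t. t * b (r * t) \<mu>)"

definition Pb :: "(real \<Rightarrow> real \<Rightarrow> real) \<Rightarrow> real \<Rightarrow> real \<Rightarrow> real" where
  "Pb b r \<mu> = integral {0..1}
     (\<lambda>t. t ^ kap * G (b (r * t) \<mu>) (r * t * b (r * t) \<mu>) (Pu b (r * t) \<mu>) (r * t) \<mu>)"

lemma jointly_continuous_Pu:
  assumes "jointly_continuous b"
  shows "jointly_continuous (Pu b)"
  unfolding jointly_continuous_def Pu_def
  by (intro continuous_intros continuous_on_integral_unit_interval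
      jointly_continuous_compose[OF assms])

lemma jointly_continuous_Pb:
  assumes "jointly_continuous b"
  shows "jointly_continuous (Pb b)"
  unfolding jointly_continuous_def Pb_def
  by (intro continuous_intros continuous_on_integral_unit_interval continuous_G
      jointly_continuous_compose[OF assms]
      jointly_continuous_compose[OF jointly_continuous_Pu[OF assms]])

text \<open>An exponentially weighted (Bielecki) estimate: integrating
  \<open>k * exp (M * k * s)\<close> gains \<open>1 / M\<close> and uses up the factor
  \<open>k\<close>. The bound is thus one factor \<open>k\<close> better than the hypothesis, which
  pays for the Lipschitz factor \<open>Q * k\<close> in \<open>Pb_dist\<close>.\<close>

lemma Pu_dist:
  fixes \<mu> :: real
  defines "k \<equiv> 1 + \<bar>\<mu>\<bar>"
  assumes b: "jointly_continuous b" and b': "jointly_continuous b'"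
    and M: "M > 0" and s: "s \<in> {0..R}"
    and D: "\<And>\<sigma>. \<sigma> \<in> {0..R} \<Longrightarrow> \<bar>b \<sigma> \<mu> - b' \<sigma> \<mu>\<bar> \<le> k * exp (M * k * \<sigma>) * D"
  shows "\<bar>Pu b s \<mu> - Pu b' s \<mu>\<bar> \<le> R * D * exp (M * k * s) / M"
proof -
  have k: "k > 0" by (simp add: k_def)
  have "0 \<le> k * exp (M * k * s) * D" using D[OF s] by linarith
  moreover have "0 < k * exp (M * k * s)" using k by simp
  ultimately have D0: "D \<ge> 0" by (metis linorder_not_le mult_pos_neg)
  let ?g = "\<lambda>t. R * D / M * (s * (M * k) * exp (M * k * (s * t)))"
  have int: "continuous_on {0..1} (\<lambda>t. t * b (s * t) \<mu>)" "continuous_on {0..1} (\<lambda>t. t * b' (s * t) \<mu>)"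
    by (intro continuous_intros jointly_continuous_compose[OF b] jointly_continuous_compose[OF b'])+
  have g: "(?g has_integral R * D / M * (exp (M * k * s) - 1)) {0..1}"
    by (intro has_integral_mult_right has_integral_exp_unit_interval)
  have "Pu b s \<mu> - Pu b' s \<mu> = s\<^sup>2 * integral {0..1} (\<lambda>t. t * b (s * t) \<mu> - t * b' (s * t) \<mu>)"
    using integral_diff[OF int[THEN integrable_continuous_interval]]
    by (simp only: Pu_def) (simp add: right_diff_distrib)
  also have "\<dots> = integral {0..1} (\<lambda>t. s\<^sup>2 * (t * b (s * t) \<mu> - t * b' (s * t) \<mu>))"
    by (rule integral_mult_right[symmetric])
  finally have eq: "Pu b s \<mu> - Pu b' s \<mu> =
    integral {0..1} (\<lambda>t. s\<^sup>2 * (t * b (s * t) \<mu> - t * b' (s * t) \<mu>))" .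
  have "\<bar>Pu b s \<mu> - Pu b' s \<mu>\<bar> \<le> integral {0..1} ?g"
    unfolding real_norm_def[symmetric] eq
  proof (rule integral_norm_bound_integral)
    show "(\<lambda>t. s\<^sup>2 * (t * b (s * t) \<mu> - t * b' (s * t) \<mu>)) integrable_on {0..1}"
      by (intro integrable_continuous_interval continuous_on_mult_left continuous_on_diff int)
    show "?g integrable_on {0..1}" using g by blast
    fix t :: real assume t: "t \<in> {0..1}"
    then have st: "s * t \<in> {0..R}" using s by (auto intro: mult_left_le order_trans)
    have "norm (s\<^sup>2 * (t * b (s * t) \<mu> - t * b' (s * t) \<mu>)) = s * (s * (t * \<bar>b (s * t) \<mu> - b' (s * t) \<mu>\<bar>))"
      using t s by (simp add: abs_mult power2_eq_square flip: right_diff_distrib)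
    also have "\<dots> \<le> R * (s * (1 * (k * exp (M * k * (s * t)) * D)))"
      using s t R_pos D[OF st] by (intro mult_mono) (auto intro!: mult_nonneg_nonneg)
    also have "\<dots> = ?g t" using M by simp
    finally show "norm (s\<^sup>2 * (t * b (s * t) \<mu> - t * b' (s * t) \<mu>)) \<le> ?g t" .
  qed
  also have "\<dots> = R * D / M * (exp (M * k * s) - 1)" using g by (rule integral_unique)
  also have "\<dots> \<le> R * D / M * exp (M * k * s)"
    using R_pos D0 M by (intro mult_left_mono) auto
  finally show ?thesis by simp
qed

text \<open>Only the dependence on \<open>b\<close> is not made small by a large \<open>M\<close>;
  there the integral of \<open>t ^ kap\<close> turns the constant \<open>kap\<close> into
  \<open>kap / (kap + 1) < 1\<close>. The contributions of \<open>p\<close> and \<open>u\<close>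
  carry \<open>1 / M\<close>, the first by integrating the exponential, the second by
  \<open>Pu_dist\<close>.\<close>

lemma Pb_dist:
  fixes \<mu> :: real
  defines "k \<equiv> 1 + \<bar>\<mu>\<bar>"
  assumes b: "jointly_continuous b" and b': "jointly_continuous b'"
    and M: "M > 0" and r: "r \<in> {0..R}"
    and D: "\<And>\<sigma>. \<sigma> \<in> {0..R} \<Longrightarrow> \<bar>b \<sigma> \<mu> - b' \<sigma> \<mu>\<bar> \<le> k * exp (M * k * \<sigma>) * D"
  shows "\<bar>Pb b r \<mu> - Pb b' r \<mu>\<bar>
    \<le> (kap / (kap + 1) + Q * (1 + R) / M) * (k * exp (M * k * r) * D)"
proof -
  have k: "k > 0" by (simp add: k_def)
  have "0 \<le> k * exp (M * k * r) * D" using D[OF r] by linarith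
  moreover have "0 < k * exp (M * k * r)" using k by simp
  ultimately have D0: "D \<ge> 0" by (metis linorder_not_le mult_pos_neg)
  define E where "E = exp (M * k * r)"
  define f where "f b t = t ^ kap * G (b (r * t) \<mu>) (r * t * b (r * t) \<mu>) (Pu b (r * t) \<mu>) (r * t) \<mu>"
    for b t
  have f: "continuous_on {0..1} (f c)" if "jointly_continuous c" for c
    unfolding f_def
    by (intro continuous_intros continuous_G jointly_continuous_compose[OF that]
        jointly_continuous_compose[OF jointly_continuous_Pu[OF that]])
  \<comment> \<open>The summands majorize the dependence on \<open>b\<close>, \<open>p\<close> and
    \<open>u\<close>, in this order.\<close>
  let ?g = "\<lambda>t. real kap * k * E * D * t ^ kap + Q * k * D / M * (r * (M * k) * exp (M * k * (r * t)))
      + Q * k * R * D * E / M"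
  have g: "(?g has_integral real kap * k * E * D * (1 / (real kap + 1)) + Q * k * D / M * (E - 1)
      + Q * k * R * D * E / M) {0..1}"
  proof (intro has_integral_add has_integral_mult_right)
    show "((\<lambda>t. r * (M * k) * exp (M * k * (r * t))) has_integral E - 1) {0..1}"
      unfolding E_def by (rule has_integral_exp_unit_interval)
    show "((\<lambda>t::real. t ^ kap) has_integral 1 / (real kap + 1)) {0..1}"
      by (rule has_integral_power_unit_interval)
    show "((\<lambda>t::real. Q * k * R * D * E / M) has_integral Q * k * R * D * E / M) {0..1}"
      using has_integral_const_real[of "Q * k * R * D * E / M" 0 1] by simp
  qed
  have eq: "Pb b r \<mu> - Pb b' r \<mu> = integral {0..1} (\<lambda>t. f b t - f b' t)"
    unfolding Pb_def f_def[symmetric]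
    by (simp add: integral_diff integrable_continuous_interval f b b')
  have "\<bar>Pb b r \<mu> - Pb b' r \<mu>\<bar> \<le> integral {0..1} ?g"
    unfolding real_norm_def[symmetric] eq
  proof (rule integral_norm_bound_integral)
    show "(\<lambda>t. f b t - f b' t) integrable_on {0..1}"
      by (intro integrable_continuous_interval continuous_intros f b b')
    show "?g integrable_on {0..1}" using g by blast
    fix t :: real assume t: "t \<in> {0..1}"
    then have rt: "r * t \<in> {0..R}" and rtr: "r * t \<le> r" using r by (auto intro: mult_left_le order_trans)
    let ?e = "exp (M * k * (r * t))"
    have E: "?e \<le> E" using rtr M k by (simp add: E_def)
    have d: "\<bar>b (r * t) \<mu> - b' (r * t) \<mu>\<bar> \<le> k * ?e * D" using D[OF rt] .
    have "norm (f b t - f b' t) = t ^ kap *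
        \<bar>G (b (r * t) \<mu>) (r * t * b (r * t) \<mu>) (Pu b (r * t) \<mu>) (r * t) \<mu>
         - G (b' (r * t) \<mu>) (r * t * b' (r * t) \<mu>) (Pu b' (r * t) \<mu>) (r * t) \<mu>\<bar>"
      using t by (simp add: f_def abs_mult flip: right_diff_distrib)
    also have "\<dots> \<le> t ^ kap * (real kap * \<bar>b (r * t) \<mu> - b' (r * t) \<mu>\<bar>
       + Q * k * (\<bar>r * t * b (r * t) \<mu> - r * t * b' (r * t) \<mu>\<bar> + \<bar>Pu b (r * t) \<mu> - Pu b' (r * t) \<mu>\<bar>))"
      unfolding k_def using t by (intro mult_left_mono G_lipschitz) auto
    also have "\<dots> \<le> t ^ kap * (real kap * (k * E * D)
       + Q * k * (r * (k * ?e * D) + R * D * E / M))"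
    proof (intro mult_left_mono add_mono)
      show "\<bar>b (r * t) \<mu> - b' (r * t) \<mu>\<bar> \<le> k * E * D"
        using d E k D0 by (smt (verit) mult_left_mono mult_right_mono)
      have "\<bar>r * t * b (r * t) \<mu> - r * t * b' (r * t) \<mu>\<bar> = r * t * \<bar>b (r * t) \<mu> - b' (r * t) \<mu>\<bar>"
        using r t by (simp add: abs_mult flip: right_diff_distrib)
      also have "\<dots> \<le> r * (k * ?e * D)"
        using d rtr rt r by (intro mult_mono) auto
      finally show "\<bar>r * t * b (r * t) \<mu> - r * t * b' (r * t) \<mu>\<bar> \<le> r * (k * ?e * D)" .
      have "\<bar>Pu b (r * t) \<mu> - Pu b' (r * t) \<mu>\<bar> \<le> R * D * ?e / M"
        using Pu_dist[OF b b' M rt, of \<mu> D] D unfolding k_def by simp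
      also have "\<dots> \<le> R * D * E / M"
        using E R_pos D0 M by (intro divide_right_mono mult_left_mono) auto
      finally show "\<bar>Pu b (r * t) \<mu> - Pu b' (r * t) \<mu>\<bar> \<le> R * D * E / M" .
    qed (use t Q_pos k in auto)
    also have "\<dots> = real kap * k * E * D * t ^ kap + t ^ kap * (Q * k * (r * (k * ?e * D) + R * D * E / M))"
      by (simp add: algebra_simps)
    also have "t ^ kap * (Q * k * (r * (k * ?e * D) + R * D * E / M)) \<le>
        1 * (Q * k * (r * (k * ?e * D) + R * D * E / M))"
      using t Q_pos k r D0 M R_pos by (intro mult_right_mono) (auto simp: E_def power_le_one)
    also have "real kap * k * E * D * t ^ kap + 1 * (Q * k * (r * (k * ?e * D) + R * D * E / M)) = ?g t"
      using M by (simp add: algebra_simps)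
    finally show "norm (f b t - f b' t) \<le> ?g t" by simp
  qed
  also have "\<dots> = real kap * k * E * D * (1 / (real kap + 1)) + Q * k * D / M * (E - 1)
      + Q * k * R * D * E / M" using g by (rule integral_unique)
  also have "\<dots> \<le> real kap * k * E * D * (1 / (real kap + 1)) + Q * k * D / M * E
      + Q * k * R * D * E / M"
    using Q_pos k D0 M by (intro add_mono mult_left_mono order_refl) auto
  also have "\<dots> = (kap / (kap + 1) + Q * (1 + R) / M) * (k * E * D)"
    by (simp add: divide_inverse algebra_simps)
  finally show ?thesis unfolding E_def .
qed

text \<open>Ensures that the fixed-point map sends bounded functions to bounded functions: the
  growth in \<open>\<mu>\<close> is just that of the weight \<open>W\<close>.\<close>

lemma Pb_zero_bound: "\<bar>Pb (\<lambda>_ _. 0) r \<mu>\<bar> \<le> Q * (1 + \<bar>\<mu>\<bar>)"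
proof -
  have "norm (Pb (\<lambda>_ _. 0) r \<mu>) \<le> (Q * (1 + \<bar>\<mu>\<bar>)) * (1 - 0)"
    unfolding Pb_def
  proof (rule integral_bound)
    show "continuous_on {0..1} (\<lambda>t. t ^ kap * G 0 (r * t * 0) (Pu (\<lambda>_ _. 0) (r * t) \<mu>) (r * t) \<mu>)"
      unfolding Pu_def by (intro continuous_intros continuous_G)
    fix t :: real assume t: "t \<in> {0..1}"
    have "\<bar>G 0 0 1 (r * t) \<mu>\<bar> \<le> Q * (1 + \<bar>\<mu>\<bar>)"
      using acc_bound[of 0 0 1 "r * t" \<mu>] by (simp add: G_def)
    moreover have "t ^ kap \<le> 1" using t by (simp add: power_le_one)
    ultimately have "t ^ kap * \<bar>G 0 0 1 (r * t) \<mu>\<bar> \<le> 1 * (Q * (1 + \<bar>\<mu>\<bar>))"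
      using t by (intro mult_mono) auto
    then show "norm (t ^ kap * G 0 (r * t * 0) (Pu (\<lambda>_ _. 0) (r * t) \<mu>) (r * t) \<mu>) \<le> Q * (1 + \<bar>\<mu>\<bar>)"
      using t by (simp add: Pu_def abs_mult)
  qed simp
  then show ?thesis by simp
qed

text \<open>The weight \<open>W\<close> makes the contraction constant independent of \<open>\<mu>\<close>, so that a single fixed
  point in the space of functions of \<open>(r, \<mu>)\<close> yields joint continuity.\<close>

lemma exists_fixed_point:
  "\<exists>b. jointly_continuous b \<and> (\<forall>r\<in>{0..R}. \<forall>\<mu>. b r \<mu> = Pb b r \<mu>)"
proof -
  \<comment> \<open>This \<open>M\<close> makes the \<open>1 / M\<close> part of the contraction
    constant equal to half of the gap \<open>1 - kap / (kap + 1)\<close>.\<close>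
  define M where "M = 2 * (real kap + 1) * Q * (1 + R)"
  define q where "q = (real kap + 1 / 2) / (real kap + 1)"
  have M: "M > 0" using Q_pos R_pos by (simp add: M_def)
  have QM: "Q * (1 + R) / M = 1 / (2 * (real kap + 1))"
    unfolding M_def mult.assoc[of _ Q]
    by (rule nonzero_divide_mult_cancel_right) (use Q_pos R_pos in auto)
  have q: "kap / (kap + 1) + Q * (1 + R) / M = q"
    unfolding QM q_def by (simp add: add_divide_distrib)
  have q01: "0 \<le> q" "q < 1" by (simp_all add: q_def)
  \<comment> \<open>Clamping the radius lets bounded continuous functions on the whole plane serve
    as the complete space.\<close>
  define c where "c r = max 0 (min R r)" for r :: real
  have c: "c r \<in> {0..R}" for r using R_pos by (auto simp: c_def)
  have c_id: "c r = r" if "r \<in> {0..R}" for r using that by (auto simp: c_def)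
  define W where "W s \<mu> = (1 + \<bar>\<mu>\<bar>) * exp (M * (1 + \<bar>\<mu>\<bar>) * s)" for s \<mu> :: real
  have W: "W s \<mu> > 0" for s \<mu> by (simp add: W_def)
  \<comment> \<open>The unknown is stored divided by its weight, so that the sup distance of the
    stored functions is the weighted distance.\<close>
  define B where "B w s \<mu> = W s \<mu> * apply_bcontfun w (s, \<mu>)" for w :: "(real \<times> real) \<Rightarrow>\<^sub>C real" and s \<mu>
  have B: "jointly_continuous (B w)" for w
    unfolding jointly_continuous_def B_def W_def by (auto intro!: continuous_intros)
  define T where "T w x = Pb (B w) (c (fst x)) (snd x) / W (c (fst x)) (snd x)" for w x
  have dist: "\<bar>T w x - T w' x\<bar> \<le> q * dist w w'" for w w' x
  proof -
    have "\<bar>B w s \<mu> - B w' s \<mu>\<bar> \<le> (1 + \<bar>\<mu>\<bar>) * exp (M * (1 + \<bar>\<mu>\<bar>) * s) * dist w w'" for s \<mu>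
      using dist_bounded[of w "(s, \<mu>)" w'] W[of s \<mu>]
      by (simp add: B_def dist_real_def abs_mult flip: right_diff_distrib W_def)
    then have "\<bar>Pb (B w) (c (fst x)) (snd x) - Pb (B w') (c (fst x)) (snd x)\<bar>
        \<le> q * (W (c (fst x)) (snd x) * dist w w')"
      using Pb_dist[OF B[of w] B[of w'] M c[of "fst x"], where \<mu> = "snd x" and D = "dist w w'"]
      unfolding q W_def by blast
    moreover have "\<bar>T w x - T w' x\<bar> =
        \<bar>Pb (B w) (c (fst x)) (snd x) - Pb (B w') (c (fst x)) (snd x)\<bar> / W (c (fst x)) (snd x)"
      using W[of "c (fst x)" "snd x"] by (simp add: T_def flip: diff_divide_distrib)
    ultimately show ?thesis
      using W[of "c (fst x)" "snd x"] by (simp add: pos_divide_le_eq ac_simps)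
  qed
  have T_zero: "\<bar>T 0 x\<bar> \<le> Q" for x
  proof -
    have "B 0 = (\<lambda>_ _. 0)" by (simp add: B_def zero_bcontfun.rep_eq fun_eq_iff)
    then have "\<bar>Pb (B 0) (c (fst x)) (snd x)\<bar> \<le> Q * (1 + \<bar>snd x\<bar>)"
      using Pb_zero_bound[of "c (fst x)" "snd x"] by simp
    also have "\<dots> \<le> Q * W (c (fst x)) (snd x)"
    proof -
      have "1 \<le> exp (M * (1 + \<bar>snd x\<bar>) * c (fst x))"
        using M c[of "fst x"] by simp
      from mult_left_mono[OF this, of "1 + \<bar>snd x\<bar>"] show ?thesis
        using Q_pos by (simp add: W_def)
    qed
    finally show ?thesis
      using W[of "c (fst x)" "snd x"] by (simp add: T_def abs_divide pos_divide_le_eq)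
  qed
  have T_mem: "T w \<in> bcontfun" for w
    unfolding bcontfun_def
  proof (intro CollectI conjI)
    have "continuous_on UNIV (\<lambda>x. Pb (B w) (c (fst x)) (snd x))"
      unfolding c_def
      by (intro jointly_continuous_compose[OF jointly_continuous_Pb[OF B]] continuous_intros)
    then show "continuous_on UNIV (T w)"
      unfolding T_def W_def c_def by (intro continuous_intros) (auto simp: c_def)
    have "\<bar>T w x\<bar> \<le> Q + q * dist w 0" for x
      using dist[of w x 0] T_zero[of x] by linarith
    then show "bounded (range (T w))" by (auto simp: bounded_iff)
  qed
  have "\<exists>!w. Bcontfun (T w) = w"
  proof (rule banach_fix_type[OF q01], intro allI)
    fix w w'
    show "dist (Bcontfun (T w)) (Bcontfun (T w')) \<le> q * dist w w'"
      by (rule dist_bound) (simp add: Bcontfun_inverse T_mem dist dist_real_def)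
  qed
  then obtain w where w: "Bcontfun (T w) = w" by blast
  then have Tw: "T w x = apply_bcontfun w x" for x
    by (metis Bcontfun_inverse T_mem)
  have "B w r \<mu> = Pb (B w) r \<mu>" if "r \<in> {0..R}" for r \<mu>
    using Tw[of "(r, \<mu>)"] W[of r \<mu>] that by (simp add: B_def T_def c_id field_simps)
  then show ?thesis using B by blast
qed

section \<open>The solution family and its derivatives\<close>

definition bsol :: "real \<Rightarrow> real \<Rightarrow> real" where
  "bsol = (SOME b. jointly_continuous b \<and> (\<forall>r\<in>{0..R}. \<forall>\<mu>. b r \<mu> = Pb b r \<mu>))"

definition usol :: "real \<Rightarrow> real \<Rightarrow> real" where "usol = Pu bsol"
definition qsol :: "real \<Rightarrow> real \<Rightarrow> real" where "qsol r \<mu> = r * bsol r \<mu>"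
definition asol :: "real \<Rightarrow> real \<Rightarrow> real" where
  "asol r \<mu> = acc (bsol r \<mu>) (qsol r \<mu>) (usol r \<mu>) r \<mu>"

lemma bsol:
  shows jointly_continuous_bsol: "jointly_continuous bsol"
    and bsol_eq: "r \<in> {0..R} \<Longrightarrow> bsol r \<mu> = Pb bsol r \<mu>"
  using someI_ex[OF exists_fixed_point] unfolding bsol_def by auto

lemma jointly_continuous_usol: "jointly_continuous usol"
  unfolding usol_def by (intro jointly_continuous_Pu jointly_continuous_bsol)

lemma jointly_continuous_qsol: "jointly_continuous qsol"
  unfolding jointly_continuous_def qsol_def
  by (intro continuous_intros jointly_continuous_compose[OF jointly_continuous_bsol])

lemma jointly_continuous_asol: "jointly_continuous asol"
  unfolding jointly_continuous_def asol_def
  by (intro continuous_acc continuous_intros jointly_continuous_compose[OF jointly_continuous_bsol]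
      jointly_continuous_compose[OF jointly_continuous_usol]
      jointly_continuous_compose[OF jointly_continuous_qsol])

lemma H_sol: "H (asol r \<mu>) (bsol r \<mu>) (qsol r \<mu>) (usol r \<mu>) r = - \<mu> * usol r \<mu>"
  by (simp add: asol_def H_acc)

lemma usol_0 [simp]: "usol 0 \<mu> = 1" and qsol_0 [simp]: "qsol 0 \<mu> = 0"
  by (simp_all add: usol_def Pu_def qsol_def)

text \<open>At the origin the integral equation degenerates to
  \<open>(kap + 1) * b = acc + kap * b\<close>. So \<open>u''\<close> and the limit of
  \<open>u' / r\<close> agree there, which later makes the radial function twice differentiable at
  the center with an isotropic Hessian.\<close>

lemma asol_0: "asol 0 \<mu> = bsol 0 \<mu>"
proof -
  let ?G = "G (bsol 0 \<mu>) 0 1 0 \<mu>"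
  have "bsol 0 \<mu> = integral {0..1} (\<lambda>t. t ^ kap * ?G)"
    using bsol_eq[of 0 \<mu>] R_pos by (simp add: Pb_def Pu_def)
  also have "\<dots> = 1 / (real kap + 1) * ?G"
    by (intro integral_unique has_integral_mult_left has_integral_power_unit_interval)
  finally have "bsol 0 \<mu> * (real kap + 1) = ?G" by (simp add: field_simps)
  then show ?thesis by (simp add: asol_def G_def algebra_simps)
qed

lemma usol_deriv:
  assumes "r \<in> {0..R}"
  shows "((\<lambda>r. usol r \<mu>) has_real_derivative qsol r \<mu>) (at r within {0..R})"
proof -
  have cont: "continuous_on UNIV (\<lambda>s. bsol s \<mu>)"
    by (intro jointly_continuous_compose[OF jointly_continuous_bsol] continuous_intros)
  have eq: "usol s \<mu> = 1 + integral {0..s} (\<lambda>s. s * bsol s \<mu>)" if "s \<in> {0..R}" for s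
    using integral_power_rescale[OF cont, of s 1] that by (simp add: usol_def Pu_def power2_eq_square)
  have "((\<lambda>s. 1 + integral {0..s} (\<lambda>s. s * bsol s \<mu>)) has_real_derivative 0 + r * bsol r \<mu>)
      (at r within {0..R})"
    by (intro DERIV_add DERIV_const integral_has_real_derivative[OF _ assms] continuous_intros
        continuous_on_subset[OF cont] subset_UNIV)
  then have D: "((\<lambda>s. 1 + integral {0..s} (\<lambda>s. s * bsol s \<mu>)) has_real_derivative qsol r \<mu>)
      (at r within {0..R})"
    by (simp add: qsol_def)
  show ?thesis
    by (rule has_field_derivative_transform_within[OF D zero_less_one assms]) (simp add: eq)
qed

text \<open>At 0 the difference quotient of \<open>qsol\<close> is \<open>bsol\<close>, which is
  continuous. Elsewhere \<open>qsol\<close> equals \<open>P / r ^ kap\<close>, and differentiating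
  the denominator produces exactly the term \<open>kap * b\<close> that was added in
  \<open>G\<close>.\<close>

lemma qsol_deriv:
  assumes r: "r \<in> {0..R}"
  shows "((\<lambda>r. qsol r \<mu>) has_real_derivative asol r \<mu>) (at r within {0..R})"
proof (cases "r = 0")
  case True
  have "continuous_on UNIV (\<lambda>s. bsol s \<mu>)"
    by (intro jointly_continuous_compose[OF jointly_continuous_bsol] continuous_intros)
  then have "((\<lambda>s. bsol s \<mu>) \<longlongrightarrow> bsol 0 \<mu>) (at 0 within {0..R})"
    by (meson UNIV_I continuous_on_def tendsto_within_subset subset_UNIV)
  then have "((\<lambda>s. (qsol s \<mu> - qsol 0 \<mu>) / (s - 0)) \<longlongrightarrow> bsol 0 \<mu>) (at 0 within {0..R})"
    by (rule Lim_transform_eventually)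
      (auto simp: qsol_def eventually_at_filter)
  then show ?thesis using True by (simp add: asol_0 has_field_derivative_iff)
next
  case False
  then have pos: "r > 0" using r by simp
  define g where "g s = G (bsol s \<mu>) (qsol s \<mu>) (usol s \<mu>) s \<mu>" for s
  define P where "P s = integral {0..s} (\<lambda>s. s ^ kap * g s)" for s
  have g: "continuous_on UNIV g"
    unfolding g_def
    by (intro continuous_G continuous_intros jointly_continuous_compose[OF jointly_continuous_bsol]
      jointly_continuous_compose[OF jointly_continuous_usol]
      jointly_continuous_compose[OF jointly_continuous_qsol])
  have eq: "s ^ Suc kap * bsol s \<mu> = P s" if "s \<in> {0..R}" for s
    using integral_power_rescale[OF g, of s kap] bsol_eq[OF that, of \<mu>] that
    by (simp add: P_def Pb_def g_def qsol_def usol_def)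
  have "(P has_real_derivative r ^ kap * g r) (at r within {0..R})"
    unfolding P_def
    by (intro integral_has_real_derivative[OF _ r] continuous_intros
        continuous_on_subset[OF g] subset_UNIV)
  then have D: "((\<lambda>s. P s / s ^ kap) has_real_derivative
      (r ^ kap * g r * r ^ kap - P r * (real kap * r ^ (kap - 1))) / (r ^ kap * r ^ kap))
      (at r within {0..R})"
    using pos by (auto intro!: derivative_eq_intros)
  have "P r * (real kap * r ^ (kap - 1)) = real kap * bsol r \<mu> * (r ^ kap * r ^ kap)"
  proof (cases "kap = 0")
    case False
    then have "Suc kap + (kap - 1) = kap + kap" by simp
    then have "r ^ Suc kap * r ^ (kap - 1) = r ^ kap * r ^ kap" by (metis power_add)
    then show ?thesis
      using eq[OF r] by (metis (no_types, opaque_lifting) mult.assoc mult.commute)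
  qed simp
  then have "(r ^ kap * g r * r ^ kap - P r * (real kap * r ^ (kap - 1))) / (r ^ kap * r ^ kap)
      = g r - real kap * bsol r \<mu>"
    using pos by (simp only:) (simp add: diff_divide_distrib)
  also have "\<dots> = asol r \<mu>" by (simp add: g_def asol_def G_def)
  finally have D': "((\<lambda>s. P s / s ^ kap) has_real_derivative asol r \<mu>) (at r within {0..R})"
    using D by simp
  show ?thesis
  proof (rule has_field_derivative_transform_within[OF D' pos r])
    fix s assume s: "s \<in> {0..R}" "dist s r < r"
    then have "s > 0" by (auto simp: dist_real_def)
    then show "P s / s ^ kap = qsol s \<mu>"
      using eq[OF s(1)] by (simp add: qsol_def field_simps)
  qed
qed

end

section \<open>Scalar differential inequalities\<close>

lemma nonneg_derivative_imp_le:
  fixes f :: "real \<Rightarrow> real"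
  assumes "a \<le> b" "continuous_on {a..b} f"
    and "\<And>x. a < x \<Longrightarrow> x < b \<Longrightarrow> \<exists>d\<ge>0. (f has_real_derivative d) (at x)"
  shows "f a \<le> f b"
proof (cases "a = b")
  case False
  with assms(1) have "a < b" by simp
  moreover have "f differentiable (at x)" if "a < x" "x < b" for x
    using assms(3)[OF that] real_differentiable_def by blast
  ultimately obtain d z where z: "a < z" "z < b" "(f has_real_derivative d) (at z)" "f b - f a = (b - a) * d"
    using MVT[OF _ assms(2)] by blast
  with assms(3)[OF z(1,2)] have "d \<ge> 0" using DERIV_unique by blast
  then have "(b - a) * d \<ge> 0" using \<open>a < b\<close> by simp
  with z(4) show ?thesis by linarith
qed simp

text \<open>Gronwall's inequality as monotonicity of \<open>f * exp (C * x)\<close>. Upper bounds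
  are obtained by applying it to the negated function with \<open>- C\<close>.\<close>

lemma exp_weighted_le:
  fixes f :: "real \<Rightarrow> real"
  assumes "a \<le> b" "continuous_on {a..b} f"
    and "\<And>x. a < x \<Longrightarrow> x < b \<Longrightarrow> \<exists>d\<ge>- C * f x. (f has_real_derivative d) (at x)"
  shows "f a * exp (C * a) \<le> f b * exp (C * b)"
proof (rule nonneg_derivative_imp_le[OF assms(1)])
  show "continuous_on {a..b} (\<lambda>x. f x * exp (C * x))"
    by (intro continuous_intros assms(2))
  fix x assume "a < x" "x < b"
  then obtain d where d: "d \<ge> - C * f x" "(f has_real_derivative d) (at x)"
    using assms(3) by blast
  have "((\<lambda>x. f x * exp (C * x)) has_real_derivative (d + C * f x) * exp (C * x)) (at x)"
    using d(2) by (auto intro!: derivative_eq_intros simp: algebra_simps)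
  moreover have "(d + C * f x) * exp (C * x) \<ge> 0" using d(1) by simp
  ultimately show "\<exists>d\<ge>0. ((\<lambda>x. f x * exp (C * x)) has_real_derivative d) (at x)" by blast
qed

lemma first_passage:
  fixes f :: "real \<Rightarrow> real"
  assumes "a \<le> b" "continuous_on {a..b} f" "f a > c" "f b \<le> c"
  obtains t where "a < t" "t \<le> b" "f t = c" "\<And>s. a \<le> s \<Longrightarrow> s < t \<Longrightarrow> f s > c"
proof -
  define S where "S = {s \<in> {a..b}. f s \<le> c}"
  have "closed S"
    unfolding S_def by (intro continuous_on_closed_Collect_le assms(2) continuous_intros closed_atLeastAtMost)
  moreover have "bounded S" by (rule bounded_subset[of "{a..b}"]) (auto simp: S_def)
  ultimately have "compact S" by (simp add: compact_eq_bounded_closed)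
  moreover have "S \<noteq> {}" using assms by (auto simp: S_def)
  ultimately obtain t where t: "t \<in> S" "\<And>s. s \<in> S \<Longrightarrow> t \<le> s"
    using compact_attains_inf by metis
  have tab: "a \<le> t" "t \<le> b" "f t \<le> c" using t(1) by (auto simp: S_def)
  have before: "f s > c" if "a \<le> s" "s < t" for s
    using t(2)[of s] that tab by (force simp: S_def)
  have "a \<noteq> t" using tab(3) assms(3) by auto
  have "f t = c"
  proof (rule ccontr)
    assume "f t \<noteq> c"
    then have "f t < c" using tab by simp
    moreover have "continuous_on {a..t} f" using continuous_on_subset[OF assms(2)] tab by auto
    ultimately obtain s where "a \<le> s" "s \<le> t" "f s = c"
      using IVT2'[of f t c a] assms(3) tab by auto
    with before[of s] \<open>f t \<noteq> c\<close> show False by (cases "s = t") auto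
  qed
  with tab \<open>a \<noteq> t\<close> before show ?thesis by (intro that[of t]) auto
qed

text \<open>Before a first zero \<open>f\<close> is positive, so the differential inequality is
  needed only where \<open>f\<close> is nonnegative. In the comparison of angles this allows a
  Lipschitz bound in the absolute value of the difference to be used without the bars.\<close>

lemma stays_positive:
  fixes f :: "real \<Rightarrow> real"
  assumes "a \<le> b" "continuous_on {a..b} f" "f a > 0"
    and "\<And>x. a < x \<Longrightarrow> x < b \<Longrightarrow> f x \<ge> 0 \<Longrightarrow> \<exists>d\<ge>- C * f x. (f has_real_derivative d) (at x)"
  shows "f b > 0"
proof (rule ccontr)
  assume "\<not> f b > 0"
  then obtain t where t: "a < t" "t \<le> b" "f t = 0" "\<And>s. a \<le> s \<Longrightarrow> s < t \<Longrightarrow> f s > 0"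
    using first_passage[OF assms(1-3)] by (metis linorder_not_less)
  have "f a * exp (C * a) \<le> f t * exp (C * t)"
  proof (rule exp_weighted_le)
    show "continuous_on {a..t} f" using continuous_on_subset[OF assms(2)] t by auto
    show "\<exists>d\<ge>- C * f x. (f has_real_derivative d) (at x)" if "a < x" "x < t" for x
      using assms(4)[of x] t(4)[of x] t(2) that by fastforce
  qed (use t in simp)
  moreover have "f a * exp (C * a) > 0" using assms(3) by simp
  ultimately show False using t(3) by simp
qed

text \<open>A function above the level could return to it only with a nonpositive left derivative,
  contrary to \<open>pos\<close>. A start exactly on the level moves strictly above it at
  once.\<close>

lemma level_crossing:
  fixes f :: "real \<Rightarrow> real"
  assumes deriv: "\<And>r. r \<in> {A..B} \<Longrightarrow> (f has_real_derivative f' r) (at r within {A..B})"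
    and pos: "\<And>r. r \<in> {A..B} \<Longrightarrow> f r = c \<Longrightarrow> f' r > 0"
    and r: "A \<le> r1" "r1 < r2" "r2 \<le> B" "f r1 \<ge> c"
  shows "f r2 > c"
proof (rule ccontr)
  assume "\<not> f r2 > c"
  have "\<exists>s. r1 \<le> s \<and> s \<le> r2 \<and> f s > c"
  proof (cases "f r1 = c")
    case True
    have "r1 \<in> {A..B}" using r by simp
    from has_real_derivative_pos_inc_right[OF deriv[OF this] pos[OF this True]]
    obtain d where d: "d > 0" "\<And>h. 0 < h \<Longrightarrow> r1 + h \<in> {A..B} \<Longrightarrow> h < d \<Longrightarrow> f r1 < f (r1 + h)"
      by blast
    define h where "h = min (d / 2) (r2 - r1)"
    have "0 < h" "h < d" "r1 + h \<le> r2" using d r by (auto simp: h_def min_def)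
    then show ?thesis using d(2)[of h] True r by (intro exI[of _ "r1 + h"]) auto
  next
    case False
    then show ?thesis using r by (intro exI[of _ r1]) auto
  qed
  then obtain s where s: "r1 \<le> s" "s \<le> r2" "f s > c" by blast
  have "continuous_on {A..B} f"
    using deriv by (meson DERIV_isCont continuous_on_eq_continuous_within
        has_field_derivative_imp_has_derivative has_derivative_continuous)
  then have cont: "continuous_on {s..r2} f" by (rule continuous_on_subset) (use s r in auto)
  have "f r2 \<le> c" using \<open>\<not> f r2 > c\<close> by simp
  then obtain t where t: "s < t" "t \<le> r2" "f t = c" "\<And>x. s \<le> x \<Longrightarrow> x < t \<Longrightarrow> f x > c"
    by (rule first_passage[OF s(2) cont s(3)]) blast
  have "t \<in> {A..B}" using t s r by simp
  from has_real_derivative_pos_inc_left[OF deriv[OF this] pos[OF this t(3)]]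
  obtain d where d: "d > 0" "\<And>h. 0 < h \<Longrightarrow> t - h \<in> {A..B} \<Longrightarrow> h < d \<Longrightarrow> f (t - h) < f t"
    by blast
  define h where "h = min (d / 2) (t - s)"
  have h: "0 < h" "h < d" "s \<le> t - h" using d t by (auto simp: h_def min_def)
  then have "f (t - h) < c" using d(2)[of h] t s r by auto
  with t(4)[of "t - h"] h show False by auto
qed

text \<open>The normalized vector \<open>(u, q) / \<rho>\<close>, rotated back by \<open>th\<close>,
  has the components \<open>c\<close> and \<open>s\<close> defined below. Their derivatives vanish,
  so they keep the initial values 1 and 0. No branch of an inverse trigonometric function has to be
  chosen.\<close>

lemma polar_representation:
  fixes u q a th :: "real \<Rightarrow> real"
  assumes du: "\<And>r. r \<in> {0..R} \<Longrightarrow> (u has_real_derivative q r) (at r within {0..R})"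
    and dq: "\<And>r. r \<in> {0..R} \<Longrightarrow> (q has_real_derivative a r) (at r within {0..R})"
    and dth: "\<And>r. r \<in> {0..R} \<Longrightarrow>
      (th has_real_derivative ((q r)\<^sup>2 - u r * a r) / ((u r)\<^sup>2 + (q r)\<^sup>2)) (at r within {0..R})"
    and nz: "\<And>r. r \<in> {0..R} \<Longrightarrow> (u r)\<^sup>2 + (q r)\<^sup>2 > 0"
    and init: "u 0 = 1" "q 0 = 0" "th 0 = 0"
    and r: "r \<in> {0..R}"
  defines "\<rho> \<equiv> \<lambda>r. sqrt ((u r)\<^sup>2 + (q r)\<^sup>2)"
  shows "u r = \<rho> r * cos (th r)" and "q r = - \<rho> r * sin (th r)"
proof -
  have pos: "\<rho> x > 0" and sq: "\<rho> x * \<rho> x = (u x)\<^sup>2 + (q x)\<^sup>2" if "x \<in> {0..R}" for x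
    using nz[OF that] by (simp_all add: \<rho>_def)
  have half: "inverse S / 2 * (2 * E) = E / S" for S E :: real by (simp add: inverse_eq_divide)
  have d\<rho>: "(\<rho> has_real_derivative (u x * q x + q x * a x) / \<rho> x) (at x within {0..R})"
    if "x \<in> {0..R}" for x
  proof -
    have "((\<lambda>x. (u x)\<^sup>2 + (q x)\<^sup>2) has_real_derivative 2 * (u x * q x + q x * a x)) (at x within {0..R})"
      by (auto intro!: derivative_eq_intros du[OF that] dq[OF that] simp: algebra_simps)
    then have "((\<lambda>x. sqrt ((u x)\<^sup>2 + (q x)\<^sup>2)) has_real_derivative
        inverse (sqrt ((u x)\<^sup>2 + (q x)\<^sup>2)) / 2 * (2 * (u x * q x + q x * a x))) (at x within {0..R})"
      by (rule DERIV_chain2[where f = sqrt and g = "\<lambda>x. (u x)\<^sup>2 + (q x)\<^sup>2",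
          OF DERIV_real_sqrt[OF nz[OF that]]])
    then show ?thesis
      unfolding \<rho>_def by (rule DERIV_cong) (rule half)
  qed
  define s where "s x = (u x * sin (th x) + q x * cos (th x)) / \<rho> x" for x
  define c where "c x = (u x * cos (th x) - q x * sin (th x)) / \<rho> x" for x
  have alg: "(N' * p - N * (E / p)) / (p * p) = 0"
    if "N' * (p * p) = N * E" "p > 0" for N N' E p :: real
  proof -
    have "N * (E / p) = N' * (p * p) / p" unfolding that(1) by simp
    also have "\<dots> = N' * p" using that(2) by simp
    finally show ?thesis by simp
  qed
  have "(s has_real_derivative 0) (at x within {0..R})" if x: "x \<in> {0..R}" for x
  proof -
    let ?t = "((q x)\<^sup>2 - u x * a x) / ((u x)\<^sup>2 + (q x)\<^sup>2)"
    let ?N' = "q x * sin (th x) + u x * (cos (th x) * ?t) + (a x * cos (th x) - q x * (sin (th x) * ?t))"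
    have "?t * (\<rho> x * \<rho> x) = (q x)\<^sup>2 - u x * a x" using nz[OF x] by (simp add: sq[OF x])
    then have "?N' * (\<rho> x * \<rho> x) = (q x * sin (th x) + a x * cos (th x)) * (\<rho> x * \<rho> x)
        + (u x * cos (th x) - q x * sin (th x)) * ((q x)\<^sup>2 - u x * a x)" by algebra
    also have "\<dots> = (u x * sin (th x) + q x * cos (th x)) * (u x * q x + q x * a x)"
      unfolding sq[OF x] by algebra
    finally have "(?N' * \<rho> x - (u x * sin (th x) + q x * cos (th x)) * ((u x * q x + q x * a x) / \<rho> x))
      / (\<rho> x * \<rho> x) = 0" using pos[OF x] by (rule alg)
    moreover have "(s has_real_derivative
       (?N' * \<rho> x - (u x * sin (th x) + q x * cos (th x)) * ((u x * q x + q x * a x) / \<rho> x))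
      / (\<rho> x * \<rho> x)) (at x within {0..R})"
      unfolding s_def using pos[OF x]
      by (auto intro!: derivative_eq_intros du[OF x] dq[OF x] dth[OF x] d\<rho>[OF x] simp: mult_ac)
    ultimately show ?thesis by (simp only:)
  qed
  then obtain k where "\<And>x. x \<in> {0..R} \<Longrightarrow> s x = k"
    using has_field_derivative_zero_constant[of "{0..R}" s] by auto
  then have "s r = s 0" using r by simp
  then have s: "u r * sin (th r) + q r * cos (th r) = 0"
    using init pos[OF r] by (simp add: s_def)
  have "(c has_real_derivative 0) (at x within {0..R})" if x: "x \<in> {0..R}" for x
  proof -
    let ?t = "((q x)\<^sup>2 - u x * a x) / ((u x)\<^sup>2 + (q x)\<^sup>2)"
    let ?N' = "q x * cos (th x) - u x * (sin (th x) * ?t) - (a x * sin (th x) + q x * (cos (th x) * ?t))"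
    have "?t * (\<rho> x * \<rho> x) = (q x)\<^sup>2 - u x * a x" using nz[OF x] by (simp add: sq[OF x])
    then have "?N' * (\<rho> x * \<rho> x) = (q x * cos (th x) - a x * sin (th x)) * (\<rho> x * \<rho> x)
        - (u x * sin (th x) + q x * cos (th x)) * ((q x)\<^sup>2 - u x * a x)" by algebra
    also have "\<dots> = (u x * cos (th x) - q x * sin (th x)) * (u x * q x + q x * a x)"
      unfolding sq[OF x] by algebra
    finally have "(?N' * \<rho> x - (u x * cos (th x) - q x * sin (th x)) * ((u x * q x + q x * a x) / \<rho> x))
      / (\<rho> x * \<rho> x) = 0" using pos[OF x] by (rule alg)
    moreover have "(c has_real_derivative
       (?N' * \<rho> x - (u x * cos (th x) - q x * sin (th x)) * ((u x * q x + q x * a x) / \<rho> x))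
      / (\<rho> x * \<rho> x)) (at x within {0..R})"
      unfolding c_def using pos[OF x]
      by (auto intro!: derivative_eq_intros du[OF x] dq[OF x] dth[OF x] d\<rho>[OF x] simp: mult_ac)
    ultimately show ?thesis by (simp only:)
  qed
  then obtain k where "\<And>x. x \<in> {0..R} \<Longrightarrow> c x = k"
    using has_field_derivative_zero_constant[of "{0..R}" c] by auto
  then have "c r = c 0" using r by simp
  then have c: "u r * cos (th r) - q r * sin (th r) = \<rho> r"
    using init pos[OF r] by (simp add: c_def \<rho>_def)
  have one: "(sin (th r))\<^sup>2 + (cos (th r))\<^sup>2 = 1" by simp
  show "u r = \<rho> r * cos (th r)" using s c one by algebra
  show "q r = - \<rho> r * sin (th r)" using s c one by algebra
qed

text \<open>The integrands are bounded by 2 and tend to 0 except at the zeros of \<open>cos\<close>,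
  which form a countable set.\<close>

lemma integral_inverse_cos_square_tendsto_0:
  "(\<lambda>n. integral {A..B} (\<lambda>x. 1 / (1 / 2 + real n * (cos x)\<^sup>2))) \<longlonglongrightarrow> 0"
proof -
  define g where "g x = (if cos x = 0 then 2 else 0 :: real)" for x :: real
  have pos: "1 / 2 + real n * (cos x)\<^sup>2 > 0" for n x
    by (smt (verit) divide_pos_pos mult_nonneg_nonneg of_nat_0_le_iff zero_le_power2)
  have "(\<lambda>n. integral {A..B} (\<lambda>x. 1 / (1 / 2 + real n * (cos x)\<^sup>2))) \<longlonglongrightarrow> integral {A..B} g"
  proof (rule dominated_convergence(2))
    show "(\<lambda>x. 1 / (1 / 2 + real n * (cos x)\<^sup>2)) integrable_on {A..B}" for n
      using pos by (intro integrable_continuous_interval continuous_intros)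
        (metis less_numeral_extra(3))
    show "(\<lambda>_. 2 :: real) integrable_on {A..B}" by (rule integrable_const_ivl)
    show "norm (1 / (1 / 2 + real n * (cos x)\<^sup>2)) \<le> 2" for n x
    proof -
      have "1 / (1 / 2 + real n * (cos x)\<^sup>2) \<le> 1 / (1 / 2)"
        by (rule divide_left_mono) (use pos[of n x] in auto)
      then show ?thesis using pos[of n x] by simp
    qed
    show "(\<lambda>n. 1 / (1 / 2 + real n * (cos x)\<^sup>2)) \<longlonglongrightarrow> g x" for x
    proof (cases "cos x = 0")
      case False
      then have "(cos x)\<^sup>2 > 0" by simp
      then have "filterlim (\<lambda>n. 1 / 2 + real n * (cos x)\<^sup>2) at_top sequentially"
        by (intro filterlim_tendsto_add_at_top[OF tendsto_const]
            filterlim_at_top_mult_tendsto_pos[OF tendsto_const] filterlim_real_sequentially)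
      then show ?thesis using False
        by (simp add: g_def tendsto_divide_0[OF tendsto_const] filterlim_at_top_imp_at_infinity)
    qed (simp add: g_def)
  qed
  moreover have "integral {A..B} g = integral {A..B} (\<lambda>_. 0)"
  proof (rule integral_spike)
    have "{x::real. cos x = 0} \<subseteq> range (\<lambda>i::int. of_int i * (pi / 2))"
      by (auto simp: cos_zero_iff_int)
    then have "countable {x::real. cos x = 0}"
      by (rule countable_subset) simp
    then show "negligible {x::real. cos x = 0}" 
      by (metis countable_imp_null_set_lborel negligible_iff_null_sets null_sets_completionI)
  qed (auto simp: g_def)
  ultimately show ?thesis by simp
qed

lemma abs_mult_le_squares: "2 * (\<bar>x\<bar> * \<bar>y\<bar>) \<le> x\<^sup>2 + y\<^sup>2" for x y :: real
  using sum_squares_bound[of "\<bar>x\<bar>" "\<bar>y\<bar>"] by simp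

lemma abs_mult_diff_le: "\<bar>a * x - b * y\<bar> \<le> \<bar>a\<bar> * \<bar>x - y\<bar> + \<bar>a - b\<bar> * \<bar>y\<bar>" for a b x y :: real
proof -
  have "a * x - b * y = a * (x - y) + (a - b) * y" by (simp add: algebra_simps)
  then show ?thesis using abs_triangle_ineq[of "a * (x - y)" "(a - b) * y"] by (simp only: abs_mult)
qed

lemma abs_sin_diff_le: "\<bar>sin x - sin y\<bar> \<le> \<bar>x - y\<bar>" for x y :: real
proof -
  have "\<bar>sin x - sin y\<bar> = 2 * \<bar>sin ((x - y) / 2)\<bar> * \<bar>cos ((x + y) / 2)\<bar>"
    by (simp add: sin_diff_sin abs_mult)
  also have "\<dots> \<le> 2 * \<bar>(x - y) / 2\<bar> * 1"
    by (intro mult_mono abs_sin_x_le_abs_x) auto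
  finally show ?thesis by simp
qed

lemma abs_cos_diff_le: "\<bar>cos x - cos y\<bar> \<le> \<bar>x - y\<bar>" for x y :: real
  using abs_sin_diff_le[of "pi / 2 - x" "pi / 2 - y"] by (simp add: sin_diff abs_minus_commute)

lemma cos_eq_0_imp:
  fixes x :: real
  assumes "cos x = 0"
  obtains k :: int where "x = pi / 2 + of_int k * pi"
proof -
  obtain i :: int where i: "odd i" "x = of_int i * (pi / 2)"
    using assms by (auto simp: cos_zero_iff_int)
  then obtain k where "i = 2 * k + 1" by (elim oddE)
  then have "x = pi / 2 + of_int k * pi" using i by (simp add: field_simps)
  then show ?thesis by (rule that)
qed

lemma cos_level: "cos (pi / 2 + of_int k * pi) = 0"
  by (simp add: cos_add sin_times_pi_eq_0)

section \<open>Uniqueness and the Pruefer angle\<close>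

context radial_problem
begin

text \<open>The conditions are those that an eigenfunction of class \<open>C\<^sup>2\<close> in the
  open ball satisfies along a ray: nothing is asked at \<open>R\<close>, and the equation is asked
  only away from the singular point 0.\<close>

definition solves :: "real \<Rightarrow> (real \<Rightarrow> real) \<Rightarrow> (real \<Rightarrow> real) \<Rightarrow> bool" where
  "solves \<mu> \<phi> q \<longleftrightarrow> continuous_on {0..<R} \<phi> \<and> continuous_on {0..<R} q \<and> q 0 = 0 \<and>
     (\<forall>r\<in>{0<..<R}. (\<phi> has_real_derivative q r) (at r) \<and>
        (\<exists>a. (q has_real_derivative a) (at r) \<and> H a (q r / r) (q r) (\<phi> r) r = - \<mu> * \<phi> r))"

text \<open>Gronwall for the energy \<open>(\<phi> - \<psi>)\<^sup>2 + (q - w)\<^sup>2\<close>: the singular term has a favourable sign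
  because \<open>acc\<close> is nonincreasing in \<open>u' / r\<close>.\<close>

lemma solves_unique:
  assumes 1: "solves \<mu> \<phi> q" and 2: "solves \<mu> \<psi> w" and init: "\<phi> 0 = \<psi> 0"
    and r: "r \<in> {0..<R}"
  shows "\<phi> r = \<psi> r"
proof -
  define C where "C = 1 + 3 * (Q * (1 + \<bar>\<mu>\<bar>))"
  define E where "E s = (\<phi> s - \<psi> s)\<^sup>2 + (q s - w s)\<^sup>2" for s
  \<comment> \<open>The two sign changes turn the lower Gronwall bound into an upper bound for
    \<open>E\<close>.\<close>
  have "- E 0 * exp (- C * 0) \<le> - E r * exp (- C * r)"
  proof (rule exp_weighted_le[of 0 r "\<lambda>s. - E s" "- C"])
    have sub: "{0..r} \<subseteq> {0..<R}" using r by auto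
    show "continuous_on {0..r} (\<lambda>s. - E s)"
      unfolding E_def using 1 2 continuous_on_subset[OF _ sub]
      by (intro continuous_intros) (auto simp: solves_def)
    fix x assume x: "0 < x" "x < r"
    then have "x \<in> {0<..<R}" using r by auto
    then obtain a c where d: "(\<phi> has_real_derivative q x) (at x)" "(q has_real_derivative a) (at x)"
      "H a (q x / x) (q x) (\<phi> x) x = - \<mu> * \<phi> x"
      "(\<psi> has_real_derivative w x) (at x)" "(w has_real_derivative c) (at x)"
      "H c (w x / x) (w x) (\<psi> x) x = - \<mu> * \<psi> x"
      using 1 2 unfolding solves_def by meson
    have ac: "a = acc (q x / x) (q x) (\<phi> x) x \<mu>" "c = acc (w x / x) (w x) (\<psi> x) x \<mu>"
      using d acc_eq_iff by metis+
    \<comment> \<open>An intermediate value that changes only the singular argument: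
      \<open>a - a'\<close> has a sign against \<open>q - w\<close>, while \<open>a' - c\<close> is
      controlled without any factor \<open>1 / x\<close>.\<close>
    define a' where "a' = acc (w x / x) (q x) (\<phi> x) x \<mu>"
    have sign: "(q x - w x) * (a - a') \<le> 0"
    proof (cases "w x \<le> q x")
      case True
      then have "w x / x \<le> q x / x" using x by (simp add: divide_right_mono)
      then have "a \<le> a'" unfolding ac a'_def by (rule acc_antimono_b)
      with True show ?thesis by (simp add: mult_nonneg_nonpos)
    next
      case False
      then have "q x / x \<le> w x / x" using x by (simp add: divide_right_mono)
      then have "a' \<le> a" unfolding ac a'_def by (rule acc_antimono_b)
      with False show ?thesis by (simp add: mult_nonpos_nonneg)
    qed
    have lip: "\<bar>a' - c\<bar> \<le> Q * (1 + \<bar>\<mu>\<bar>) * (\<bar>q x - w x\<bar> + \<bar>\<phi> x - \<psi> x\<bar>)"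
      using acc_lipschitz[of "w x / x" "q x" "\<phi> x" x \<mu> "w x / x" "w x" "\<psi> x"]
      unfolding a'_def ac by simp
    define X Y where "X = \<phi> x - \<psi> x" and "Y = q x - w x"
    have E: "E x = X\<^sup>2 + Y\<^sup>2" by (simp add: E_def X_def Y_def)
    define m where "m = Q * (1 + \<bar>\<mu>\<bar>)"
    have m: "m \<ge> 0" using Q_pos by (simp add: m_def)
    have XY: "2 * (\<bar>X\<bar> * \<bar>Y\<bar>) \<le> X\<^sup>2 + Y\<^sup>2" by (rule abs_mult_le_squares)
    have "Y * (a' - c) \<le> \<bar>Y\<bar> * (m * (\<bar>Y\<bar> + \<bar>X\<bar>))"
    proof -
      have "Y * (a' - c) \<le> \<bar>Y\<bar> * \<bar>a' - c\<bar>" by (metis abs_ge_self abs_mult)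
      also have "\<dots> \<le> \<bar>Y\<bar> * (m * (\<bar>Y\<bar> + \<bar>X\<bar>))"
        using lip unfolding m_def X_def Y_def by (intro mult_left_mono) auto
      finally show ?thesis .
    qed
    also have "\<bar>Y\<bar> * (m * (\<bar>Y\<bar> + \<bar>X\<bar>)) = m * (Y\<^sup>2 + \<bar>X\<bar> * \<bar>Y\<bar>)"
      by (simp add: power2_eq_square algebra_simps)
    finally have "Y * (a - c) \<le> m * (Y\<^sup>2 + \<bar>X\<bar> * \<bar>Y\<bar>)"
      using sign unfolding Y_def[symmetric] by (simp add: algebra_simps)
    moreover have "2 * (m * (Y\<^sup>2 + \<bar>X\<bar> * \<bar>Y\<bar>)) \<le> m * (3 * (X\<^sup>2 + Y\<^sup>2))"
    proof -
      have "2 * (Y\<^sup>2 + \<bar>X\<bar> * \<bar>Y\<bar>) \<le> 3 * (X\<^sup>2 + Y\<^sup>2)"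
        using XY zero_le_power2[of X] zero_le_power2[of Y] by (simp only: distrib_left)
      from mult_left_mono[OF this m] show ?thesis by (simp add: mult.left_commute)
    qed
    moreover have "X * Y \<le> \<bar>X\<bar> * \<bar>Y\<bar>" by (metis abs_ge_self abs_mult)
    ultimately have "2 * (X * Y) + 2 * (Y * (a - c)) \<le> (X\<^sup>2 + Y\<^sup>2) + m * (3 * (X\<^sup>2 + Y\<^sup>2))"
      using XY by linarith
    also have "\<dots> = C * E x" by (simp add: C_def E m_def algebra_simps)
    finally have "- (2 * (X * Y) + 2 * (Y * (a - c))) \<ge> - (- C) * - E x" by simp
    moreover have "((\<lambda>s. - E s) has_real_derivative - (2 * (X * Y) + 2 * (Y * (a - c)))) (at x)"
      unfolding E_def X_def Y_def using d
      by (auto intro!: derivative_eq_intros simp: algebra_simps)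
    ultimately show "\<exists>d\<ge>- (- C) * - E x. ((\<lambda>s. - E s) has_real_derivative d) (at x)" by blast
  qed (use r in simp)
  moreover have "E 0 = 0" using 1 2 init by (simp add: E_def solves_def)
  ultimately have "E r * exp (- C * r) \<le> 0" by simp
  then have "E r \<le> 0" by (meson exp_gt_zero linorder_not_le mult_pos_pos)
  then show ?thesis unfolding E_def
    by (metis add_nonneg_eq_0_iff antisym eq_iff_diff_eq_0 sum_power2_ge_zero zero_eq_power2 zero_le_power2)
qed

lemma continuous_sol:
  "continuous_on S (\<lambda>r. bsol r \<mu>)" "continuous_on S (\<lambda>r. usol r \<mu>)"
  "continuous_on S (\<lambda>r. qsol r \<mu>)" "continuous_on S (\<lambda>r. asol r \<mu>)"
  by (intro jointly_continuous_compose[OF jointly_continuous_bsol]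
      jointly_continuous_compose[OF jointly_continuous_usol]
      jointly_continuous_compose[OF jointly_continuous_qsol]
      jointly_continuous_compose[OF jointly_continuous_asol] continuous_intros)+

lemma at_within_interior: "r \<in> {0<..<R} \<Longrightarrow> at r within {0..R} = at r"
  by (intro at_within_Icc_at) auto

lemma usol_deriv_at: "r \<in> {0<..<R} \<Longrightarrow> ((\<lambda>r. usol r \<mu>) has_real_derivative qsol r \<mu>) (at r)"
  and qsol_deriv_at: "r \<in> {0<..<R} \<Longrightarrow> ((\<lambda>r. qsol r \<mu>) has_real_derivative asol r \<mu>) (at r)"
  using usol_deriv[of r \<mu>] qsol_deriv[of r \<mu>] at_within_interior[of r] by auto

lemma solves_usol:
  assumes "c \<ge> 0"
  shows "solves \<mu> (\<lambda>r. c * usol r \<mu>) (\<lambda>r. c * qsol r \<mu>)"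
  unfolding solves_def
proof (intro conjI ballI)
  fix r assume r: "r \<in> {0<..<R}"
  show "((\<lambda>r. c * usol r \<mu>) has_real_derivative c * qsol r \<mu>) (at r)"
    using usol_deriv_at[OF r] by (rule DERIV_cmult)
  have b: "qsol r \<mu> / r = bsol r \<mu>" using r by (simp add: qsol_def)
  have "((\<lambda>r. c * qsol r \<mu>) has_real_derivative c * asol r \<mu>) (at r)"
    using qsol_deriv_at[OF r] by (rule DERIV_cmult)
  moreover have "H (c * asol r \<mu>) (c * qsol r \<mu> / r) (c * qsol r \<mu>) (c * usol r \<mu>) r
      = - \<mu> * (c * usol r \<mu>)"
    using H_hom[OF assms] H_sol[of r \<mu>] b by (simp flip: times_divide_eq_right)
  ultimately show "\<exists>a. ((\<lambda>r. c * qsol r \<mu>) has_real_derivative a) (at r) \<and>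
       H a (c * qsol r \<mu> / r) (c * qsol r \<mu>) (c * usol r \<mu>) r = - \<mu> * (c * usol r \<mu>)"
    by blast
qed (auto intro!: continuous_intros continuous_sol)

lemma solves_eq_usol:
  assumes "solves \<mu> \<phi> q" "\<phi> 0 \<ge> 0" "r \<in> {0..<R}"
  shows "\<phi> r = \<phi> 0 * usol r \<mu>"
  using solves_unique[OF assms(1) solves_usol[OF assms(2)] _ assms(3)] by simp

text \<open>Gronwall is run backwards from a common zero of \<open>u\<close> and \<open>u'\<close>.
  In this direction the sign of the singular term does not help, so the constant contains
  \<open>1 / e\<close> and the estimate stops at \<open>e\<close>. As \<open>e\<close> is arbitrary,
  the energy vanishes on all of \<open>{0<..<r}\<close>, and by continuity at 0, where it equals
  1.\<close>

lemma sol_nonzero: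
  assumes r: "r \<in> {0..R}"
  shows "(usol r \<mu>)\<^sup>2 + (qsol r \<mu>)\<^sup>2 > 0"
proof (rule ccontr)
  define E where "E s = (usol s \<mu>)\<^sup>2 + (qsol s \<mu>)\<^sup>2" for s
  assume "\<not> ?thesis"
  then have Er: "E r = 0" unfolding E_def
    by (metis not_sum_power2_lt_zero linorder_neqE_linordered_idom)
  then have "r \<noteq> 0" by (auto simp: E_def)
  with r have rpos: "r > 0" by simp
  have E0: "E e = 0" if e: "0 < e" "e < r" for e
  proof -
    define m where "m = Q * (1 + \<bar>\<mu>\<bar>) * (1 / e + 1)"
    have m: "m \<ge> 0" using Q_pos e by (simp add: m_def)
    have "E e * exp ((1 + 3 * m) * e) \<le> E r * exp ((1 + 3 * m) * r)"
    proof (rule exp_weighted_le)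
      show "continuous_on {e..r} E"
        unfolding E_def by (intro continuous_intros continuous_sol)
      fix x assume x: "e < x" "x < r"
      then have xi: "x \<in> {0<..<R}" using e r by auto
      define X Y A where "X = usol x \<mu>" and "Y = qsol x \<mu>" and "A = asol x \<mu>"
      have XY: "2 * (\<bar>X\<bar> * \<bar>Y\<bar>) \<le> X\<^sup>2 + Y\<^sup>2" by (rule abs_mult_le_squares)
      have b: "bsol x \<mu> = Y / x" using xi by (simp add: Y_def qsol_def)
      have A: "\<bar>A\<bar> \<le> m * (\<bar>Y\<bar> + \<bar>X\<bar>)"
      proof -
        have "\<bar>Y / x\<bar> \<le> 1 / e * \<bar>Y\<bar>"
          using x e by (simp add: abs_divide frac_le)
        moreover have "0 \<le> 1 / e * \<bar>X\<bar>" using e by simp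
        ultimately have *: "\<bar>Y / x\<bar> + \<bar>Y\<bar> + \<bar>X\<bar> \<le> (1 / e + 1) * (\<bar>Y\<bar> + \<bar>X\<bar>)"
          by (simp only: distrib_left distrib_right)
        have "\<bar>A\<bar> \<le> Q * (1 + \<bar>\<mu>\<bar>) * (\<bar>Y / x\<bar> + \<bar>Y\<bar> + \<bar>X\<bar>)"
          using acc_bound[of "bsol x \<mu>" "qsol x \<mu>" "usol x \<mu>" x \<mu>]
          by (simp add: A_def asol_def X_def Y_def b)
        also have "\<dots> \<le> Q * (1 + \<bar>\<mu>\<bar>) * ((1 / e + 1) * (\<bar>Y\<bar> + \<bar>X\<bar>))"
          using * Q_pos by (intro mult_left_mono) auto
        finally show ?thesis by (simp only: m_def mult.assoc)
      qed
      have "\<bar>Y * A\<bar> \<le> \<bar>Y\<bar> * (m * (\<bar>Y\<bar> + \<bar>X\<bar>))"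
        using A by (simp add: abs_mult mult_left_mono)
      also have "\<bar>Y\<bar> * (m * (\<bar>Y\<bar> + \<bar>X\<bar>)) = m * (Y\<^sup>2 + \<bar>X\<bar> * \<bar>Y\<bar>)"
        by (simp add: power2_eq_square algebra_simps)
      finally have YA: "\<bar>Y * A\<bar> \<le> m * (Y\<^sup>2 + \<bar>X\<bar> * \<bar>Y\<bar>)" .
      have "2 * (Y\<^sup>2 + \<bar>X\<bar> * \<bar>Y\<bar>) \<le> 3 * (X\<^sup>2 + Y\<^sup>2)"
        using XY zero_le_power2[of X] zero_le_power2[of Y] by (simp only: distrib_left)
      from mult_left_mono[OF this m]
      have "2 * (m * (Y\<^sup>2 + \<bar>X\<bar> * \<bar>Y\<bar>)) \<le> m * (3 * (X\<^sup>2 + Y\<^sup>2))"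
        by (simp add: mult.left_commute)
      moreover have "\<bar>X * Y\<bar> = \<bar>X\<bar> * \<bar>Y\<bar>" by (rule abs_mult)
      ultimately have "2 * (X * Y) + 2 * (Y * A) \<ge> - ((X\<^sup>2 + Y\<^sup>2) + m * (3 * (X\<^sup>2 + Y\<^sup>2)))"
        using XY YA by linarith
      also have "- ((X\<^sup>2 + Y\<^sup>2) + m * (3 * (X\<^sup>2 + Y\<^sup>2))) = - (1 + 3 * m) * E x"
        by (simp add: E_def X_def Y_def algebra_simps)
      finally have "2 * (X * Y) + 2 * (Y * A) \<ge> - (1 + 3 * m) * E x" .
      moreover have "(E has_real_derivative 2 * (X * Y) + 2 * (Y * A)) (at x)"
        unfolding E_def X_def Y_def A_def
        by (auto intro!: derivative_eq_intros usol_deriv_at[OF xi] qsol_deriv_at[OF xi]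
            simp: algebra_simps)
      ultimately show "\<exists>d\<ge>- (1 + 3 * m) * E x. (E has_real_derivative d) (at x)" by blast
    qed (use e in simp)
    then have "E e * exp ((1 + 3 * m) * e) \<le> 0" using Er by simp
    then have "E e \<le> 0" by (meson exp_gt_zero linorder_not_le mult_pos_pos)
    moreover have "E e \<ge> 0" by (simp add: E_def)
    ultimately show ?thesis by simp
  qed
  have "continuous_on {0..r} E"
    unfolding E_def by (intro continuous_intros continuous_sol)
  moreover have "{0..r} = closure {0<..<r}" using rpos by simp
  ultimately have cont: "continuous_on (closure {0<..<r}) E" by simp
  have "E 0 = 0"
    by (rule continuous_constant_on_closure[OF cont]) (use E0 rpos in auto)
  then show False by (simp add: E_def)
qed

text \<open>The formula for the derivative of the polar angle of \<open>(u, - u')\<close>, written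
  with \<open>asol\<close> so that it is continuous up to \<open>r = 0\<close>; the angle can then
  be defined as its integral.\<close>

definition thetad :: "real \<Rightarrow> real \<Rightarrow> real" where
  "thetad r \<mu> = ((qsol r \<mu>)\<^sup>2 - usol r \<mu> * asol r \<mu>) / ((usol r \<mu>)\<^sup>2 + (qsol r \<mu>)\<^sup>2)"

text \<open>The Pruefer angle: \<open>u = \<rho> cos \<theta>\<close> and \<open>u' = - \<rho> sin \<theta>\<close>.\<close>

definition theta :: "real \<Rightarrow> real \<Rightarrow> real" where
  "theta r \<mu> = integral {0..r} (\<lambda>s. thetad s \<mu>)"

definition rho :: "real \<Rightarrow> real \<Rightarrow> real" where
  "rho r \<mu> = sqrt ((usol r \<mu>)\<^sup>2 + (qsol r \<mu>)\<^sup>2)"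

lemma rho_pos: "r \<in> {0..R} \<Longrightarrow> rho r \<mu> > 0"
  using sol_nonzero by (simp add: rho_def)

lemma theta_0 [simp]: "theta 0 \<mu> = 0"
  by (simp add: theta_def)

lemma theta_deriv:
  assumes "r \<in> {0..R}"
  shows "((\<lambda>r. theta r \<mu>) has_real_derivative thetad r \<mu>) (at r within {0..R})"
  unfolding theta_def
proof (rule integral_has_real_derivative[OF _ assms])
  show "continuous_on {0..R} (\<lambda>s. thetad s \<mu>)"
    unfolding thetad_def using sol_nonzero
    by (intro continuous_intros continuous_sol) (metis less_irrefl)
qed

lemma theta_deriv_at: "r \<in> {0<..<R} \<Longrightarrow> ((\<lambda>r. theta r \<mu>) has_real_derivative thetad r \<mu>) (at r)"
  using theta_deriv[of r \<mu>] at_within_interior[of r] by auto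

lemma continuous_theta: "S \<subseteq> {0..R} \<Longrightarrow> continuous_on S (\<lambda>r. theta r \<mu>)"
  using theta_deriv by (meson DERIV_continuous continuous_on_eq_continuous_within continuous_on_subset)

lemma continuous_theta_end: "continuous_on UNIV (\<lambda>\<mu>. theta R \<mu>)"
proof -
  have nz: "\<forall>x \<in> UNIV \<times> cbox 0 R. (usol (snd x) (fst x))\<^sup>2 + (qsol (snd x) (fst x))\<^sup>2 \<noteq> 0"
    using sol_nonzero by (metis SigmaE box_real(2) less_irrefl snd_conv)
  have "continuous_on (UNIV \<times> cbox 0 R) (\<lambda>x. thetad (snd x) (fst x))"
    unfolding thetad_def
    by (intro continuous_intros jointly_continuous_compose[OF jointly_continuous_usol]
      jointly_continuous_compose[OF jointly_continuous_qsol]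
      jointly_continuous_compose[OF jointly_continuous_asol] nz)
  then have "continuous_on (UNIV \<times> cbox 0 R) (\<lambda>(\<mu>, s). thetad s \<mu>)"
    by (simp add: case_prod_unfold)
  from integral_continuous_on_param[OF this] show ?thesis by (simp add: theta_def)
qed

lemma usol_polar: "r \<in> {0..R} \<Longrightarrow> usol r \<mu> = rho r \<mu> * cos (theta r \<mu>)"
  and qsol_polar: "r \<in> {0..R} \<Longrightarrow> qsol r \<mu> = - rho r \<mu> * sin (theta r \<mu>)"
  unfolding rho_def
  by (rule polar_representation[of R "\<lambda>r. usol r \<mu>" "\<lambda>r. qsol r \<mu>" "\<lambda>r. asol r \<mu>" "\<lambda>r. theta r \<mu>"];
      use usol_deriv qsol_deriv theta_deriv sol_nonzero in \<open>simp add: thetad_def\<close>)+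

lemma usol_eq_0_iff: "r \<in> {0..R} \<Longrightarrow> usol r \<mu> = 0 \<longleftrightarrow> cos (theta r \<mu>) = 0"
  using usol_polar[of r \<mu>] rho_pos[of r \<mu>] by simp

text \<open>This is \<open>thetad\<close> with \<open>(u, u')\<close> replaced by
  \<open>(cos x, - sin x)\<close>; positive homogeneity of \<open>acc\<close> cancels the radius. It
  has period \<open>2 * pi\<close>, but since \<open>acc\<close> need not be odd, in general not
  \<open>pi\<close>.\<close>

definition Phi :: "real \<Rightarrow> real \<Rightarrow> real \<Rightarrow> real" where
  "Phi r x \<mu> = (sin x)\<^sup>2 - cos x * acc (- sin x / r) (- sin x) (cos x) r \<mu>"

lemma thetad_eq_Phi:
  assumes "r \<in> {0<..R}"
  shows "thetad r \<mu> = Phi r (theta r \<mu>) \<mu>"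
proof -
  let ?x = "theta r \<mu>" and ?p = "rho r \<mu>"
  have r: "r \<in> {0..R}" "r > 0" using assms by auto
  have p: "?p > 0" using rho_pos r by simp
  have "bsol r \<mu> = ?p * (- sin ?x / r)"
    using r qsol_polar[OF r(1), of \<mu>] by (simp add: qsol_def field_simps)
  then have "asol r \<mu> = acc (?p * (- sin ?x / r)) (?p * - sin ?x) (?p * cos ?x) r \<mu>"
    unfolding asol_def usol_polar[OF r(1)] qsol_polar[OF r(1)] by simp
  also have "\<dots> = ?p * acc (- sin ?x / r) (- sin ?x) (cos ?x) r \<mu>"
    using p by (intro acc_hom) simp
  finally have a: "asol r \<mu> = ?p * acc (- sin ?x / r) (- sin ?x) (cos ?x) r \<mu>" .
  have "(usol r \<mu>)\<^sup>2 + (qsol r \<mu>)\<^sup>2 = ?p\<^sup>2"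
    using sol_nonzero[OF r(1), of \<mu>] by (simp add: rho_def)
  moreover have "(qsol r \<mu>)\<^sup>2 - usol r \<mu> * asol r \<mu> = ?p\<^sup>2 * Phi r ?x \<mu>"
    unfolding a Phi_def usol_polar[OF r(1)] qsol_polar[OF r(1)]
    by (simp add: power2_eq_square algebra_simps)
  ultimately show ?thesis using p by (simp add: thetad_def)
qed

text \<open>Raising \<open>\<mu>\<close> pushes the second derivative against the sign of
  \<open>cos x\<close>, and the factor \<open>cos x\<close> in \<open>Phi\<close> makes both cases
  agree. At zeros of \<open>cos x\<close> there is equality, so strictness has to come from
  elsewhere.\<close>

lemma Phi_mono:
  assumes "\<mu> \<le> \<nu>"
  shows "Phi r x \<mu> \<le> Phi r x \<nu>"
proof -
  let ?A = "\<lambda>\<mu>. acc (- sin x / r) (- sin x) (cos x) r \<mu>"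
  have "cos x * ?A \<nu> \<le> cos x * ?A \<mu>"
  proof (cases "cos x \<ge> 0")
    case True
    have "H (?A \<nu>) (- sin x / r) (- sin x) (cos x) r \<le> H (?A \<mu>) (- sin x / r) (- sin x) (cos x) r"
      unfolding H_acc using assms True by (simp add: mult_right_mono)
    then have "?A \<nu> \<le> ?A \<mu>" by (simp only: H_le_iff)
    with True show ?thesis by (intro mult_left_mono)
  next
    case False
    have "H (?A \<mu>) (- sin x / r) (- sin x) (cos x) r \<le> H (?A \<nu>) (- sin x / r) (- sin x) (cos x) r"
      unfolding H_acc using assms False by (simp add: mult_right_mono_neg)
    then have "?A \<mu> \<le> ?A \<nu>" by (simp only: H_le_iff)
    with False show ?thesis by (simp add: mult_left_mono_neg)
  qed
  then show ?thesis by (simp add: Phi_def)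
qed

text \<open>The constant contains \<open>1 / e\<close>, because the singular argument is
  \<open>- sin x / r\<close>.\<close>

lemma Phi_lipschitz:
  assumes e: "e > 0"
  obtains C where "\<And>r x y. r \<ge> e \<Longrightarrow> \<bar>Phi r x \<mu> - Phi r y \<mu>\<bar> \<le> C * \<bar>x - y\<bar>"
proof
  fix r x y :: real assume r: "r \<ge> e"
  define m where "m = Q * (1 + \<bar>\<mu>\<bar>)"
  have m: "m > 0" using Q_pos by (simp add: m_def)
  let ?A = "\<lambda>x. acc (- sin x / r) (- sin x) (cos x) r \<mu>"
  let ?C = "2 + (Q * (1 + \<bar>\<mu>\<bar>) * 2 + K / l * (1 / e)) + Q * (1 + \<bar>\<mu>\<bar>) * (1 / e + 2)"
  have rpos: "r > 0" using r e by simp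
  have bd: "\<bar>z / r\<bar> \<le> 1 / e * \<bar>z\<bar>" for z
    using r e by (simp add: abs_divide frac_le)
  have s: "\<bar>sin x - sin y\<bar> \<le> \<bar>x - y\<bar>" and c: "\<bar>cos x - cos y\<bar> \<le> \<bar>x - y\<bar>"
    by (simp_all add: abs_sin_diff_le abs_cos_diff_le)
  have Ad: "\<bar>?A x - ?A y\<bar> \<le> (m * 2 + K / l * (1 / e)) * \<bar>x - y\<bar>"
  proof -
    have "\<bar>?A x - ?A y\<bar> \<le> m * (\<bar>- sin x - - sin y\<bar> + \<bar>cos x - cos y\<bar>)
        + K / l * \<bar>- sin x / r - - sin y / r\<bar>"
      unfolding m_def by (rule acc_lipschitz)
    also have "\<dots> \<le> m * (\<bar>x - y\<bar> + \<bar>x - y\<bar>) + K / l * (1 / e * \<bar>x - y\<bar>)"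
    proof (intro add_mono mult_left_mono)
      have "\<bar>- sin x / r - - sin y / r\<bar> = \<bar>(sin x - sin y) / r\<bar>"
        by (simp add: diff_divide_distrib abs_minus_commute)
      also have "\<dots> \<le> 1 / e * \<bar>sin x - sin y\<bar>" by (rule bd)
      also have "\<dots> \<le> 1 / e * \<bar>x - y\<bar>" using s e by (intro mult_left_mono) auto
      finally show "\<bar>- sin x / r - - sin y / r\<bar> \<le> 1 / e * \<bar>x - y\<bar>" .
    qed (use s c m K_pos l_pos in auto)
    also have "\<dots> = (m * 2 + K / l * (1 / e)) * \<bar>x - y\<bar>" by (simp add: algebra_simps)
    finally show ?thesis .
  qed
  have Ab: "\<bar>?A y\<bar> \<le> m * (1 / e + 2)"
  proof -
    have "\<bar>?A y\<bar> \<le> m * (\<bar>- sin y / r\<bar> + \<bar>- sin y\<bar> + \<bar>cos y\<bar>)"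
      unfolding m_def by (rule acc_bound)
    also have "\<dots> \<le> m * (1 / e + 2)"
    proof (rule mult_left_mono)
      have "\<bar>- sin y / r\<bar> \<le> 1 / e * \<bar>- sin y\<bar>" by (rule bd)
      also have "\<dots> \<le> 1 / e * 1" using e by (intro mult_left_mono) auto
      finally show "\<bar>- sin y / r\<bar> + \<bar>- sin y\<bar> + \<bar>cos y\<bar> \<le> 1 / e + 2"
        using abs_sin_le_one[of y] abs_cos_le_one[of y] by (simp only: abs_minus_cancel)
    qed (use m in simp)
    finally show ?thesis .
  qed
  have "\<bar>(sin x)\<^sup>2 - (sin y)\<^sup>2\<bar> \<le> 2 * \<bar>x - y\<bar>"
  proof -
    have "\<bar>(sin x)\<^sup>2 - (sin y)\<^sup>2\<bar> = \<bar>sin x + sin y\<bar> * \<bar>sin x - sin y\<bar>"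
      by (simp add: power2_eq_square square_diff_square_factored abs_mult)
    moreover have "\<bar>sin x + sin y\<bar> \<le> 2"
      using abs_sin_le_one[of x] abs_sin_le_one[of y] by linarith
    ultimately show ?thesis
      using mult_mono[of "\<bar>sin x + sin y\<bar>" 2 "\<bar>sin x - sin y\<bar>" "\<bar>x - y\<bar>"] s by simp
  qed
  moreover have "\<bar>cos x * ?A x - cos y * ?A y\<bar> \<le> (m * 2 + K / l * (1 / e)) * \<bar>x - y\<bar> + m * (1 / e + 2) * \<bar>x - y\<bar>"
  proof -
    have "\<bar>cos x * ?A x - cos y * ?A y\<bar> \<le> \<bar>cos x\<bar> * \<bar>?A x - ?A y\<bar> + \<bar>cos x - cos y\<bar> * \<bar>?A y\<bar>"
      by (rule abs_mult_diff_le)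
    moreover have "\<bar>cos x\<bar> * \<bar>?A x - ?A y\<bar> \<le> 1 * ((m * 2 + K / l * (1 / e)) * \<bar>x - y\<bar>)"
      using Ad by (intro mult_mono) auto
    moreover have "\<bar>cos x - cos y\<bar> * \<bar>?A y\<bar> \<le> \<bar>x - y\<bar> * (m * (1 / e + 2))"
      using Ab c by (intro mult_mono) auto
    ultimately show ?thesis by (simp only: mult_1 mult.commute[of "\<bar>x - y\<bar>"])
  qed
  ultimately have "\<bar>Phi r x \<mu> - Phi r y \<mu>\<bar> \<le>
      2 * \<bar>x - y\<bar> + ((m * 2 + K / l * (1 / e)) * \<bar>x - y\<bar> + m * (1 / e + 2) * \<bar>x - y\<bar>)"
    unfolding Phi_def by linarith
  then show "\<bar>Phi r x \<mu> - Phi r y \<mu>\<bar> \<le> ?C * \<bar>x - y\<bar>"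
    unfolding m_def[symmetric] by (simp only: distrib_right add.assoc)
qed

end

section \<open>Dependence on the eigenvalue parameter and nodal structure\<close>

context radial_problem
begin

text \<open>At the origin both singular arguments coincide and the equation becomes
  \<open>H b b 0 1 0 = - \<mu>\<close>, with a left side that is monotone in both places. This is
  the source of strictness for the angles.\<close>

lemma bsol_0_strict_antimono:
  assumes "\<mu> < \<nu>"
  shows "bsol 0 \<nu> < bsol 0 \<mu>"
proof (rule ccontr)
  have *: "H (bsol 0 \<mu>) (bsol 0 \<mu>) 0 1 0 = - \<mu>" for \<mu>
    using H_sol[of 0 \<mu>] by (simp add: asol_0)
  assume "\<not> ?thesis"
  then have "bsol 0 \<mu> \<le> bsol 0 \<nu>" by simp
  then have "H (bsol 0 \<mu>) (bsol 0 \<mu>) 0 1 0 \<le> H (bsol 0 \<nu>) (bsol 0 \<nu>) 0 1 0"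
    by (meson H_b_mono H_le_iff order_trans)
  with * assms show False by simp
qed

lemma thetad_0: "thetad 0 \<mu> = - bsol 0 \<mu>"
  by (simp add: thetad_def asol_0)

text \<open>The angles separate near 0 because their initial derivatives \<open>- bsol 0\<close>
  differ. From some \<open>e > 0\<close> on, the weak monotonicity of \<open>Phi\<close> and its
  Lipschitz bound keep the difference positive.\<close>

lemma theta_strict_mono:
  assumes "\<mu> < \<nu>" and r: "r \<in> {0<..R}"
  shows "theta r \<mu> < theta r \<nu>"
proof -
  define D where "D s = theta s \<nu> - theta s \<mu>" for s
  have "(D has_real_derivative thetad 0 \<nu> - thetad 0 \<mu>) (at 0 within {0..R})"
    unfolding D_def using R_pos by (intro DERIV_diff theta_deriv) auto
  moreover have "thetad 0 \<nu> - thetad 0 \<mu> > 0"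
    using bsol_0_strict_antimono[OF assms(1)] by (simp add: thetad_0)
  ultimately obtain d where d: "d > 0" "\<And>h. 0 < h \<Longrightarrow> 0 + h \<in> {0..R} \<Longrightarrow> h < d \<Longrightarrow> D 0 < D (0 + h)"
    using has_real_derivative_pos_inc_right by blast
  define e where "e = min (d / 2) r"
  have e: "0 < e" "e < d" "e \<le> r" using d r by (auto simp: e_def min_def)
  have "D e > 0" using d(2)[of e] e r by (simp add: D_def)
  obtain C where C: "\<And>r x y. r \<ge> e \<Longrightarrow> \<bar>Phi r x \<mu> - Phi r y \<mu>\<bar> \<le> C * \<bar>x - y\<bar>"
    using Phi_lipschitz[OF e(1)] by blast
  have "D r > 0"
  proof (rule stays_positive[where f = D and a = e and b = r, OF e(3) _ \<open>D e > 0\<close>])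
    show "continuous_on {e..r} D"
      unfolding D_def using e r by (intro continuous_intros continuous_theta) auto
    fix x assume x: "e < x" "x < r" "D x \<ge> 0"
    then have xi: "x \<in> {0<..<R}" "x \<in> {0<..R}" using e r by auto
    have "(D has_real_derivative thetad x \<nu> - thetad x \<mu>) (at x)"
      unfolding D_def using xi by (intro DERIV_diff theta_deriv_at)
    moreover have "thetad x \<nu> - thetad x \<mu> \<ge> - C * D x"
    proof -
      have "thetad x \<nu> - thetad x \<mu> \<ge> Phi x (theta x \<nu>) \<mu> - Phi x (theta x \<mu>) \<mu>"
        using Phi_mono[of \<mu> \<nu> x "theta x \<nu>"] assms(1) by (simp add: thetad_eq_Phi[OF xi(2)])
      moreover have "\<bar>Phi x (theta x \<nu>) \<mu> - Phi x (theta x \<mu>) \<mu>\<bar> \<le> C * D x"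
        using C[of x "theta x \<nu>" "theta x \<mu>"] x by (simp add: D_def)
      ultimately show ?thesis by simp
    qed
    ultimately show "\<exists>d\<ge>- C * D x. (D has_real_derivative d) (at x)" by blast
  qed
  then show ?thesis by (simp add: D_def)
qed

lemma thetad_level:
  assumes "r \<in> {0..R}" "cos (theta r \<mu>) = 0"
  shows "thetad r \<mu> = 1"
proof -
  have "usol r \<mu> = 0" using assms by (simp add: usol_eq_0_iff)
  then show ?thesis using sol_nonzero[OF assms(1), of \<mu>] by (simp add: thetad_def)
qed

text \<open>Where \<open>u = 0\<close> the formula for \<open>thetad\<close> reduces to
  \<open>q\<^sup>2 / q\<^sup>2 = 1\<close>, so such a level is always crossed upwards.\<close>

lemma theta_crosses_level:
  assumes "0 \<le> r" "r < s" "s \<le> R" "cos c = 0" "c \<le> theta r \<mu>"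
  shows "c < theta s \<mu>"
  by (rule level_crossing[where f = "\<lambda>r. theta r \<mu>" and A = 0 and B = R and ?r1.0 = r
        and f' = "\<lambda>r. thetad r \<mu>"])
    (use assms theta_deriv thetad_level in auto)

lemma theta_lower: "r \<in> {0..R} \<Longrightarrow> - pi / 2 < theta r \<mu>"
  using theta_crosses_level[of 0 r "- pi / 2" \<mu>] pi_gt_zero
  by (cases "r = 0") auto

text \<open>Here the barrier is the level 0, where \<open>u > 0\<close> and \<open>u' = 0\<close>.
  For such \<open>\<mu>\<close> the equation forces \<open>u'' > 0\<close> there, so the negated
  angle crosses 0 only upwards, starting at \<open>r = 0\<close>.\<close>

lemma theta_end_negative:
  assumes "\<mu> < - K"
  shows "theta R \<mu> < 0"
proof -
  have "0 < - theta R \<mu>"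
  proof (rule level_crossing[where f = "\<lambda>r. - theta r \<mu>" and A = 0 and B = R and ?r1.0 = 0
        and f' = "\<lambda>r. - thetad r \<mu>"])
    show "((\<lambda>r. - theta r \<mu>) has_real_derivative - thetad r \<mu>) (at r within {0..R})"
      if "r \<in> {0..R}" for r using theta_deriv[OF that] by (rule DERIV_minus)
    have bound: "H 0 0 0 u r < - \<mu> * u" if "u > 0" for u r
    proof -
      have "H 0 0 0 u r \<le> K * u" using H_pu[of 0 0 0 u r 0 0] that by (simp add: H_zero)
      also have "\<dots> < - \<mu> * u" using assms that by (intro mult_strict_right_mono) auto
      finally show ?thesis .
    qed
    fix r assume r: "r \<in> {0..R}" "- theta r \<mu> = 0"
    then have uq: "usol r \<mu> > 0" "qsol r \<mu> = 0"
      using usol_polar[OF r(1), of \<mu>] qsol_polar[OF r(1), of \<mu>] rho_pos[OF r(1), of \<mu>] by auto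
    have "asol r \<mu> > 0"
    proof (cases "r = 0")
      \<comment> \<open>At the origin \<open>qsol\<close> vanishes whatever \<open>bsol\<close> is,
        so \<open>b = 0\<close> cannot be inferred. Instead \<open>asol_0\<close> identifies
        \<open>a\<close> with \<open>b\<close>, and monotonicity in both is used.\<close>
      case True
      show ?thesis
      proof (rule ccontr)
        assume "\<not> asol r \<mu> > 0"
        then have "bsol 0 \<mu> \<le> 0" using True by (simp add: asol_0)
        then have "H (bsol 0 \<mu>) (bsol 0 \<mu>) 0 1 0 \<le> H 0 0 0 1 0"
          by (meson H_b_mono H_le_iff order_trans)
        with bound[of 1 0] H_sol[of 0 \<mu>] show False by (simp add: asol_0)
      qed
    next
      case False
      then have "bsol r \<mu> = 0" using uq(2) by (simp add: qsol_def)
      then show ?thesis using bound[OF uq(1), of r] uq(2) by (simp add: asol_def less_acc_iff)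
    qed
    then show "- thetad r \<mu> > 0" using uq by (simp add: thetad_def)
  qed (use R_pos in auto)
  then show ?thesis by simp
qed

text \<open>The lower order part of the equation is bounded by \<open>l * K2\<close>, so
  \<open>- cos x * acc\<close> is at least
  \<open>\<mu> / K * (cos x)\<^sup>2 - K2 * \<bar>cos x\<bar>\<close>. Young's inequality splits the
  last product; it costs half of the 1 in \<open>(sin x)\<^sup>2 = 1 - (cos x)\<^sup>2\<close> and
  leaves the constant \<open>1 / 2\<close>.\<close>

lemma Phi_lower:
  assumes \<mu>: "\<mu> \<ge> 0" and r: "r \<ge> e" and e: "e > 0"
  defines "K2 \<equiv> K * (1 / e + 2) / l"
  shows "Phi r x \<mu> \<ge> 1 / 2 + (\<mu> / K - 1 - K2\<^sup>2 / 2) * (cos x)\<^sup>2"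
proof -
  let ?b = "- sin x / r" and ?p = "- sin x"
  define c where "c = cos x"
  define A where "A = acc ?b ?p c r \<mu>"
  have K2: "l * K2 = K * (1 / e + 2)" "K2 \<ge> 0"
    using l_pos K_pos e by (auto simp: K2_def)
  have H0: "\<bar>H 0 ?b ?p c r\<bar> \<le> l * K2"
  proof -
    have "\<bar>H 0 ?b ?p c r\<bar> \<le> K * \<bar>?b\<bar> + K * (\<bar>?p\<bar> + \<bar>c\<bar>)"
      using H_b_dist[of 0 ?b ?p c r 0] H_pu[of 0 0 ?p c r 0 0] H_zero[of r] by simp linarith
    also have "\<dots> = K * (\<bar>?b\<bar> + \<bar>?p\<bar> + \<bar>c\<bar>)" by (simp add: algebra_simps)
    also have "\<dots> \<le> K * (1 / e + 2)"
    proof (rule mult_left_mono)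
      have "\<bar>?b\<bar> \<le> 1 / e"
        using r e by (simp add: abs_divide frac_le)
      moreover have "\<bar>?p\<bar> \<le> 1" "\<bar>c\<bar> \<le> 1" by (simp_all add: c_def)
      ultimately show "\<bar>?b\<bar> + \<bar>?p\<bar> + \<bar>c\<bar> \<le> 1 / e + 2" by linarith
    qed (use K_pos in simp)
    finally show ?thesis using K2 by simp
  qed
  define m where "m = \<mu> * \<bar>c\<bar> / K"
  have m: "m \<ge> 0" "K * m = \<mu> * \<bar>c\<bar>" using \<mu> K_pos by (auto simp: m_def)
  have "- c * A \<ge> \<bar>c\<bar> * (m - K2)"
  proof (cases "c \<ge> 0")
    case True
    \<comment> \<open>Moving from 0 up to \<open>K2\<close> with slope at least \<open>l\<close>
      makes \<open>H\<close> nonnegative; moving back by \<open>m\<close> with slope at most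
      \<open>K\<close> loses at most \<open>\<mu> * c\<close>.\<close>
    have "H A ?b ?p c r \<le> H (K2 - m) ?b ?p c r"
      using H_a_lower[of 0 K2 ?b ?p c r] H_a_upper[of "K2 - m" K2 ?b ?p c r] H0 K2 m True
      by (simp add: A_def H_acc abs_le_iff)
    then have "A \<le> K2 - m" by (simp only: H_le_iff)
    from mult_left_mono[OF this True] True show ?thesis by (simp add: algebra_simps)
  next
    case False
    have "H (m - K2) ?b ?p c r \<le> H A ?b ?p c r"
      using H_a_lower[of "- K2" 0 ?b ?p c r] H_a_upper[of "- K2" "m - K2" ?b ?p c r] H0 K2 m False
      by (simp add: A_def H_acc abs_le_iff)
    then have "m - K2 \<le> A" by (simp only: H_le_iff)
    with False show ?thesis by (simp add: mult_left_mono)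
  qed
  moreover have "\<bar>c\<bar> * (m - K2) = \<mu> / K * c\<^sup>2 - K2 * \<bar>c\<bar>"
    by (simp add: m_def right_diff_distrib power2_eq_square mult.commute)
  moreover have "2 * (K2 * \<bar>c\<bar>) \<le> 1 + K2\<^sup>2 * c\<^sup>2"
    using sum_squares_bound[of 1 "K2 * \<bar>c\<bar>"] by (simp add: power_mult_distrib)
  moreover have "(sin x)\<^sup>2 = 1 - c\<^sup>2" unfolding c_def by (rule sin_squared_eq)
  moreover have "Phi r x \<mu> = (sin x)\<^sup>2 - c * A" by (simp add: Phi_def c_def A_def)
  moreover have "(\<mu> / K - 1 - K2\<^sup>2 / 2) * c\<^sup>2 = \<mu> / K * c\<^sup>2 - c\<^sup>2 - K2\<^sup>2 * c\<^sup>2 / 2"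
    by (simp add: algebra_simps)
  ultimately show ?thesis unfolding c_def[symmetric] by linarith
qed

text \<open>The substitution \<open>h(\<theta>)\<close> with \<open>h' = 1 / (1 / 2 + n cos\<^sup>2)\<close> turns the differential
  inequality of \<open>Phi_lower\<close> into \<open>(h \<circ> \<theta>)' \<ge> 1\<close>, while the total variation of \<open>h\<close> on a fixed
  interval tends to 0.\<close>

lemma theta_end_unbounded: "\<exists>\<mu>. theta R \<mu> > B"
proof (rule ccontr)
  assume "\<not> ?thesis"
  then have le_B: "theta R \<mu> \<le> B" for \<mu> by (simp add: not_less)
  \<comment> \<open>Staying away from the origin keeps \<open>K2\<close> fixed while
    \<open>\<mu>\<close> grows.\<close>
  define e where "e = R / 2"
  have e: "e > 0" "e < R" using R_pos by (auto simp: e_def)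
  define K2 where "K2 = K * (1 / e + 2) / l"
  define f where "f n x = 1 / (1 / 2 + real n * (cos x)\<^sup>2)" for n x
  have fpos: "1 / 2 + real n * (cos x)\<^sup>2 > 0" for n x
    by (smt (verit) divide_pos_pos mult_nonneg_nonneg of_nat_0_le_iff zero_le_power2)
  have fcont: "continuous_on S (f n)" for S n
    unfolding f_def using fpos by (intro continuous_intros) (metis less_irrefl)
  have "R - e \<le> integral {- pi / 2..B + 1} (f n)" for n
  proof -
    \<comment> \<open>Chosen so that the coefficient of the squared cosine in
      \<open>Phi_lower\<close> is exactly \<open>n\<close>.\<close>
    define \<mu> where "\<mu> = K * (real n + 1 + K2\<^sup>2 / 2)"
    have \<mu>: "\<mu> \<ge> 0" "\<mu> / K - 1 - K2\<^sup>2 / 2 = real n"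
      using K_pos by (auto simp: \<mu>_def)
    have lower: "thetad x \<mu> \<ge> 1 / 2 + real n * (cos (theta x \<mu>))\<^sup>2" if "x \<in> {e..R}" for x
      using Phi_lower[OF \<mu>(1) _ e(1), of x "theta x \<mu>"] that e thetad_eq_Phi[of x \<mu>] \<mu>(2)
      by (simp add: K2_def)
    define h where "h y = integral {- pi / 2..y} (f n)" for y
    have upper: "theta x \<mu> \<le> B" if x: "x \<in> {e..R}" for x
    proof -
      have "theta x \<mu> \<le> theta R \<mu>"
      proof (rule nonneg_derivative_imp_le[where f = "\<lambda>x. theta x \<mu>"])
        show "continuous_on {x..R} (\<lambda>r. theta r \<mu>)"
          using x e by (intro continuous_theta) auto
        fix y assume y: "x < y" "y < R"
        have "thetad y \<mu> \<ge> 0" using lower[of y] fpos[of n "theta y \<mu>"] x y by simp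
        moreover have "((\<lambda>r. theta r \<mu>) has_real_derivative thetad y \<mu>) (at y)"
          using x y e by (intro theta_deriv_at) auto
        ultimately show "\<exists>d\<ge>0. ((\<lambda>r. theta r \<mu>) has_real_derivative d) (at y)" by blast
      qed (use x in simp)
      also have "\<dots> \<le> B" by (rule le_B)
      finally show ?thesis .
    qed
    \<comment> \<open>Angles lie strictly above \<open>- pi / 2\<close> and at most at
      \<open>B\<close>; ending at \<open>B + 1\<close> makes \<open>h\<close> differentiable from
      both sides at all of them.\<close>
    have h_deriv: "(h has_real_derivative f n y) (at y)" if y: "- pi / 2 < y" "y < B + 1" for y
    proof -
      have "(h has_real_derivative f n y) (at y within {- pi / 2..B + 1})"
        unfolding h_def using y by (intro integral_has_real_derivative fcont) auto
      then show ?thesis using at_within_Icc_at[of "- pi / 2" y "B + 1"] y by simp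
    qed
    have h_mono: "h y \<le> h z" if "- pi / 2 < y" "y \<le> z" "z < B + 1" for y z
    proof (rule nonneg_derivative_imp_le[where f = h, OF that(2)])
      show "continuous_on {y..z} h"
        by (intro continuous_at_imp_continuous_on ballI DERIV_isCont[OF h_deriv]) (use that in auto)
      show "\<exists>d\<ge>0. (h has_real_derivative d) (at x)" if "y < x" "x < z" for x
        using h_deriv[of x] fpos[of n x] that \<open>- pi / 2 < y\<close> \<open>z < B + 1\<close>
        by (intro exI[of _ "f n x"]) (auto simp: f_def less_imp_le)
    qed
    have "h (theta e \<mu>) - e \<le> h (theta R \<mu>) - R"
    proof (rule nonneg_derivative_imp_le[where f = "\<lambda>x. h (theta x \<mu>) - x"])
      have range: "- pi / 2 < theta x \<mu>" "theta x \<mu> < B + 1" if "x \<in> {e..R}" for x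
        using theta_lower[of x \<mu>] upper[OF that] that e by auto
      have "continuous_on {e..R} (\<lambda>x. h (theta x \<mu>))"
      proof (rule continuous_on_compose2[of "{- pi / 2<..<B + 1}" h])
        show "continuous_on {- pi / 2<..<B + 1} h"
          by (intro continuous_at_imp_continuous_on ballI DERIV_isCont[OF h_deriv]) auto
        show "continuous_on {e..R} (\<lambda>x. theta x \<mu>)" using e by (intro continuous_theta) auto
      qed (use range in auto)
      then show "continuous_on {e..R} (\<lambda>x. h (theta x \<mu>) - x)" by (intro continuous_intros)
      fix x assume x: "e < x" "x < R"
      have "((\<lambda>x. theta x \<mu>) has_real_derivative thetad x \<mu>) (at x)"
        using x e by (intro theta_deriv_at) auto
      moreover have "(h has_real_derivative f n (theta x \<mu>)) (at (theta x \<mu>))"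
        using range[of x] x by (intro h_deriv) auto
      ultimately have "((\<lambda>x. h (theta x \<mu>)) has_real_derivative f n (theta x \<mu>) * thetad x \<mu>) (at x)"
        by (rule DERIV_chain2[rotated])
      then have "((\<lambda>x. h (theta x \<mu>) - x) has_real_derivative f n (theta x \<mu>) * thetad x \<mu> - 1) (at x)"
        by (intro DERIV_diff DERIV_ident)
      moreover have "f n (theta x \<mu>) * thetad x \<mu> \<ge> 1"
        using lower[of x] x fpos[of n "theta x \<mu>"] by (simp add: f_def)
      ultimately show "\<exists>d\<ge>0. ((\<lambda>x. h (theta x \<mu>) - x) has_real_derivative d) (at x)"
        by (intro exI[of _ "f n (theta x \<mu>) * thetad x \<mu> - 1"]) auto
    qed (use e in simp)
    moreover have "h (theta e \<mu>) \<ge> 0"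
      unfolding h_def using fpos
      by (intro integral_nonneg integrable_continuous_interval fcont) (simp add: f_def less_imp_le)
    moreover have "h (theta R \<mu>) \<le> h B"
      using theta_lower[of R \<mu>] le_B[of \<mu>] R_pos by (intro h_mono) auto
    moreover have "h B \<le> integral {- pi / 2..B + 1} (f n)"
      unfolding h_def using fpos
      by (intro integral_subset_le integrable_continuous_interval fcont)
        (auto simp: f_def less_imp_le)
    ultimately show ?thesis by linarith
  qed
  moreover have "(\<lambda>n. integral {- pi / 2..B + 1} (f n)) \<longlonglongrightarrow> 0"
    unfolding f_def by (rule integral_inverse_cos_square_tendsto_0)
  ultimately have "R - e \<le> 0"
    by (intro tendsto_lowerbound[of _ 0 sequentially]) auto
  then show False using e by simp
qed

lemma theta_end_surj:
  assumes "c \<ge> 0"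
  shows "\<exists>\<mu>. theta R \<mu> = c"
proof -
  obtain \<nu> where \<nu>: "theta R \<nu> > c" using theta_end_unbounded by blast
  define \<mu> where "\<mu> = - K - 1"
  have \<mu>: "theta R \<mu> < 0" using theta_end_negative by (simp add: \<mu>_def)
  then have "\<mu> \<le> \<nu>"
    using \<nu> theta_strict_mono[of \<nu> \<mu> R] R_pos assms by force
  then show ?thesis
    using IVT'[of "\<lambda>\<mu>. theta R \<mu>" \<mu> c \<nu>] \<mu> \<nu> assms
      continuous_on_subset[OF continuous_theta_end] by (metis less_imp_le order_trans subset_UNIV)
qed

section \<open>Zeros of the solution as levels of the angle\<close>

lemma theta_levels:
  assumes "r \<in> {0..R}" "usol r \<mu> = 0"
  obtains k :: nat where "theta r \<mu> = pi / 2 + real k * pi"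
proof -
  obtain k :: int where k: "theta r \<mu> = pi / 2 + of_int k * pi"
    using cos_eq_0_imp assms usol_eq_0_iff by metis
  have "k \<ge> 0"
  proof (rule ccontr)
    assume "\<not> k \<ge> 0"
    then have "of_int k * pi \<le> (- 1) * pi" by (intro mult_right_mono) auto
    with k theta_lower[OF assms(1), of \<mu>] show False by simp
  qed
  then show ?thesis using k that[of "nat k"] by simp
qed

lemma cos_level_nat: "cos (pi / 2 + real k * pi) = 0"
  using cos_level[of "int k"] by simp

text \<open>The intermediate value theorem yields a point for each level below the end angle; upward
  crossing makes it unique and puts the points in the order of the levels. An interior zero on any
  other level would force the end angle above its assumed value.\<close>

lemma nodal_structure:
  assumes at_R: "theta R \<mu> = pi / 2 + real n * pi"
  obtains r where "interior_zeros R n (\<lambda>s. usol s \<mu>) r"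
    and "\<And>s. s \<in> {0<..<first_zero R n r} \<Longrightarrow> usol s \<mu> > 0"
proof -
  \<comment> \<open>Zeros are numbered from 1 but levels from 0, hence the shift; only
    \<open>j \<ge> 1\<close> matters, so the truncated subtraction is harmless.\<close>
  define c where "c j = pi / 2 + real (j - 1) * pi" for j :: nat
  have cos_c: "cos (c j) = 0" for j unfolding c_def by (rule cos_level_nat)
  have "\<exists>r. r \<in> {0<..<R} \<and> theta r \<mu> = c j" if j: "j \<in> {1..n}" for j
  proof -
    have c: "c j > 0" "c j < theta R \<mu>"
    proof -
      show "c j > 0" using pi_gt_zero by (simp add: c_def add_pos_nonneg)
      have "real (j - 1) < real n" using j by simp
      then show "c j < theta R \<mu>" using pi_gt_zero by (simp add: c_def at_R)
    qed
    then obtain r where r: "0 \<le> r" "r \<le> R" "theta r \<mu> = c j"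
      using IVT'[of "\<lambda>r. theta r \<mu>" 0 "c j" R] continuous_theta[of "{0..R}" \<mu>] R_pos by auto
    moreover have "r \<noteq> 0" "r \<noteq> R" using c r by auto
    ultimately show ?thesis by (intro exI[of _ r]) auto
  qed
  then obtain r where r: "\<And>j. j \<in> {1..n} \<Longrightarrow> r j \<in> {0<..<R} \<and> theta (r j) \<mu> = c j" by metis
  have zeros: "interior_zeros R n (\<lambda>s. usol s \<mu>) r"
    unfolding interior_zeros_def
  proof (intro conjI strict_mono_onI set_eqI iffI)
    fix i j assume ij: "i \<in> {1..n}" "j \<in> {1..n}" "i < j"
    show "r i < r j"
    proof (rule ccontr)
      assume "\<not> r i < r j"
      then have "r j \<le> r i" by simp
      have "c i < c j" using ij pi_gt_zero by (simp add: c_def)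
      show False
      proof (cases "r j = r i")
        case True
        then show ?thesis using r[OF ij(1)] r[OF ij(2)] \<open>c i < c j\<close> by simp
      next
        case False
        then have "c j < theta (r i) \<mu>"
          using \<open>r j \<le> r i\<close> r[OF ij(1)] r[OF ij(2)] cos_c
          by (intro theta_crosses_level[of "r j"]) auto
        then show ?thesis using r[OF ij(1)] \<open>c i < c j\<close> by simp
      qed
    qed
  next
    fix s assume "s \<in> {s \<in> {0<..<R}. usol s \<mu> = 0}"
    then have s: "0 < s" "s < R" "usol s \<mu> = 0" by auto
    obtain k :: nat where k: "theta s \<mu> = pi / 2 + real k * pi"
      using theta_levels[of s \<mu>] s by auto
    have "theta s \<mu> < theta R \<mu>"
      using s k cos_level_nat by (intro theta_crosses_level[of s R]) auto
    then have "k < n" using k pi_gt_zero by (simp add: at_R)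
    then have j: "Suc k \<in> {1..n}" by simp
    have eq: "theta s \<mu> = c (Suc k)" by (simp add: c_def k)
    have "r (Suc k) = s"
    proof (rule linorder_cases)
      assume "r (Suc k) < s"
      then have "c (Suc k) < theta s \<mu>"
        using r[OF j] s cos_c by (intro theta_crosses_level[of "r (Suc k)"]) auto
      then show ?thesis using eq by simp
    next
      assume "s < r (Suc k)"
      then have "c (Suc k) < theta (r (Suc k)) \<mu>"
        using r[OF j] s cos_c eq by (intro theta_crosses_level[of s]) auto
      then show ?thesis using r[OF j] by simp
    qed
    then show "s \<in> r ` {1..n}" using j by blast
  next
    fix s assume "s \<in> r ` {1..n}"
    then obtain j where j: "j \<in> {1..n}" "s = r j" by blast
    then show "s \<in> {s \<in> {0<..<R}. usol s \<mu> = 0}"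
      using r[OF j(1)] cos_c[of j] usol_eq_0_iff[of s \<mu>] by auto
  qed
  moreover have "usol s \<mu> > 0" if s: "s \<in> {0<..<first_zero R n r}" for s
  proof -
    \<comment> \<open>For \<open>n = 0\<close> the point is \<open>R\<close> itself, whose angle is
      then also \<open>pi / 2\<close>.\<close>
    have first: "first_zero R n r \<in> {0<..R}" "theta (first_zero R n r) \<mu> = pi / 2"
      using r[of 1] at_R R_pos by (auto simp: first_zero_def c_def)
    have sR: "s \<in> {0..R}" using s first by auto
    have "theta s \<mu> < pi / 2"
    proof (rule ccontr)
      assume "\<not> theta s \<mu> < pi / 2"
      then have "pi / 2 < theta (first_zero R n r) \<mu>"
        using s first by (intro theta_crosses_level[of s]) auto
      with first show False by simp
    qed
    then have "cos (theta s \<mu>) > 0"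
      using theta_lower[OF sR, of \<mu>] by (intro cos_gt_zero_pi) auto
    then show ?thesis using usol_polar[OF sR] rho_pos[OF sR] by simp
  qed
  ultimately show ?thesis by (rule that)
qed

theorem nodal_eigenvalues:
  obtains lam where "strict_mono lam"
    and "\<And>n. usol R (lam n) = 0"
    and "\<And>n. \<exists>r. interior_zeros R n (\<lambda>s. usol s (lam n)) r \<and>
           (\<forall>s\<in>{0<..<first_zero R n r}. usol s (lam n) > 0)"
    and "\<And>\<mu>. usol R \<mu> = 0 \<Longrightarrow> \<exists>n. \<mu> = lam n"
proof -
  have "\<exists>\<mu>. theta R \<mu> = pi / 2 + real n * pi" for n
    by (rule theta_end_surj) simp
  then obtain lam where lam: "\<And>n. theta R (lam n) = pi / 2 + real n * pi" by metis
  have R: "R \<in> {0..R}" "R \<in> {0<..R}" using R_pos by auto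
  have inj: "\<mu> = \<nu>" if "theta R \<mu> = theta R \<nu>" for \<mu> \<nu>
    using theta_strict_mono[of \<mu> \<nu> R] theta_strict_mono[of \<nu> \<mu> R] R that
    by (metis less_irrefl linorder_cases)
  show ?thesis
  proof (rule that[of lam])
    show "strict_mono lam"
    proof (rule strict_monoI)
      fix m n :: nat assume "m < n"
      then have "theta R (lam m) < theta R (lam n)" using pi_gt_zero by (simp add: lam)
      then show "lam m < lam n"
        using theta_strict_mono[of "lam n" "lam m" R] R
        by (metis less_asym less_irrefl linorder_cases)
    qed
    show "usol R (lam n) = 0" for n
      using usol_eq_0_iff[OF R(1)] by (simp add: lam cos_level_nat)
    show "\<exists>r. interior_zeros R n (\<lambda>s. usol s (lam n)) r \<and>
           (\<forall>s\<in>{0<..<first_zero R n r}. usol s (lam n) > 0)" for n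
      using nodal_structure[OF lam] by metis
    show "\<exists>n. \<mu> = lam n" if "usol R \<mu> = 0" for \<mu>
      using theta_levels[OF R(1) that] inj lam by metis
  qed
qed

end

section \<open>Hessians of radial functions and Pucci operators\<close>

lemma tensor_mult: "tensor x y *v h = (y \<bullet> h) *\<^sub>R x"
  by (simp add: vec_eq_iff tensor_def matrix_vector_mult_def inner_vec_def sum_distrib_left mult_ac)

lemma tensor_scaleR: "tensor (a *\<^sub>R x) (b *\<^sub>R y) = (a * b) *\<^sub>R tensor x y"
  by (simp add: tensor_def vec_eq_iff)

lemma scaleR_mat_mult: "(c *\<^sub>R A) *v h = c *\<^sub>R (A *v (h :: real^'n))" for A :: "real^'n^'m"
  by (simp add: scaleR_matrix_vector_assoc)

lemma radial_hessian_mult: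
  "radial_hessian m p x *v h =
     (p / norm x) *\<^sub>R h + ((m - p / norm x) / (norm x)\<^sup>2 * (x \<bullet> h)) *\<^sub>R x"
  by (simp add: radial_hessian_def matrix_vector_mult_add_rdistrib scaleR_mat_mult tensor_mult)

lemma grad_eqI:
  assumes "(u has_derivative (\<lambda>h. g \<bullet> h)) (at x)"
  shows "grad u x = g"
  unfolding grad_def frechet_derivative_at[OF assms, symmetric] by (simp add: vec_eq_iff inner_axis)

lemma has_derivative_grad:
  fixes u :: "real^'n \<Rightarrow> real"
  assumes "u differentiable (at x)"
  shows "(u has_derivative (\<lambda>h. grad u x \<bullet> h)) (at x)"
proof -
  let ?f = "frechet_derivative u (at x)"
  have D: "(u has_derivative ?f) (at x)" using assms by (simp add: frechet_derivative_works)
  then have lin: "linear ?f" by (rule has_derivative_linear)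
  have "?f h = grad u x \<bullet> h" for h
  proof -
    have "?f h = ?f (\<Sum>i\<in>UNIV. (h $ i) *\<^sub>R axis i 1)"
      using basis_expansion[of h] by (simp add: scalar_mult_eq_scaleR)
    also have "\<dots> = (\<Sum>i\<in>UNIV. (h $ i) * ?f (axis i 1))"
      using lin by (simp add: linear_sum linear_cmul)
    finally show ?thesis by (simp add: grad_def inner_vec_def mult.commute)
  qed
  then have "?f = (\<lambda>h. grad u x \<bullet> h)" by blast
  with D show ?thesis by simp
qed

lemma hessian_eqI:
  assumes "(grad u has_derivative (\<lambda>h. M *v h)) (at x)"
  shows "hessian u x = M"
  unfolding hessian_def jacobian_def frechet_derivative_at[OF assms, symmetric]
  by (rule matrix_of_matrix_vector_mul)

lemma has_derivative_hessian:
  assumes "grad u differentiable (at x)"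
  shows "(grad u has_derivative (\<lambda>h. hessian u x *v h)) (at x)"
  using assms jacobian_works unfolding hessian_def by blast

lemma radial_has_derivative:
  fixes x :: "real^'n"
  assumes "(\<phi> has_real_derivative q) (at (norm x))" "x \<noteq> 0"
  shows "((\<lambda>x. \<phi> (norm x)) has_derivative (\<lambda>h. ((q / norm x) *\<^sub>R x) \<bullet> h)) (at x)"
proof -
  have "(norm has_derivative (\<lambda>h. h \<bullet> sgn x)) (at x)" by (rule has_derivative_norm[OF assms(2)])
  moreover have "(\<phi> has_derivative (\<lambda>h. q * h)) (at (norm x))"
    using assms(1) by (simp add: has_field_derivative_def)
  ultimately have "((\<lambda>x. \<phi> (norm x)) has_derivative (\<lambda>h. q * (h \<bullet> sgn x))) (at x)"
    by (rule has_derivative_compose)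
  then show ?thesis
    by (rule has_derivative_eq_rhs) (simp add: fun_eq_iff sgn_div_norm inner_commute divide_inverse)
qed

lemma radial_grad_has_derivative:
  fixes x :: "real^'n"
  assumes "(q has_real_derivative a) (at (norm x))" "x \<noteq> 0"
  shows "((\<lambda>x. (q (norm x) / norm x) *\<^sub>R x) has_derivative
    (\<lambda>h. radial_hessian a (q (norm x)) x *v h)) (at x)"
proof -
  let ?r = "norm x"
  have r: "?r > 0" using assms(2) by simp
  have "((\<lambda>r. q r / r) has_real_derivative (a * ?r - q ?r * 1) / (?r * ?r)) (at ?r)"
    using r by (intro DERIV_divide assms(1) DERIV_ident) auto
  from radial_has_derivative[OF this assms(2)]
  have "((\<lambda>x. q (norm x) / norm x) has_derivative
    (\<lambda>h. (((a * ?r - q ?r * 1) / (?r * ?r) / ?r) *\<^sub>R x) \<bullet> h)) (at x)" .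
  from has_derivative_scaleR[OF this has_derivative_ident]
  have D: "((\<lambda>x. (q (norm x) / norm x) *\<^sub>R x) has_derivative
    (\<lambda>h. (q ?r / ?r) *\<^sub>R h + ((((a * ?r - q ?r * 1) / (?r * ?r) / ?r) *\<^sub>R x) \<bullet> h) *\<^sub>R x)) (at x)" .
  have "(a * ?r - q ?r * 1) / (?r * ?r) / ?r = (a - q ?r / ?r) / ?r\<^sup>2"
    using r by (simp add: divide_simps power2_eq_square)
  then show ?thesis
    by (intro has_derivative_eq_rhs[OF D]) (simp add: fun_eq_iff radial_hessian_mult)
qed

text \<open>Changing only \<open>a\<close> or only \<open>b\<close> changes the radial Hessian by
  \<open>t\<close> times a projection. The identity \<open>M * M = t * M\<close> then determines the
  possible eigenvalues without diagonalization.\<close>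

lemma eigenvalues_scaled_projection:
  fixes M :: "real^'n^'n"
  assumes "\<And>v. M *v (M *v v) = t *\<^sub>R (M *v v)"
  shows "eigenvalues M \<subseteq> {0, t}"
proof
  fix e assume "e \<in> eigenvalues M"
  then obtain v where v: "v \<noteq> 0" "M *v v = e *\<^sub>R v" by (auto simp: eigenvalues_def)
  have "e *\<^sub>R (e *\<^sub>R v) = t *\<^sub>R (e *\<^sub>R v)"
    using assms[of v] by (simp add: v(2) matrix_vector_mult_scaleR)
  then have "(e * e - t * e) *\<^sub>R v = 0" by (simp add: scaleR_left_diff_distrib)
  then have "e * (e - t) = 0" using v(1) by (simp add: algebra_simps)
  then show "e \<in> {0, t}" by auto
qed

context
  fixes M :: "real^'n^'n" and t l L :: real
  assumes proj: "\<And>v. M *v (M *v v) = t *\<^sub>R (M *v v)" and t: "t \<ge> 0" and l: "0 < l" and L: "l \<le> L"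
begin

lemma no_negative_eigenvalues: "{e \<in> eigenvalues M. e < 0} = {}"
  using eigenvalues_scaled_projection[OF proj] t by auto

lemma pucci_minus_nonneg: "0 \<le> pucci_minus l L M"
  unfolding pucci_minus_def no_negative_eigenvalues
  using l by (auto intro!: sum_nonneg mult_nonneg_nonneg)

lemma pucci_plus_le: "pucci_plus l L M \<le> L * real CARD('n) * t"
proof -
  have "(\<Sum>e | e \<in> eigenvalues M \<and> e > 0. real (dim (eigenspace M e)) * e) \<le>
      (\<Sum>e\<in>{t}. real CARD('n) * e)"
  proof (rule order_trans[OF sum_mono sum_mono2])
    show "real (dim (eigenspace M e)) * e \<le> real CARD('n) * e"
      if "e \<in> {e \<in> eigenvalues M. 0 < e}" for e
      using that dim_subset_UNIV_cart[of "eigenspace M e"] by (intro mult_right_mono) auto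
  qed (use eigenvalues_scaled_projection[OF proj] t in auto)
  then have "L * (\<Sum>e | e \<in> eigenvalues M \<and> e > 0. real (dim (eigenspace M e)) * e)
      \<le> L * (real CARD('n) * t)" using l L by (intro mult_left_mono) auto
  then show ?thesis by (simp add: pucci_plus_def no_negative_eigenvalues)
qed

text \<open>The eigenvector is needed to know that \<open>t\<close> really occurs. The radial
  direction supplies one for changes of \<open>a\<close>; for changes of \<open>b\<close> in
  dimension 1 the projection is 0 and there is none when \<open>t > 0\<close>.\<close>

lemma pucci_minus_ge:
  assumes v: "v \<noteq> 0" "M *v v = t *\<^sub>R v"
  shows "l * t \<le> pucci_minus l L M"
proof (cases "t = 0")
  case False
  then have "t > 0" using t by simp
  have "{e \<in> eigenvalues M. e > 0} = {t}"
    using eigenvalues_scaled_projection[OF proj] \<open>t > 0\<close> v by (auto simp: eigenvalues_def)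
  moreover have "1 * t \<le> real (dim (eigenspace M t)) * t"
  proof (rule mult_right_mono[OF _ t])
    have "v \<in> eigenspace M t" using v by (simp add: eigenspace_def)
    then have "dim (eigenspace M t) \<noteq> 0" using v(1) by (auto simp only: dim_eq_0)
    then show "1 \<le> real (dim (eigenspace M t))" by (metis of_nat_1 of_nat_mono less_one linorder_not_le)
  qed
  ultimately show ?thesis
    using l by (simp add: pucci_minus_def no_negative_eigenvalues)
qed (use pucci_minus_nonneg in simp)

end

section \<open>Radial Hessians along a fixed ray\<close>

definition unit_dir :: "real^'n" where "unit_dir = axis undefined 1"

lemma norm_unit_dir [simp]: "norm (unit_dir :: real^'n) = 1"
  and inner_unit_dir [simp]: "(unit_dir :: real^'n) \<bullet> unit_dir = 1"
  and unit_dir_nonzero [simp]: "(unit_dir :: real^'n) \<noteq> 0"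
  by (simp_all add: unit_dir_def norm_axis_1 inner_axis_axis axis_eq_0_iff)

text \<open>Eigenvalue \<open>a\<close> along the ray and \<open>b\<close> on its orthogonal
  complement. With \<open>b\<close> as an independent argument there is no division by the radius,
  so the origin is included.\<close>

definition hess_mat :: "real \<Rightarrow> real \<Rightarrow> real^'n^'n" where
  "hess_mat a b = b *\<^sub>R mat 1 + (a - b) *\<^sub>R tensor unit_dir unit_dir"

lemma hess_mat_sym: "hess_mat a b \<in> sym_mats"
  by (simp add: sym_mats_def hess_mat_def vec_eq_iff transpose_def mat_def tensor_def)

lemma hess_mat_mult: "hess_mat a b *v h = b *\<^sub>R h + ((a - b) * (unit_dir \<bullet> h)) *\<^sub>R unit_dir"
  by (simp add: hess_mat_def matrix_vector_mult_add_rdistrib scaleR_mat_mult tensor_mult)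

lemma hess_mat_scale: "hess_mat (s * a) (s * b) = s *\<^sub>R hess_mat a b"
  by (simp add: hess_mat_def scaleR_add_right right_diff_distrib)

lemma hess_mat_diff: "hess_mat a b - hess_mat a' b' = hess_mat (a - a') (b - b')"
  by (simp add: hess_mat_def algebra_simps)

lemma radial_hessian_unit_dir:
  assumes "r > 0"
  shows "radial_hessian a p (r *\<^sub>R unit_dir) = hess_mat a (p / r)"
  using assms
  by (simp add: radial_hessian_def hess_mat_def tensor_def vec_eq_iff power2_eq_square)

lemma hess_mat_projections:
  shows "hess_mat t 0 *v (hess_mat t 0 *v v) = t *\<^sub>R (hess_mat t 0 *v v)"
    and "hess_mat 0 t *v (hess_mat 0 t *v v) = t *\<^sub>R (hess_mat 0 t *v v)"
    and "hess_mat t 0 *v unit_dir = t *\<^sub>R unit_dir"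
  by (simp_all add: hess_mat_mult inner_diff_right algebra_simps)

section \<open>Reduction to the radial equation\<close>

definition clamp_radius :: "real \<Rightarrow> real \<Rightarrow> real" where
  "clamp_radius R r = max 0 (min R r)"

text \<open>The operator on radial functions: \<open>a\<close>, \<open>b\<close>, \<open>p\<close> stand for \<open>u''\<close>, \<open>u' / r\<close>, \<open>u'\<close>. The radius
  is clamped so that the function is defined and continuous for all real \<open>r\<close>.\<close>

definition radial_op :: "real \<Rightarrow> 'n::finite nonlin \<Rightarrow> real \<Rightarrow> real \<Rightarrow> real \<Rightarrow> real \<Rightarrow> real \<Rightarrow> real" where
  "radial_op R F a b p u r =
     F (hess_mat a b) (p *\<^sub>R unit_dir) u (clamp_radius R r *\<^sub>R unit_dir)"

lemma clamp_radius_mem: "R > 0 \<Longrightarrow> clamp_radius R r *\<^sub>R (unit_dir :: real^'n) \<in> cball 0 R"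
  by (auto simp: clamp_radius_def)

lemma clamp_radius_id: "r \<in> {0..R} \<Longrightarrow> clamp_radius R r = r"
  by (auto simp: clamp_radius_def)

text \<open>The arguments are varied separately: an increment in \<open>a\<close> or
  \<open>b\<close> gives a Hessian difference that is a multiple of a projection, for which the
  Pucci bounds are explicit. The dimension enters \<open>K\<close> as a crude bound for
  multiplicities.\<close>

lemma radial_problem_radial_op:
  fixes F :: "'n::finite nonlin"
  assumes R: "R > 0" and cont: "F_continuous R F" and F1: "F1 R F" and F2: "F2 R F"
  shows "\<exists>l K. radial_problem (radial_op R F) R l K"
proof -
  obtain l L \<gamma> \<delta> where c: "0 < l" "l \<le> L" "0 < \<gamma>" "0 < \<delta>"
    and F2': "\<And>M M' p q u v x. M \<in> sym_mats \<Longrightarrow> M' \<in> sym_mats \<Longrightarrow> x \<in> cball 0 R \<Longrightarrow>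
           pucci_minus l L (M - M') - \<gamma> * norm (p - q) - \<delta> * \<bar>u - v\<bar>
             \<le> F M p u x - F M' q v x \<and>
           F M p u x - F M' q v x
             \<le> pucci_plus l L (M - M') + \<gamma> * norm (p - q) + \<delta> * \<bar>u - v\<bar>"
    using F2 unfolding F2_def by metis
  define K where "K = L * real CARD('n) + \<gamma> + \<delta>"
  have LC: "L * real CARD('n) \<le> K" using c by (simp add: K_def)
  have LC0: "L * real CARD('n) \<ge> 0" using c by simp
  have diff: "pucci_minus l L (hess_mat (a - a') (b - b') :: real^'n^'n) \<le>
        radial_op R F a b p u r - radial_op R F a' b' p u r \<and>
      radial_op R F a b p u r - radial_op R F a' b' p u r \<le>
        pucci_plus l L (hess_mat (a - a') (b - b') :: real^'n^'n)" for a a' b b' p u r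
    using F2'[OF hess_mat_sym hess_mat_sym clamp_radius_mem[OF R], of a b a' b' "p *\<^sub>R unit_dir" "p *\<^sub>R unit_dir" u u r]
    by (simp add: radial_op_def hess_mat_diff)
  have proj_a: "hess_mat t 0 *v (hess_mat t 0 *v v) = t *\<^sub>R (hess_mat t 0 *v v)"
    and proj_b: "hess_mat 0 t *v (hess_mat 0 t *v v) = t *\<^sub>R (hess_mat 0 t *v v)"
    and dir: "hess_mat t 0 *v (unit_dir :: real^'n) = t *\<^sub>R unit_dir" for t and v :: "real^'n"
    by (rule hess_mat_projections)+
  have "radial_problem (radial_op R F) R l K"
  proof
    show "continuous_on UNIV (\<lambda>(a, b, p, u, r). radial_op R F a b p u r)"
    proof -
      have m: "continuous_on UNIV (\<lambda>z :: real \<times> real \<times> real \<times> real \<times> real.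
          (hess_mat (fst z) (fst (snd z)) :: real^'n^'n, fst (snd (snd z)) *\<^sub>R (unit_dir :: real^'n),
           fst (snd (snd (snd z))), clamp_radius R (snd (snd (snd (snd z)))) *\<^sub>R (unit_dir :: real^'n)))"
        unfolding hess_mat_def clamp_radius_def by (intro continuous_intros)
      have "continuous_on UNIV (\<lambda>z. (\<lambda>(M, p, u, x). F M p u x)
          (hess_mat (fst z) (fst (snd z)), fst (snd (snd z)) *\<^sub>R unit_dir,
           fst (snd (snd (snd z))), clamp_radius R (snd (snd (snd (snd z)))) *\<^sub>R unit_dir))"
        by (rule continuous_on_compose2[OF cont[unfolded F_continuous_def] m])
          (use R in \<open>auto simp: hess_mat_sym clamp_radius_def\<close>)
      then show ?thesis by (simp add: radial_op_def case_prod_unfold)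
    qed
    show "radial_op R F (s * a) (s * b) (s * p) (s * u) r = s * radial_op R F a b p u r"
      if "s \<ge> 0" for s a b p u r
      using F1[unfolded F1_def, rule_format, OF that hess_mat_sym clamp_radius_mem[OF R],
          of a b "p *\<^sub>R unit_dir" u r]
      by (simp add: radial_op_def hess_mat_scale)
    show "l * (a - a') \<le> radial_op R F a b p u r - radial_op R F a' b p u r"
      if "a' \<le> a" for a' a b p u r
      using diff[of a a' b b p u r]
        pucci_minus_ge[OF proj_a _ c(1,2) unit_dir_nonzero dir, of "a - a'"] that
      by auto
    show "radial_op R F a b p u r - radial_op R F a' b p u r \<le> K * (a - a')"
      if "a' \<le> a" for a' a b p u r
    proof -
      have "radial_op R F a b p u r - radial_op R F a' b p u r \<le> L * real CARD('n) * (a - a')"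
        using diff[of a a' b b p u r] pucci_plus_le[OF proj_a _ c(1,2), of "a - a'"] that by force
      also have "\<dots> \<le> K * (a - a')" using LC that by (intro mult_right_mono) auto
      finally show ?thesis .
    qed
    show "radial_op R F a b' p u r \<le> radial_op R F a b p u r" if "b' \<le> b" for b' b a p u r
      using diff[of a a b b' p u r] pucci_minus_nonneg[OF proj_b _ c(1,2), of "b - b'"] that by force
    show "radial_op R F a b p u r - radial_op R F a b' p u r \<le> K * (b - b')"
      if "b' \<le> b" for b' b a p u r
    proof -
      have "radial_op R F a b p u r - radial_op R F a b' p u r \<le> L * real CARD('n) * (b - b')"
        using diff[of a a b b' p u r] pucci_plus_le[OF proj_b _ c(1,2), of "b - b'"] that by force
      also have "\<dots> \<le> K * (b - b')" using LC that by (intro mult_right_mono) auto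
      finally show ?thesis .
    qed
    show "\<bar>radial_op R F a b p u r - radial_op R F a b p' u' r\<bar> \<le> K * (\<bar>p - p'\<bar> + \<bar>u - u'\<bar>)"
      for a b p u r p' u'
    proof -
      \<comment> \<open>With equal matrices the Pucci terms are those of the zero matrix, obtained
        from the projection bounds with \<open>t = 0\<close>.\<close>
      have "hess_mat 0 0 = (0 :: real^'n^'n)" by (simp add: hess_mat_def)
      then have Z: "pucci_minus l L (0 :: real^'n^'n) \<ge> 0" "pucci_plus l L (0 :: real^'n^'n) \<le> 0"
        using pucci_minus_nonneg[OF proj_a _ c(1,2), of 0] pucci_plus_le[OF proj_a _ c(1,2), of 0]
        by simp_all
      have "norm (p *\<^sub>R unit_dir - p' *\<^sub>R (unit_dir :: real^'n)) = \<bar>p - p'\<bar>"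
        by (simp flip: scaleR_left_diff_distrib)
      then have "\<bar>radial_op R F a b p u r - radial_op R F a b p' u' r\<bar> \<le> \<gamma> * \<bar>p - p'\<bar> + \<delta> * \<bar>u - u'\<bar>"
        using F2'[OF hess_mat_sym hess_mat_sym clamp_radius_mem[OF R],
            of a b a b "p *\<^sub>R unit_dir" "p' *\<^sub>R unit_dir" u u' r] Z
        by (simp add: radial_op_def abs_le_iff)
      also have "\<dots> \<le> K * \<bar>p - p'\<bar> + K * \<bar>u - u'\<bar>"
        using c LC0 by (intro add_mono mult_right_mono) (auto simp: K_def)
      finally show ?thesis by (simp add: distrib_left)
    qed
  qed (use R c in auto)
  then show ?thesis by blast
qed

lemma radial_op_eq:
  fixes F :: "'n::finite nonlin" and x :: "real^'n"
  assumes F4: "F4 R F" and x: "x \<noteq> 0" "norm x \<le> R"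
  shows "F (radial_hessian a p x) ((p / norm x) *\<^sub>R x) u x = radial_op R F a (p / norm x) p u (norm x)"
proof -
  let ?r = "norm x" and ?y = "norm x *\<^sub>R (unit_dir :: real^'n)"
  have "x \<in> cball 0 R - {0}" "?y \<in> cball 0 R - {0}" "norm x = norm ?y" using x by auto
  then have "F (radial_hessian a p x) ((p / norm x) *\<^sub>R x) u x =
      F (radial_hessian a p ?y) ((p / norm ?y) *\<^sub>R ?y) u ?y"
    using F4 unfolding F4_def by blast
  also have "\<dots> = radial_op R F a (p / ?r) p u ?r"
    using x by (simp add: radial_op_def radial_hessian_unit_dir clamp_radius_id)
  finally show ?thesis .
qed

text \<open>Half of the result, for an arbitrary operator so that it can be applied to the reflected
  one as well. The condition \<open>v 0 \<ge> 0\<close> is not strict, so that the two halves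
  together cover every radial eigenfunction.\<close>

definition positive_nodal_sequence ::
  "real \<Rightarrow> 'n::finite nonlin \<Rightarrow> (nat \<Rightarrow> real) \<Rightarrow> (nat \<Rightarrow> real^'n \<Rightarrow> real) \<Rightarrow> bool" where
  "positive_nodal_sequence R F lam U \<longleftrightarrow>
    (\<forall>n. eigenpair R F (lam n) (U n) \<and>
         (\<exists>\<phi> r. has_profile R (U n) \<phi> \<and> interior_zeros R n \<phi> r \<and>
                (\<forall>s\<in>{0<..<first_zero R n r}. \<phi> s > 0))) \<and>
    strict_mono lam \<and>
    (\<forall>\<mu> v. eigenpair R F \<mu> v \<and> radially_symmetric R v \<and> v 0 \<ge> 0 \<longrightarrow>
       (\<exists>n. \<mu> = lam n \<and> same_eigenfunction R v (U n)))"

context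
  fixes F :: "'n::finite nonlin" and R l K :: real
  assumes F4: "F4 R F" and problem: "radial_problem (radial_op R F) R l K"
begin

interpretation radial_problem "radial_op R F" R l K by (rule problem)

section \<open>From radial solutions to eigenfunctions on the ball\<close>

definition radial_sol :: "real \<Rightarrow> real^'n \<Rightarrow> real" where
  "radial_sol \<mu> x = usol (norm x) \<mu>"

lemma radial_sol_has_derivative:
  assumes x: "x \<in> ball 0 R"
  shows "(radial_sol \<mu> has_derivative (\<lambda>h. (bsol (norm x) \<mu> *\<^sub>R x) \<bullet> h)) (at x)"
proof (cases "x = 0")
  case False
  then have "((\<lambda>r. usol r \<mu>) has_real_derivative qsol (norm x) \<mu>) (at (norm x))"
    using x by (intro usol_deriv_at) auto
  from radial_has_derivative[OF this False] show ?thesis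
    using False by (simp add: radial_sol_def[abs_def] qsol_def)
next
  case True
  have "((\<lambda>r. usol r \<mu>) has_real_derivative 0) (at 0 within {0..R})"
    using usol_deriv[of 0 \<mu>] R_pos by simp
  then have lim: "((\<lambda>r. (usol r \<mu> - 1) / r) \<longlongrightarrow> 0) (at 0 within {0..R})"
    by (simp add: has_field_derivative_iff)
  have "filterlim norm (at 0 within {0..R}) (at (0 :: real^'n))"
    unfolding filterlim_at
  proof
    show "\<forall>\<^sub>F x in at (0 :: real^'n). norm x \<in> {0..R} \<and> norm x \<noteq> 0"
      unfolding eventually_at by (rule exI[of _ R]) (use R_pos in auto)
  qed (intro tendsto_norm_zero tendsto_ident_at)
  from filterlim_compose[OF lim this]
  have "((\<lambda>x :: real^'n. (usol (norm x) \<mu> - 1) / norm x) \<longlongrightarrow> 0) (at 0)" .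
  then have "((\<lambda>x :: real^'n. \<bar>(usol (norm x) \<mu> - 1) / norm x\<bar>) \<longlongrightarrow> 0) (at 0)"
    by (rule tendsto_rabs_zero)
  then have "((\<lambda>x. norm (radial_sol \<mu> x - radial_sol \<mu> 0 - 0) / norm (x - 0)) \<longlongrightarrow> 0) (at 0)"
    by (simp add: radial_sol_def abs_divide)
  then show ?thesis using True by (simp add: has_derivative_iff_norm)
qed

lemma grad_radial_sol: "x \<in> ball 0 R \<Longrightarrow> grad (radial_sol \<mu>) x = bsol (norm x) \<mu> *\<^sub>R x"
  by (intro grad_eqI radial_sol_has_derivative)

lemma bsol_scaleR_eq: "bsol (norm x) \<mu> *\<^sub>R x = (qsol (norm x) \<mu> / norm x) *\<^sub>R x" for x :: "real^'n"
  by (cases "x = 0") (simp_all add: qsol_def)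

text \<open>Written with \<open>sgn\<close>, whose value 0 at the origin makes the formula correct
  there as well.\<close>

definition sol_hessian :: "real \<Rightarrow> real^'n \<Rightarrow> real^'n^'n" where
  "sol_hessian \<mu> x = bsol (norm x) \<mu> *\<^sub>R mat 1 +
     (asol (norm x) \<mu> - bsol (norm x) \<mu>) *\<^sub>R tensor (sgn x) (sgn x)"

lemma sol_hessian_eq:
  assumes "x \<noteq> 0"
  shows "sol_hessian \<mu> x = radial_hessian (asol (norm x) \<mu>) (qsol (norm x) \<mu>) x"
proof -
  have "qsol (norm x) \<mu> / norm x = bsol (norm x) \<mu>" using assms by (simp add: qsol_def)
  moreover have "tensor (sgn x) (sgn x) = (1 / (norm x)\<^sup>2) *\<^sub>R tensor x x"
    by (simp add: sgn_div_norm tensor_scaleR power2_eq_square inverse_eq_divide)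
  ultimately show ?thesis
    unfolding sol_hessian_def radial_hessian_def by (simp only: scaleR_scaleR) simp
qed

lemma sol_hessian_0: "sol_hessian \<mu> 0 = hess_mat (bsol 0 \<mu>) (bsol 0 \<mu>)"
  by (simp add: sol_hessian_def asol_0 hess_mat_def)

text \<open>At the origin the gradient is \<open>x\<close> times a merely continuous function. That
  suffices: the normalized remainder is the difference of \<open>bsol\<close> at
  \<open>norm x\<close> and at 0.\<close>

lemma grad_radial_sol_has_derivative:
  assumes x: "x \<in> ball 0 R"
  shows "(grad (radial_sol \<mu>) has_derivative (\<lambda>h. sol_hessian \<mu> x *v h)) (at x)"
proof -
  have "((\<lambda>x. bsol (norm x) \<mu> *\<^sub>R x) has_derivative (\<lambda>h. sol_hessian \<mu> x *v h)) (at x)"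
  proof (cases "x = 0")
    case False
    then have "((\<lambda>r. qsol r \<mu>) has_real_derivative asol (norm x) \<mu>) (at (norm x))"
      using x by (intro qsol_deriv_at) auto
    from radial_grad_has_derivative[OF this False] show ?thesis
      by (simp add: bsol_scaleR_eq sol_hessian_eq[OF False])
  next
    case True
    have "continuous_on UNIV (\<lambda>x :: real^'n. bsol (norm x) \<mu>)"
      by (intro jointly_continuous_compose[OF jointly_continuous_bsol] continuous_intros)
    then have "((\<lambda>x :: real^'n. bsol (norm x) \<mu>) \<longlongrightarrow> bsol (norm (0 :: real^'n)) \<mu>) (at 0)"
      unfolding continuous_on_def by blast
    then have "((\<lambda>x :: real^'n. bsol (norm x) \<mu> - bsol 0 \<mu>) \<longlongrightarrow> 0) (at 0)"
      by (simp add: LIM_zero)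
    then have lim: "((\<lambda>x :: real^'n. \<bar>bsol (norm x) \<mu> - bsol 0 \<mu>\<bar>) \<longlongrightarrow> 0) (at 0)"
      by (rule tendsto_rabs_zero)
    have "((\<lambda>x :: real^'n. norm (bsol (norm x) \<mu> *\<^sub>R x - bsol (norm (0 :: real^'n)) \<mu> *\<^sub>R 0
        - sol_hessian \<mu> 0 *v (x - 0)) / norm (x - 0)) \<longlongrightarrow> 0) (at 0)"
    proof (rule Lim_transform_eventually[OF lim], unfold eventually_at, intro exI[of _ 1] conjI ballI impI)
      fix x :: "real^'n" assume "x \<noteq> 0 \<and> dist x 0 < 1"
      then show "\<bar>bsol (norm x) \<mu> - bsol 0 \<mu>\<bar> = norm (bsol (norm x) \<mu> *\<^sub>R x - bsol (norm (0 :: real^'n)) \<mu> *\<^sub>R 0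
        - sol_hessian \<mu> 0 *v (x - 0)) / norm (x - 0)"
        by (simp add: sol_hessian_0 hess_mat_mult flip: scaleR_left_diff_distrib)
    qed simp
    then show ?thesis
      using True by (simp add: has_derivative_iff_norm)
  qed
  then show ?thesis
    by (rule has_derivative_transform_within_open[OF _ open_ball x]) (simp add: grad_radial_sol)
qed

lemma hessian_radial_sol: "x \<in> ball 0 R \<Longrightarrow> hessian (radial_sol \<mu>) x = sol_hessian \<mu> x"
  by (intro hessian_eqI grad_radial_sol_has_derivative)

text \<open>The direction tensor has no limit at the origin in general, but its entries are bounded
  by 1 and its coefficient \<open>asol - bsol\<close> tends to 0 by \<open>asol_0\<close>.\<close>

lemma continuous_sol_hessian: "continuous_on UNIV (sol_hessian \<mu>)"
proof -
  have b: "continuous_on UNIV (\<lambda>x :: real^'n. bsol (norm x) \<mu>)"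
    by (intro jointly_continuous_compose[OF jointly_continuous_bsol] continuous_intros)
  have a: "continuous_on UNIV (\<lambda>x :: real^'n. asol (norm x) \<mu>)"
    by (intro jointly_continuous_compose[OF jointly_continuous_asol] continuous_intros)
  define d where "d x = asol (norm x) \<mu> - bsol (norm x) \<mu>" for x :: "real^'n"
  have d: "continuous_on UNIV d" unfolding d_def by (intro continuous_intros a b)
  have "continuous (at x) (\<lambda>x. d x *\<^sub>R tensor (sgn x) (sgn x))" for x
  proof (cases "x = 0")
    case False
    then have s: "(sgn \<longlongrightarrow> sgn x) (at x)" by (rule tendsto_sgn[OF tendsto_ident_at])
    have dx: "(d \<longlongrightarrow> d x) (at x)" using d by (simp add: continuous_on_def)
    have "((\<lambda>x. d x *\<^sub>R tensor (sgn x) (sgn x)) \<longlongrightarrow> d x *\<^sub>R tensor (sgn x) (sgn x)) (at x)"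
    proof (intro vec_tendstoI)
      fix i j
      have "((\<lambda>y. d y * (sgn y $ i * sgn y $ j)) \<longlongrightarrow> d x * (sgn x $ i * sgn x $ j)) (at x)"
        by (intro tendsto_mult tendsto_vec_nth s dx)
      then show "((\<lambda>x. (d x *\<^sub>R tensor (sgn x) (sgn x)) $ i $ j) \<longlongrightarrow>
          (d x *\<^sub>R tensor (sgn x) (sgn x)) $ i $ j) (at x)" by (simp add: tensor_def)
    qed
    then show ?thesis by (simp add: continuous_at)
  next
    case True
    have "(d \<longlongrightarrow> d 0) (at 0)" using d by (simp add: continuous_on_def)
    then have d0: "(d \<longlongrightarrow> 0) (at 0)" by (simp add: d_def asol_0)
    have "((\<lambda>x. d x *\<^sub>R tensor (sgn x) (sgn x)) \<longlongrightarrow> 0) (at 0)"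
    proof (intro vec_tendstoI)
      fix i j
      have "norm ((d x *\<^sub>R tensor (sgn x) (sgn x)) $ i $ j) \<le> norm (d x)" for x
      proof -
        have "\<bar>sgn x $ i\<bar> \<le> 1" for i
          using component_le_norm_cart[of "sgn x" i] norm_sgn[of x] by (auto split: if_splits)
        then have "\<bar>sgn x $ i\<bar> * \<bar>sgn x $ j\<bar> \<le> 1 * 1" by (intro mult_mono) auto
        then have "\<bar>d x\<bar> * (\<bar>sgn x $ i\<bar> * \<bar>sgn x $ j\<bar>) \<le> \<bar>d x\<bar> * 1" by (intro mult_left_mono) auto
        then show ?thesis by (simp add: tensor_def abs_mult)
      qed
      then have "\<forall>\<^sub>F x in at 0. norm ((d x *\<^sub>R tensor (sgn x) (sgn x)) $ i $ j) \<le> norm (d x)"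
        by (intro always_eventually allI)
      from Lim_null_comparison[OF this tendsto_norm_zero[OF d0]]
      show "((\<lambda>x. (d x *\<^sub>R tensor (sgn x) (sgn x)) $ i $ j) \<longlongrightarrow> (0 :: real^'n^'n) $ i $ j) (at 0)"
        by simp
    qed
    then show ?thesis using True by (simp add: continuous_at d_def asol_0)
  qed
  then have T: "continuous_on UNIV (\<lambda>x. d x *\<^sub>R tensor (sgn x) (sgn x))"
    by (intro continuous_at_imp_continuous_on) auto
  show ?thesis
    unfolding sol_hessian_def[abs_def]
    by (intro continuous_on_add T[unfolded d_def] continuous_on_scaleR[OF b continuous_on_const])
qed

lemma eigenpair_radial_sol:
  assumes "usol R \<mu> = 0"
  shows "eigenpair R F \<mu> (radial_sol \<mu>)"
  unfolding eigenpair_def C2_on_def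
proof (intro conjI ballI)
  show "radial_sol \<mu> differentiable (at x)" if "x \<in> ball 0 R" for x
    using radial_sol_has_derivative[OF that] differentiableI by blast
  show "grad (radial_sol \<mu>) differentiable (at x)" if "x \<in> ball 0 R" for x
    using grad_radial_sol_has_derivative[OF that] differentiableI by blast
  have "continuous_on (ball 0 R) (sol_hessian \<mu>)"
    by (rule continuous_on_subset[OF continuous_sol_hessian]) simp
  then show "continuous_on (ball 0 R) (hessian (radial_sol \<mu>))"
    by (rule continuous_on_eq) (simp add: hessian_radial_sol)
  show "continuous_on (cball 0 R) (radial_sol \<mu>)"
    unfolding radial_sol_def[abs_def]
    by (intro jointly_continuous_compose[OF jointly_continuous_usol] continuous_intros)
  show "radial_sol \<mu> x = 0" if "x \<in> sphere 0 R" for x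
    using that assms by (simp add: radial_sol_def)
  show "\<exists>x\<in>cball 0 R. radial_sol \<mu> x \<noteq> 0"
    using R_pos by (intro bexI[of _ 0]) (auto simp: radial_sol_def)
  fix x :: "real^'n" assume x: "x \<in> ball 0 R"
  have "F (sol_hessian \<mu> x) (bsol (norm x) \<mu> *\<^sub>R x) (usol (norm x) \<mu>) x = - \<mu> * usol (norm x) \<mu>"
  proof (cases "x = 0")
    \<comment> \<open>\<open>F4\<close> speaks only of points other than 0. Here the Hessian is
      isotropic and the gradient is 0, so the radial equation at radius 0 is the equation
      itself.\<close>
    case True
    then show ?thesis
      using H_sol[of 0 \<mu>] R_pos by (simp add: sol_hessian_0 asol_0 radial_op_def clamp_radius_def)
  next
    case False
    then have "qsol (norm x) \<mu> / norm x = bsol (norm x) \<mu>" by (simp add: qsol_def)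
    then show ?thesis
      using radial_op_eq[OF F4 False, of "asol (norm x) \<mu>" "qsol (norm x) \<mu>" "usol (norm x) \<mu>"] x
        H_sol[of "norm x" \<mu>] False by (simp add: sol_hessian_eq)
  qed
  then show "F (hessian (radial_sol \<mu>) x) (grad (radial_sol \<mu>) x) (radial_sol \<mu> x) x = - \<mu> * radial_sol \<mu> x"
    using x by (simp add: hessian_radial_sol grad_radial_sol radial_sol_def)
qed

text \<open>Nothing is known about the regularity of the given profile, so it is replaced by the
  restriction of \<open>v\<close> to a line through the center. Radial symmetry then recovers the
  full gradient and Hessian from the derivatives on that line.\<close>

lemma eigenpair_solves:
  assumes v: "eigenpair R F \<mu> v" and radial: "radially_symmetric R v"
  shows "solves \<mu> (\<lambda>r. v (r *\<^sub>R unit_dir)) (\<lambda>r. grad v (r *\<^sub>R unit_dir) \<bullet> unit_dir)"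
proof -
  let ?e = "unit_dir :: real^'n"
  define \<phi> where "\<phi> r = v (r *\<^sub>R ?e)" for r
  define q where "q r = grad v (r *\<^sub>R ?e) \<bullet> ?e" for r
  have diff: "v differentiable (at x)" "grad v differentiable (at x)" if "x \<in> ball 0 R" for x
    using v that by (auto simp: eigenpair_def C2_on_def)
  have line: "((\<lambda>r. r *\<^sub>R ?e) has_derivative (\<lambda>h. h *\<^sub>R ?e)) (at r)" for r
    by (auto intro!: derivative_eq_intros)
  have mem: "r *\<^sub>R ?e \<in> ball 0 R" if "\<bar>r\<bar> < R" for r using that by simp
  have d\<phi>: "(\<phi> has_real_derivative q r) (at r)" if "\<bar>r\<bar> < R" for r
    using has_derivative_compose[OF line has_derivative_grad[OF diff(1)[OF mem[OF that]]]]
    unfolding \<phi>_def[abs_def] q_def has_field_derivative_def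
    by (rule has_derivative_eq_rhs) (simp add: fun_eq_iff mult.commute)
  have dq: "(q has_real_derivative (hessian v (r *\<^sub>R ?e) *v ?e) \<bullet> ?e) (at r)" if "\<bar>r\<bar> < R" for r
    using has_derivative_inner_left[OF has_derivative_compose[OF line has_derivative_hessian[OF diff(2)[OF mem[OF that]]]], of ?e]
    unfolding q_def[abs_def] has_field_derivative_def
    by (rule has_derivative_eq_rhs) (simp add: fun_eq_iff matrix_vector_mult_scaleR mult.commute)
  obtain \<psi> where \<psi>: "v x = \<psi> (norm x)" if "x \<in> cball 0 R" for x
    using radial by (auto simp: radially_symmetric_def has_profile_def)
  have prof: "v x = \<phi> (norm x)" if "x \<in> ball 0 R" for x
    using that \<psi>[of x] \<psi>[of "norm x *\<^sub>R ?e"] by (simp add: \<phi>_def)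
  \<comment> \<open>The restriction to the whole diameter is even, which forces its derivative at 0
    to vanish.\<close>
  have even: "\<phi> (- r) = \<phi> r" if "\<bar>r\<bar> < R" for r
    using \<psi>[of "r *\<^sub>R ?e"] \<psi>[of "(- r) *\<^sub>R ?e"] that by (simp add: \<phi>_def)
  have q0: "q 0 = 0"
  proof -
    have "((\<lambda>r. \<phi> (- r)) has_real_derivative - q 0) (at 0)"
      using d\<phi>[of 0] R_pos DERIV_mirror[of \<phi> "q 0" 0] by simp
    then have "(\<phi> has_real_derivative - q 0) (at 0)"
      by (rule has_field_derivative_transform_within_open[where S = "{- R<..<R}"])
        (use R_pos even in auto)
    moreover have "(\<phi> has_real_derivative q 0) (at 0)" using d\<phi>[of 0] R_pos by simp
    ultimately show ?thesis using DERIV_unique by fastforce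
  qed
  have grad_v: "grad v x = (q (norm x) / norm x) *\<^sub>R x" if "x \<in> ball 0 R - {0}" for x
  proof (rule grad_eqI)
    have "(\<phi> has_real_derivative q (norm x)) (at (norm x))" using that by (intro d\<phi>) auto
    then have "((\<lambda>x. \<phi> (norm x)) has_derivative (\<lambda>h. ((q (norm x) / norm x) *\<^sub>R x) \<bullet> h)) (at x)"
      using that by (intro radial_has_derivative) auto
    then show "(v has_derivative (\<lambda>h. ((q (norm x) / norm x) *\<^sub>R x) \<bullet> h)) (at x)"
      by (rule has_derivative_transform_within_open[OF _ open_ball[of 0 R]]) (use that in \<open>auto simp: prof\<close>)
  qed
  have "continuous_on {0..<R} \<phi>" "continuous_on {0..<R} q"
    using d\<phi> dq by (intro continuous_at_imp_continuous_on ballI; force intro: DERIV_isCont)+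
  moreover have "\<exists>a. (q has_real_derivative a) (at r) \<and> radial_op R F a (q r / r) (q r) (\<phi> r) r = - \<mu> * \<phi> r"
    if r: "r \<in> {0<..<R}" for r
  proof -
    let ?x = "r *\<^sub>R ?e"
    define a where "a = (hessian v (r *\<^sub>R ?e) *v ?e) \<bullet> ?e"
    have x: "?x \<in> ball 0 R - {0}" "norm ?x = r" "?x \<noteq> 0" using r by auto
    have a: "(q has_real_derivative a) (at r)" unfolding a_def using r by (intro dq) auto
    have "((\<lambda>x. (q (norm x) / norm x) *\<^sub>R x) has_derivative (\<lambda>h. radial_hessian a (q (norm ?x)) ?x *v h)) (at ?x)"
      using a x by (intro radial_grad_has_derivative) auto
    then have "(grad v has_derivative (\<lambda>h. radial_hessian a (q (norm ?x)) ?x *v h)) (at ?x)"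
      by (rule has_derivative_transform_within_open[OF _ open_delete[OF open_ball, of 0 R 0] x(1)])
        (simp add: grad_v)
    then have hess: "hessian v ?x = radial_hessian a (q r) ?x"
      using x by (intro hessian_eqI) simp
    have "F (hessian v ?x) (grad v ?x) (v ?x) ?x = - \<mu> * v ?x"
      using v x(1) by (simp add: eigenpair_def)
    then have "radial_op R F a (q r / r) (q r) (\<phi> r) r = - \<mu> * \<phi> r"
      using radial_op_eq[OF F4 x(3), of a "q r" "\<phi> r"] x r
      by (simp add: hess grad_v \<phi>_def)
    with a show ?thesis by blast
  qed
  ultimately have "solves \<mu> \<phi> q"
    using q0 d\<phi> by (auto simp: solves_def)
  then show ?thesis by (simp only: \<phi>_def[abs_def] q_def[abs_def])
qed

text \<open>Uniqueness makes \<open>v\<close> the multiple \<open>v 0\<close> of the canonical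
  solution. This excludes \<open>v 0 = 0\<close>, as \<open>v\<close> would vanish identically, and
  carries the boundary condition over to \<open>usol\<close>.\<close>

lemma eigenpair_radial_eq:
  assumes v: "eigenpair R F \<mu> v" and radial: "radially_symmetric R v" and v0: "v 0 \<ge> 0"
  shows "v 0 > 0" and "usol R \<mu> = 0" and "\<forall>x\<in>cball 0 R. v x = v 0 * radial_sol \<mu> x"
proof -
  let ?e = "unit_dir :: real^'n"
  obtain \<psi> where \<psi>: "v x = \<psi> (norm x)" if "x \<in> cball 0 R" for x
    using radial by (auto simp: radially_symmetric_def has_profile_def)
  have prof: "v x = v (norm x *\<^sub>R ?e)" if "x \<in> cball 0 R" for x
    using that \<psi>[of x] \<psi>[of "norm x *\<^sub>R ?e"] by simp
  have eq: "v (r *\<^sub>R ?e) - v 0 * usol r \<mu> = 0" if "r \<in> {0..<R}" for r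
    using solves_eq_usol[OF eigenpair_solves[OF v radial] _ that] v0 by simp
  have "continuous_on {0..R} (\<lambda>r. v (r *\<^sub>R ?e))"
    by (rule continuous_on_compose2[of "cball 0 R" v])
      (use v in \<open>auto simp: eigenpair_def intro!: continuous_intros\<close>)
  then have "continuous_on {0..R} (\<lambda>r. v (r *\<^sub>R ?e) - v 0 * usol r \<mu>)"
    by (intro continuous_intros continuous_sol)
  \<comment> \<open>The identity is known only for radii below \<open>R\<close>; continuity of both
    sides extends it to the boundary.\<close>
  moreover have "{0..R} = closure {0..<R}" using R_pos by simp
  ultimately have cont: "continuous_on (closure {0..<R}) (\<lambda>r. v (r *\<^sub>R ?e) - v 0 * usol r \<mu>)" by simp
  have eq': "v (r *\<^sub>R ?e) = v 0 * usol r \<mu>" if "r \<in> {0..R}" for r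
    using continuous_constant_on_closure[OF cont eq, of r] that R_pos by simp
  show all: "\<forall>x\<in>cball 0 R. v x = v 0 * radial_sol \<mu> x"
  proof
    fix x :: "real^'n" assume x: "x \<in> cball 0 R"
    then show "v x = v 0 * radial_sol \<mu> x"
      using prof[OF x] eq'[of "norm x"] by (simp add: radial_sol_def)
  qed
  have "\<exists>x\<in>cball 0 R. v x \<noteq> 0" using v by (simp add: eigenpair_def)
  with all v0 show pos: "v 0 > 0" by (cases "v 0 = 0") auto
  have "v (R *\<^sub>R ?e) = 0" using v R_pos by (simp add: eigenpair_def)
  with eq'[of R] pos R_pos show "usol R \<mu> = 0" by simp
qed

lemma radial_problem_nodal_sequence: "\<exists>lam U. positive_nodal_sequence R F lam U"
proof -
  obtain lam where lam: "strict_mono lam" "\<And>n. usol R (lam n) = 0"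
    "\<And>n. \<exists>r. interior_zeros R n (\<lambda>s. usol s (lam n)) r \<and>
           (\<forall>s\<in>{0<..<first_zero R n r}. usol s (lam n) > 0)"
    "\<And>\<mu>. usol R \<mu> = 0 \<Longrightarrow> \<exists>n. \<mu> = lam n"
    by (rule nodal_eigenvalues) blast
  have "positive_nodal_sequence R F lam (\<lambda>n. radial_sol (lam n))"
    unfolding positive_nodal_sequence_def
  proof (intro conjI allI impI)
    fix n
    show "eigenpair R F (lam n) (radial_sol (lam n))" by (intro eigenpair_radial_sol lam)
    obtain r where "interior_zeros R n (\<lambda>s. usol s (lam n)) r"
      "\<forall>s\<in>{0<..<first_zero R n r}. usol s (lam n) > 0" using lam(3) by blast
    then show "\<exists>\<phi> r. has_profile R (radial_sol (lam n)) \<phi> \<and> interior_zeros R n \<phi> r \<and>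
        (\<forall>s\<in>{0<..<first_zero R n r}. \<phi> s > 0)"
      by (intro exI[of _ "\<lambda>s. usol s (lam n)"] exI[of _ r]) (simp add: has_profile_def radial_sol_def)
  next
    show "strict_mono lam" by (rule lam)
  next
    fix \<mu> v assume v: "eigenpair R F \<mu> v \<and> radially_symmetric R v \<and> v 0 \<ge> 0"
    then obtain n where "\<mu> = lam n" using lam(4) eigenpair_radial_eq(2)[of \<mu> v] by blast
    moreover have "same_eigenfunction R v (radial_sol \<mu>)"
      unfolding same_eigenfunction_def using v eigenpair_radial_eq(1,3)[of \<mu> v] by blast
    ultimately show "\<exists>n. \<mu> = lam n \<and> same_eigenfunction R v (radial_sol (lam n))" by blast
  qed
  then show ?thesis by blast
qed

end

lemma exists_positive_nodal_sequence:
  assumes "R > 0" "F_continuous R F" "F1 R F" "F2 R F" "F4 R F"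
  shows "\<exists>lam U. positive_nodal_sequence R F lam U"
  using radial_problem_radial_op[OF assms(1-4)] radial_problem_nodal_sequence[OF assms(5)] by blast

section \<open>Negative eigenfunctions by reflection\<close>

definition reflect :: "'n::finite nonlin \<Rightarrow> 'n nonlin" where
  "reflect F = (\<lambda>M p u x. - F (- M) (- p) (- u) x)"

lemma reflect_reflect [simp]: "reflect (reflect F) = F"
  by (simp add: reflect_def)

lemma sym_mats_uminus: "M \<in> sym_mats \<Longrightarrow> - M \<in> sym_mats"
  by (simp add: sym_mats_def vec_eq_iff transpose_def)

lemma F_continuous_reflect:
  fixes F :: "'n::finite nonlin"
  assumes "F_continuous R F"
  shows "F_continuous R (reflect F)"
proof -
  have m: "continuous_on (sym_mats \<times> UNIV \<times> UNIV \<times> cball 0 R)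
      (\<lambda>z :: (real^'n^'n) \<times> (real^'n) \<times> real \<times> (real^'n).
        (- fst z, - fst (snd z), - fst (snd (snd z)), snd (snd (snd z))))"
    by (intro continuous_intros)
  have "continuous_on (sym_mats \<times> UNIV \<times> UNIV \<times> cball 0 R) (\<lambda>z. (\<lambda>(M, p, u, x). F M p u x)
      (- fst z, - fst (snd z), - fst (snd (snd z)), snd (snd (snd z))))"
    by (rule continuous_on_compose2[OF assms[unfolded F_continuous_def] m])
      (auto simp: sym_mats_uminus)
  then show ?thesis
    by (auto simp: F_continuous_def reflect_def case_prod_unfold intro!: continuous_intros)
qed

lemma F1_reflect: "F1 R F \<Longrightarrow> F1 R (reflect F)" for F :: "'n::finite nonlin"
  unfolding F1_def
proof (intro allI ballI impI)
  fix s u :: real and M :: "real^'n^'n" and p x :: "real^'n"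
  assume F: "\<forall>s\<ge>0. \<forall>M\<in>sym_mats. \<forall>p u. \<forall>x\<in>cball 0 R.
        F (s *\<^sub>R M) (s *\<^sub>R p) (s * u) x = s * F M p u x"
    and "s \<ge> 0" "M \<in> sym_mats" "x \<in> cball 0 R"
  then have "F (s *\<^sub>R - M) (s *\<^sub>R - p) (s * - u) x = s * F (- M) (- p) (- u) x"
    using sym_mats_uminus by blast
  then show "reflect F (s *\<^sub>R M) (s *\<^sub>R p) (s * u) x = s * reflect F M p u x"
    by (simp add: reflect_def)
qed

text \<open>The two argument tuples are exchanged as well as negated, so their differences are
  unchanged and the two Pucci operators keep their places.\<close>

lemma F2_reflect:
  assumes "F2 R F"
  shows "F2 R (reflect F)"
proof -
  obtain l L \<gamma> \<delta> where c: "0 < l" "l \<le> L" "0 < \<gamma>" "0 < \<delta>"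
    and F2': "\<And>M M' p q u v x. M \<in> sym_mats \<Longrightarrow> M' \<in> sym_mats \<Longrightarrow> x \<in> cball 0 R \<Longrightarrow>
           pucci_minus l L (M - M') - \<gamma> * norm (p - q) - \<delta> * \<bar>u - v\<bar>
             \<le> F M p u x - F M' q v x \<and>
           F M p u x - F M' q v x
             \<le> pucci_plus l L (M - M') + \<gamma> * norm (p - q) + \<delta> * \<bar>u - v\<bar>"
    using assms unfolding F2_def by metis
  have "pucci_minus l L (M - M') - \<gamma> * norm (p - q) - \<delta> * \<bar>u - v\<bar>
             \<le> reflect F M p u x - reflect F M' q v x \<and>
           reflect F M p u x - reflect F M' q v x
             \<le> pucci_plus l L (M - M') + \<gamma> * norm (p - q) + \<delta> * \<bar>u - v\<bar>"
    if "M \<in> sym_mats" "M' \<in> sym_mats" "x \<in> cball 0 R" for M M' p q u v x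
    using F2'[OF sym_mats_uminus[OF that(2)] sym_mats_uminus[OF that(1)] that(3), of "- q" "- p" "- v" "- u"]
    by (simp add: reflect_def norm_minus_commute)
  with c show ?thesis unfolding F2_def by blast
qed

lemma radial_hessian_uminus: "radial_hessian (- m) (- p) x = - radial_hessian m p x"
proof -
  have eq: "- m - - p / norm x = - (m - p / norm x)" by simp
  show ?thesis
    unfolding radial_hessian_def eq
    by (simp only: minus_divide_left[symmetric] scaleR_minus_left minus_add_distrib)
qed

lemma F4_reflect: "F4 R F \<Longrightarrow> F4 R (reflect F)" for F :: "'n::finite nonlin"
  unfolding F4_def
proof (intro allI ballI impI)
  fix m p u :: real and x y :: "real^'n"
  assume F: "\<forall>m p u. \<forall>x\<in>cball 0 R - {0}. \<forall>y\<in>cball 0 R - {0}. norm x = norm y \<longrightarrow>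
        F (radial_hessian m p x) ((p / norm x) *\<^sub>R x) u x =
        F (radial_hessian m p y) ((p / norm y) *\<^sub>R y) u y"
    and xy: "x \<in> cball 0 R - {0}" "y \<in> cball 0 R - {0}" "norm x = norm y"
  have "F (radial_hessian (- m) (- p) x) ((- p / norm x) *\<^sub>R x) (- u) x =
        F (radial_hessian (- m) (- p) y) ((- p / norm y) *\<^sub>R y) (- u) y"
    using F xy by blast
  then show "reflect F (radial_hessian m p x) ((p / norm x) *\<^sub>R x) u x =
        reflect F (radial_hessian m p y) ((p / norm y) *\<^sub>R y) u y"
    by (simp add: reflect_def radial_hessian_uminus)
qed

text \<open>Negation changes the sign of the function but not the eigenvalue. Since
  \<open>reflect\<close> is an involution, this one direction also leads back from the reflected
  operator.\<close>

lemma eigenpair_reflect: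
  assumes v: "eigenpair R F \<mu> v"
  shows "eigenpair R (reflect F) \<mu> (\<lambda>x. - v x)"
proof -
  have diff: "v differentiable (at x)" "grad v differentiable (at x)" if "x \<in> ball 0 R" for x
    using v that by (auto simp: eigenpair_def C2_on_def)
  have D: "((\<lambda>x. - v x) has_derivative (\<lambda>h. (- grad v x) \<bullet> h)) (at x)" if "x \<in> ball 0 R" for x
    using has_derivative_minus[OF has_derivative_grad[OF diff(1)[OF that]]] by simp
  have grad: "grad (\<lambda>x. - v x) x = - grad v x" if "x \<in> ball 0 R" for x
    using D[OF that] by (rule grad_eqI)
  have D2: "(grad (\<lambda>x. - v x) has_derivative (\<lambda>h. (- hessian v x) *v h)) (at x)" if "x \<in> ball 0 R" for x
  proof -
    have "((\<lambda>x. - grad v x) has_derivative (\<lambda>h. - (hessian v x *v h))) (at x)"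
      by (intro has_derivative_minus has_derivative_hessian diff that)
    then have "(grad (\<lambda>x. - v x) has_derivative (\<lambda>h. - (hessian v x *v h))) (at x)"
      by (rule has_derivative_transform_within_open[OF _ open_ball that]) (simp add: grad)
    moreover have "- (hessian v x *v h) = (- hessian v x) *v h" for h
      using scaleR_mat_mult[of "-1" "hessian v x" h] by simp
    ultimately show ?thesis by simp
  qed
  have hess: "hessian (\<lambda>x. - v x) x = - hessian v x" if "x \<in> ball 0 R" for x
    using D2[OF that] by (rule hessian_eqI)
  have "continuous_on (ball 0 R) (\<lambda>x. - hessian v x)"
    using v by (intro continuous_intros) (simp add: eigenpair_def C2_on_def)
  then have cont_hess: "continuous_on (ball 0 R) (hessian (\<lambda>x. - v x))"
    by (rule continuous_on_eq) (simp add: hess)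
  have diff': "(\<lambda>x. - v x) differentiable (at x)" "grad (\<lambda>x. - v x) differentiable (at x)"
    if "x \<in> ball 0 R" for x
    using D[OF that] D2[OF that] differentiableI by blast+
  have cont: "continuous_on (cball 0 R) (\<lambda>x. - v x)"
    using v by (intro continuous_on_minus) (simp add: eigenpair_def)
  have eq: "reflect F (hessian (\<lambda>x. - v x) x) (grad (\<lambda>x. - v x) x) (- v x) x = - \<mu> * - v x"
    if "x \<in> ball 0 R" for x
    using v that by (simp add: eigenpair_def reflect_def grad hess)
  have zero: "\<forall>x\<in>sphere 0 R. - v x = 0" and nonzero: "\<exists>x\<in>cball 0 R. - v x \<noteq> 0"
    using v unfolding eigenpair_def neg_equal_0_iff_equal by blast+
  show ?thesis
    unfolding eigenpair_def C2_on_def by (intro conjI ballI diff' cont_hess cont eq zero nonzero)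
qed

theorem theorem1p1:
  fixes R :: real and F :: "'n::finite nonlin"
  assumes "R > 0"
    and "F_continuous R F"
    and "F1 R F" and "F2 R F" and "F3 R F" and "F4 R F"
  shows "\<exists>(lp :: nat \<Rightarrow> real) (up :: nat \<Rightarrow> real^'n \<Rightarrow> real)
          (lm :: nat \<Rightarrow> real) (um :: nat \<Rightarrow> real^'n \<Rightarrow> real).
    (\<forall>n. eigenpair R F (lp n) (up n) \<and>
         (\<exists>\<phi> r. has_profile R (up n) \<phi> \<and> interior_zeros R n \<phi> r \<and>
                (\<forall>s\<in>{0<..<first_zero R n r}. \<phi> s > 0))) \<and>
    (\<forall>n. eigenpair R F (lm n) (um n) \<and>
         (\<exists>\<phi> r. has_profile R (um n) \<phi> \<and> interior_zeros R n \<phi> r \<and>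
                (\<forall>s\<in>{0<..<first_zero R n r}. \<phi> s < 0))) \<and>
    strict_mono lp \<and> strict_mono lm \<and>
    (\<forall>\<mu> v. eigenpair R F \<mu> v \<and> radially_symmetric R v \<longrightarrow>
       (\<exists>n. (\<mu> = lp n \<and> same_eigenfunction R v (up n)) \<or>
            (\<mu> = lm n \<and> same_eigenfunction R v (um n))))"
proof -
  obtain lp up where p: "positive_nodal_sequence R F lp up"
    using exists_positive_nodal_sequence assms by blast
  obtain lm um where m: "positive_nodal_sequence R (reflect F) lm um"
    using exists_positive_nodal_sequence[OF assms(1) F_continuous_reflect F1_reflect F2_reflect F4_reflect]
      assms by blast
  have neg: "eigenpair R F (lm n) (\<lambda>x. - um n x) \<and>
         (\<exists>\<phi> r. has_profile R (\<lambda>x. - um n x) \<phi> \<and> interior_zeros R n \<phi> r \<and>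
                (\<forall>s\<in>{0<..<first_zero R n r}. \<phi> s < 0))" for n
  proof
    \<comment> \<open>Reflecting the reflected operator gives \<open>F\<close> again.\<close>
    show "eigenpair R F (lm n) (\<lambda>x. - um n x)"
      using eigenpair_reflect[of R "reflect F" "lm n" "um n"] m
      by (simp add: positive_nodal_sequence_def)
    obtain \<phi> r where \<phi>: "has_profile R (um n) \<phi>" "interior_zeros R n \<phi> r"
      "\<forall>s\<in>{0<..<first_zero R n r}. \<phi> s > 0"
      using m unfolding positive_nodal_sequence_def by blast
    then show "\<exists>\<phi> r. has_profile R (\<lambda>x. - um n x) \<phi> \<and> interior_zeros R n \<phi> r \<and>
                (\<forall>s\<in>{0<..<first_zero R n r}. \<phi> s < 0)"
      by (intro exI[of _ "\<lambda>s. - \<phi> s"] exI[of _ r]) (simp add: has_profile_def interior_zeros_def)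
  qed
  have complete: "\<exists>n. (\<mu> = lp n \<and> same_eigenfunction R v (up n)) \<or>
            (\<mu> = lm n \<and> same_eigenfunction R v (\<lambda>x. - um n x))"
    if v: "eigenpair R F \<mu> v" "radially_symmetric R v" for \<mu> v
  proof (cases "v 0 \<ge> 0")
    case True
    then show ?thesis using p v unfolding positive_nodal_sequence_def by blast
  next
    case False
    have "radially_symmetric R (\<lambda>x. - v x)"
    proof -
      obtain \<phi> where "has_profile R v \<phi>" using v(2) by (auto simp: radially_symmetric_def)
      then have "has_profile R (\<lambda>x. - v x) (\<lambda>s. - \<phi> s)" by (simp add: has_profile_def)
      then show ?thesis unfolding radially_symmetric_def by blast
    qed
    moreover have "eigenpair R (reflect F) \<mu> (\<lambda>x. - v x)" using v(1) by (rule eigenpair_reflect)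
    ultimately obtain n where n: "\<mu> = lm n" "same_eigenfunction R (\<lambda>x. - v x) (um n)"
      using m False unfolding positive_nodal_sequence_def
      by (metis linorder_not_le neg_0_le_iff_le order_less_imp_le)
    then obtain c where "c > 0" "\<forall>x\<in>cball 0 R. - v x = c * um n x"
      by (auto simp: same_eigenfunction_def)
    then have "same_eigenfunction R v (\<lambda>x. - um n x)"
      unfolding same_eigenfunction_def
      by (intro exI[of _ c]) (metis minus_equation_iff mult_minus_right)
    with n(1) show ?thesis by blast
  qed
  show ?thesis
  proof (rule exI[of _ lp], rule exI[of _ up], rule exI[of _ lm], rule exI[of _ "\<lambda>n x. - um n x"], intro conjI)
    show "strict_mono lp" by (rule p[unfolded positive_nodal_sequence_def, THEN conjunct2, THEN conjunct1])
    show "strict_mono lm" by (rule m[unfolded positive_nodal_sequence_def, THEN conjunct2, THEN conjunct1])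
  qed (rule p[unfolded positive_nodal_sequence_def, THEN conjunct1], rule allI, rule neg,
      intro allI impI, elim conjE, rule complete)
qed

end
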